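(* Let $V$ be a finite dimensional symplectic vector space over $\mathbb{C}$ and let $g,h\in\mathrm{Sp}(V)$ be contained in a compact subgroup of $\mathrm{Sp}(V)$. If $V_g+V_h=V$, then $$\mu_{gh}=\mu_g\wedge\mu_h,$$ where $\mu_g,\mu_h$ are interpreted as exterior forms on $V_{gh}^\perp$ using its direct sum decomposition $V_{gh}^\perp=V_g^\perp\oplus V_h^\perp$ (which holds under this hypothesis).
   Context: The symplectic structure on $V$ is defined by a nondegenerate element $\pi\in\bigwedge^2V$. For $g\in\mathrm{Sp}(V)$ contained in a compact subgroup, $V_g\subset V$ denotes the subspace of $g$-invariants and $V_g^\perp\subset V^*$ its orthogonal complement (annihilator); under the isomorphism $\pi:V^*\cong V$ the space $V_g^\perp$ is identified with $\mathrm{Im}(1-g)$. Put $d_g=\tfrac12\dim V_g^\perp$. Let $\pi_g^\perp$ be the restriction of $\pi$ to $V_g^\perp$ (a symplectic form on $V_g^\perp$), and let $$\psi_g=\frac{1}{d_g!}(\pi_g^\perp)^{d_g},$$ the top exterior power of $\pi_g^\perp$ (a volume form on $V_g^\perp$). Set $$\mu_g=\det\big((1-g)|_{V_g^\perp}\big)^{1/2}\,\psi_g.$$ The determinant is a positive real number, since the eigenvalues of $g$ have absolute value $1$ and occur in pairs $\lambda,\lambda^{-1}$; the positive square root is taken.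
   Formalization: Here μ_g, μ_h become forms on V_gh^⊥ by pullback along the π-orthogonal projections onto V_g^⊥, V_h^⊥, not the direct-sum projections; with the latter the identity fails (e.g. dim V=4) unless the summands are π-orthogonal, when both readings agree. *)

theory Defs
  imports
    "HOL-Analysis.Analysis"
    "HOL-Library.Function_Algebras"
    "HOL-Algebra.Group"
    "Jordan_Normal_Form.Determinant"
begin

section \<open>The dual space and symplectic structures\<close>

definition fscale :: "complex \<Rightarrow> ('v \<Rightarrow> complex) \<Rightarrow> ('v \<Rightarrow> complex)" where
  "fscale c \<phi> = (\<lambda>v. c * \<phi> v)"

text \<open>The dual \<open>V*\<close> is a subspace of the complex vector space of all functions on \<open>V\<close>
  (with pointwise addition and \<open>fscale\<close>).\<close>

definition dual :: "(complex \<Rightarrow> 'v::ab_group_add \<Rightarrow> 'v) \<Rightarrow> ('v \<Rightarrow> complex) set" where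
  "dual scl = {\<phi>. Vector_Spaces.linear scl (*) \<phi>}"

text \<open>For finite-dimensional \<open>V\<close>, elements of the second exterior power of \<open>V\<close> are the
  alternating bilinear forms on \<open>V*\<close>; only the values of \<open>\<pi>\<close> on \<open>V*\<close> matter.\<close>

definition symplectic ::
  "(complex \<Rightarrow> 'v::ab_group_add \<Rightarrow> 'v) \<Rightarrow> (('v \<Rightarrow> complex) \<Rightarrow> ('v \<Rightarrow> complex) \<Rightarrow> complex) \<Rightarrow> bool"
  where
  "symplectic scl \<pi> \<longleftrightarrow>
     (\<forall>\<phi>\<in>dual scl. \<forall>\<phi>'\<in>dual scl. \<forall>\<psi>\<in>dual scl.
        \<pi> (\<phi> + \<phi>') \<psi> = \<pi> \<phi> \<psi> + \<pi> \<phi>' \<psi> \<and> \<pi> \<psi> (\<phi> + \<phi>') = \<pi> \<psi> \<phi> + \<pi> \<psi> \<phi>') \<and>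
     (\<forall>c. \<forall>\<phi>\<in>dual scl. \<forall>\<psi>\<in>dual scl.
        \<pi> (fscale c \<phi>) \<psi> = c * \<pi> \<phi> \<psi> \<and> \<pi> \<phi> (fscale c \<psi>) = c * \<pi> \<phi> \<psi>) \<and>
     (\<forall>\<phi>\<in>dual scl. \<pi> \<phi> \<phi> = 0) \<and>
     (\<forall>\<phi>\<in>dual scl. (\<forall>\<psi>\<in>dual scl. \<pi> \<phi> \<psi> = 0) \<longrightarrow> \<phi> = 0)"

definition Sp ::
  "(complex \<Rightarrow> 'v::ab_group_add \<Rightarrow> 'v) \<Rightarrow> (('v \<Rightarrow> complex) \<Rightarrow> ('v \<Rightarrow> complex) \<Rightarrow> complex) \<Rightarrow>
   ('v \<Rightarrow> 'v) monoid" where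
  "Sp scl \<pi> =
     \<lparr>carrier = {g. Vector_Spaces.linear scl scl g \<and> bij g \<and>
                   (\<forall>\<phi>\<in>dual scl. \<forall>\<psi>\<in>dual scl. \<pi> (\<phi> \<circ> g) (\<psi> \<circ> g) = \<pi> \<phi> \<psi>)},
      mult = (\<circ>), one = id\<rparr>"

text \<open>The topology of the finite-dimensional space \<open>End V\<close> is the coarsest one for which all matrix
  coefficients \<open>A \<mapsto> \<phi> (A v)\<close> are continuous, i.e. it is induced from the product topology
  by the injection \<open>matrix_coeffs\<close>.\<close>

definition matrix_coeffs ::
  "(complex \<Rightarrow> 'v::ab_group_add \<Rightarrow> 'v) \<Rightarrow> ('v \<Rightarrow> 'v) \<Rightarrow> ('v \<Rightarrow> complex) \<times> 'v \<Rightarrow> complex" where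
  "matrix_coeffs scl A = (\<lambda>(\<phi>, v). if \<phi> \<in> dual scl then \<phi> (A v) else 0)"

definition compact_subgroup_Sp ::
  "(complex \<Rightarrow> 'v::ab_group_add \<Rightarrow> 'v) \<Rightarrow> (('v \<Rightarrow> complex) \<Rightarrow> ('v \<Rightarrow> complex) \<Rightarrow> complex) \<Rightarrow>
   ('v \<Rightarrow> 'v) set \<Rightarrow> bool" where
  "compact_subgroup_Sp scl \<pi> K \<longleftrightarrow>
     subgroup K (Sp scl \<pi>) \<and> compact (matrix_coeffs scl ` K)"

section \<open>Invariants and their annihilators\<close>

definition invariants :: "('v \<Rightarrow> 'v) \<Rightarrow> 'v set" where
  "invariants g = {v. g v = v}"

definition inv_perp ::
  "(complex \<Rightarrow> 'v::ab_group_add \<Rightarrow> 'v) \<Rightarrow> ('v \<Rightarrow> 'v) \<Rightarrow> ('v \<Rightarrow> complex) set" where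
  "inv_perp scl g = {\<phi> \<in> dual scl. \<forall>v\<in>invariants g. \<phi> v = 0}"

definition half_dim :: "(complex \<Rightarrow> 'v::ab_group_add \<Rightarrow> 'v) \<Rightarrow> ('v \<Rightarrow> 'v) \<Rightarrow> nat" where
  "half_dim scl g = vector_space.dim fscale (inv_perp scl g) div 2"

text \<open>The contragredient action, for which \<open>\<pi> : V* \<cong> V\<close> is equivariant.\<close>

definition dual_act :: "('v \<Rightarrow> 'v) \<Rightarrow> ('v \<Rightarrow> complex) \<Rightarrow> ('v \<Rightarrow> complex)" where
  "dual_act g \<phi> = \<phi> \<circ> inv_into UNIV g"

text \<open>Determinant of the restriction of \<open>f\<close> to a finite-dimensional \<open>f\<close>-invariant subspace \<open>W\<close>:
  the determinant of its matrix in some ordered basis \<open>bs\<close> of \<open>W\<close>.\<close>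

definition det_on ::
  "(complex \<Rightarrow> 'w::ab_group_add \<Rightarrow> 'w) \<Rightarrow> 'w set \<Rightarrow> ('w \<Rightarrow> 'w) \<Rightarrow> complex" where
  "det_on sc W f =
     (let bs = (SOME bs. distinct bs \<and> \<not> Modules.module.dependent sc (set bs) \<and>
                         Modules.module.span sc (set bs) = W);
          n = length bs
      in Determinant.det
           (Matrix.mat n n (\<lambda>(i, j). Modules.module.representation sc (set bs) (f (bs ! j)) (bs ! i))))"

section \<open>Exterior forms\<close>

text \<open>An inhomogeneous exterior form on a space \<open>W\<close> is encoded by one function on lists over \<open>W\<close>;
  its values on lists of length \<open>k\<close> are the component of degree \<open>k\<close>. In the wedge product \<open>S\<close> ranges
  over the sets of positions handed to the first factor, and the sign is that of the corresponding
  shuffle; thus \<open>\<alpha> \<and> \<beta>\<close> of two 1-forms takes the value \<open>\<alpha> x * \<beta> y - \<alpha> y * \<beta> x\<close> on \<open>[x, y]\<close>.\<close>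

definition wedge :: "('w list \<Rightarrow> complex) \<Rightarrow> ('w list \<Rightarrow> complex) \<Rightarrow> 'w list \<Rightarrow> complex" where
  "wedge \<alpha> \<beta> xs =
     (\<Sum>S\<in>Pow {..<length xs}.
        (-1) ^ card {(i, j). i \<in> S \<and> j \<in> {..<length xs} - S \<and> j < i} *
        \<alpha> (nths xs S) * \<beta> (nths xs ({..<length xs} - S)))"

fun wedge_power :: "('w list \<Rightarrow> complex) \<Rightarrow> nat \<Rightarrow> 'w list \<Rightarrow> complex" where
  "wedge_power \<alpha> 0 = (\<lambda>xs. if xs = [] then 1 else 0)"
| "wedge_power \<alpha> (Suc d) = wedge \<alpha> (wedge_power \<alpha> d)"

definition restricted_two_form :: "('w \<Rightarrow> 'w \<Rightarrow> complex) \<Rightarrow> 'w set \<Rightarrow> 'w list \<Rightarrow> complex" where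
  "restricted_two_form \<pi> W xs =
     (if length xs = 2 \<and> set xs \<subseteq> W then \<pi> (xs ! 0) (xs ! 1) else 0)"

definition psi ::
  "(complex \<Rightarrow> 'v::ab_group_add \<Rightarrow> 'v) \<Rightarrow> (('v \<Rightarrow> complex) \<Rightarrow> ('v \<Rightarrow> complex) \<Rightarrow> complex) \<Rightarrow>
   ('v \<Rightarrow> 'v) \<Rightarrow> ('v \<Rightarrow> complex) list \<Rightarrow> complex" where
  "psi scl \<pi> g xs =
     1 / fact (half_dim scl g) *
     wedge_power (restricted_two_form \<pi> (inv_perp scl g)) (half_dim scl g) xs"

text \<open>\<open>csqrt\<close> is the principal square root, hence the positive one on positive reals.\<close>

definition mu ::
  "(complex \<Rightarrow> 'v::ab_group_add \<Rightarrow> 'v) \<Rightarrow> (('v \<Rightarrow> complex) \<Rightarrow> ('v \<Rightarrow> complex) \<Rightarrow> complex) \<Rightarrow>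
   ('v \<Rightarrow> 'v) \<Rightarrow> ('v \<Rightarrow> complex) list \<Rightarrow> complex" where
  "mu scl \<pi> g xs =
     csqrt (det_on fscale (inv_perp scl g) (\<lambda>\<phi>. \<phi> - dual_act g \<phi>)) * psi scl \<pi> g xs"

text \<open>Let \<open>U\<close> be a direct summand of \<open>W\<close> on which \<open>\<pi>\<close> is nondegenerate, as it is on \<open>W\<close>. A form on
  \<open>U\<close> becomes a form on \<open>W\<close> along \<open>U* \<cong> U \<subseteq> W \<cong> W*\<close>, where the isomorphisms are given by \<open>\<pi>\<close> on
  \<open>U\<close> and on \<open>W\<close> and the inclusion is that of the summand. This embedding sends \<open>\<pi>(u, _)\<close> on \<open>U\<close>
  to \<open>\<pi>(u, _)\<close> on \<open>W\<close>; on exterior forms it is the pullback under the \<open>\<pi>\<close>-orthogonal projection onto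
  \<open>U\<close>. For \<open>U = V\<^sub>g\<^sup>\<bottom>\<close> this is the extension by zero along the \<open>g\<close>-invariants of \<open>V*\<close>. It differs
  from the pullback under the projection with kernel the other summand \<open>U'\<close>, unless \<open>U\<close> and \<open>U'\<close>
  are \<open>\<pi>\<close>-orthogonal; with that pullback, and the exponent \<open>1/2\<close> in \<open>mu\<close>, the product formula
  \<open>\<mu>\<^sub>g\<^sub>h = \<mu>\<^sub>g \<and> \<mu>\<^sub>h\<close> fails already for \<open>dim V = 4\<close>.\<close>

definition symplectic_proj :: "('w \<Rightarrow> 'w \<Rightarrow> complex) \<Rightarrow> 'w set \<Rightarrow> 'w \<Rightarrow> 'w" where
  "symplectic_proj \<pi> U x = (THE u. u \<in> U \<and> (\<forall>w\<in>U. \<pi> w u = \<pi> w x))"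

definition extend_form ::
  "('w \<Rightarrow> 'w \<Rightarrow> complex) \<Rightarrow> 'w set \<Rightarrow> ('w list \<Rightarrow> complex) \<Rightarrow> 'w list \<Rightarrow> complex" where
  "extend_form \<pi> U \<alpha> xs = \<alpha> (map (symplectic_proj \<pi> U) xs)"

end

theory Submission
  imports Defs
begin

text \<open>Write \<open>A\<close>, \<open>B\<close> for the actions of \<open>g\<close>, \<open>h\<close> on \<open>V*\<close>, and \<open>P\<^sub>g\<close>, \<open>P\<^sub>h\<close> for the \<open>\<pi>\<close>-orthogonal projections
  onto \<open>V\<^sub>g\<^sup>\<bottom> = Im (1 - A)\<close> and \<open>V\<^sub>h\<^sup>\<bottom> = Im (1 - B)\<close>. On \<open>V\<^sub>g\<^sub>h\<^sup>\<bottom> = V\<^sub>g\<^sup>\<bottom> \<oplus> V\<^sub>h\<^sup>\<bottom>\<close> one has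
  \<open>1 - A B = (1 - A) P\<^sub>g + A (1 - B) P\<^sub>h = L \<Psi>\<close>, where \<open>\<Psi> = P\<^sub>g + P\<^sub>h\<close> and \<open>L\<close> is block triangular for the
  decomposition, with diagonal blocks \<open>1 - A\<close> and \<open>1 - B\<close>. So
  \<open>det (1 - A B) = det (1 - A) det (1 - B) det \<Psi>\<close>. On a basis made of symplectic bases of the two summands,
  \<open>\<psi>\<^sub>g \<and> \<psi>\<^sub>h\<close> takes the value \<open>det \<Psi>\<close>, whereas \<open>\<psi>\<^sub>g\<^sub>h\<close> takes as its value the Pfaffian of \<open>\<pi>\<close>, whose
  square is \<open>det \<Psi>\<close>. It remains to see that the Pfaffian and the determinants are positive. This follows by
  deformation from the existence of a positive definite Hermitian form invariant under the
  compact group.\<close>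

section \<open>The wedge product\<close>

text \<open>What ties the Pfaffian to positivity is that the fixed space of an isometry A is
  orthogonal to Im (1 - A) for \<pi> and for the invariant Hermitian form H, so P_g is the
  orthogonal projection for both. Hence a single \<Psi> compares either form with the orthogonal sum
  of its restrictions: F(x, y) = F_split(\<Psi> x, y) for F = \<pi> and F = H, and along the segment
  from F_split to F the same holds with (1 - t) + t \<Psi>. For H the segment stays positive
  definite by convexity, so these maps are invertible with real determinant. For \<pi>, whose
  segment could a priori degenerate, this gives nondegeneracy, and the square of the Pfaffian is
  real and never 0. Starting from 1, the square and then the Pfaffian itself stay positive.

  The dual sits in the space of all functions on V, in general infinite dimensional, so the linear
  algebra is relative to a subspace W. \<open>det_on\<close> is handled only through its effect on
  alternating forms of top degree and on Gram determinants, and block matrices never appear. H comes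
  from a fixed point argument instead of Haar integration.\<close>

lemma wedge_Nil [simp]: "wedge \<alpha> \<beta> [] = \<alpha> [] * \<beta> []"
  by (simp add: wedge_def)

text \<open>Induction over argument lists needs the sets of positions sorted by whether they contain
  the first position.\<close>

lemma Pow_lessThan_Suc_split:
  "Pow {..<Suc n} = (\<lambda>S. Suc ` S) ` Pow {..<n} \<union> (\<lambda>S. insert 0 (Suc ` S)) ` Pow {..<n}"
proof (intro equalityI subsetI)
  fix S assume "S \<in> Pow {..<Suc n}"
  then have S: "S \<subseteq> insert 0 (Suc ` {..<n})"
    by (simp add: lessThan_Suc_eq_insert_0)
  define T where "T = {j. Suc j \<in> S}"
  have "T \<in> Pow {..<n}" using S by (auto simp: T_def)
  moreover have "S = Suc ` T \<or> S = insert 0 (Suc ` T)"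
    using S by (auto simp: T_def image_iff)
  ultimately show "S \<in> (\<lambda>S. Suc ` S) ` Pow {..<n} \<union> (\<lambda>S. insert 0 (Suc ` S)) ` Pow {..<n}"
    by blast
qed (auto simp: lessThan_Suc_eq_insert_0)

text \<open>Contraction with x is an antiderivation: x goes to one of the two factors. Handing it to
  the second one moves it across every argument of the first; as forms are inhomogeneous, the sign
  is attached to \<alpha> list by list. Later facts that depend on the shuffle signs are derived
  from this recursion.\<close>

lemma wedge_Cons:
  "wedge \<alpha> \<beta> (x # xs) =
     wedge (\<lambda>l. \<alpha> (x # l)) \<beta> xs + wedge (\<lambda>l. (-1) ^ length l * \<alpha> l) (\<lambda>l. \<beta> (x # l)) xs"
proof -
  let ?n = "length xs"
  define sh where "sh S = Suc ` S" for S :: "nat set"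
  define ivs where "ivs n S = {(i, j). i \<in> S \<and> j \<in> {..<n} - S \<and> j < i}" for n :: nat and S :: "nat set"
  define t where "t S = (-1) ^ card (ivs (Suc ?n) S) * \<alpha> (nths (x # xs) S) *
                          \<beta> (nths (x # xs) ({..<Suc ?n} - S))" for S
  have W: "wedge \<alpha> \<beta> (x # xs) = sum t (Pow {..<Suc ?n})"
    by (simp add: wedge_def t_def ivs_def)
  have V: "wedge \<gamma> \<delta> xs = (\<Sum>S\<in>Pow {..<?n}. (-1) ^ card (ivs ?n S) *
      \<gamma> (nths xs S) * \<delta> (nths xs ({..<?n} - S)))" for \<gamma> \<delta>
    by (simp add: wedge_def ivs_def)
  have fin: "finite (ivs n S)" if "S \<subseteq> {..<n}" for n S
    by (rule finite_subset[of _ "{..<n} \<times> {..<n}"]) (use that in \<open>auto simp: ivs_def\<close>)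
  have inj1: "inj_on sh (Pow {..<?n})" unfolding sh_def by (metis inj_image_eq_iff inj_onI inj_Suc)
  have inj2: "inj_on (\<lambda>S. insert 0 (sh S)) (Pow {..<?n})"
    unfolding sh_def by (rule inj_onI) (metis (no_types, lifting) image_iff insert_ident inj_image_eq_iff inj_Suc nat.distinct(1))
  have disj: "sh ` Pow {..<?n} \<inter> (\<lambda>S. insert 0 (sh S)) ` Pow {..<?n} = {}"
    by (auto simp: sh_def)
  have n1: "nths (x # xs) (sh S) = nths xs S" for S
    by (simp add: nths_Cons sh_def image_iff)
  have n2: "nths (x # xs) (insert 0 (sh S)) = x # nths xs S" for S
    by (simp add: nths_Cons sh_def image_iff)
  have n3: "nths (x # xs) ({..<Suc ?n} - sh S) = x # nths xs ({..<?n} - S)" for S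
    by (auto simp: nths_Cons sh_def image_iff intro!: arg_cong[of _ _ "nths xs"])
  have n4: "nths (x # xs) ({..<Suc ?n} - insert 0 (sh S)) = nths xs ({..<?n} - S)" for S
    by (auto simp: nths_Cons sh_def image_iff intro!: arg_cong[of _ _ "nths xs"])
  have i2: "card (ivs (Suc ?n) (insert 0 (sh S))) = card (ivs ?n S)" for S
  proof -
    have "ivs (Suc ?n) (insert 0 (sh S)) = (\<lambda>(i, j). (Suc i, Suc j)) ` ivs ?n S"
      by (auto simp: ivs_def sh_def image_iff Bex_def) (metis lessE less_Suc_eq_0_disj not_less_eq)+
    moreover have "inj_on (\<lambda>(i, j). (Suc i, Suc j)) (ivs ?n S)" by (auto simp: inj_on_def)
    ultimately show ?thesis by (simp add: card_image)
  qed
  \<comment> \<open>Position 0 goes to the second factor, so it forms an inversion with each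
    position handed to the first.\<close>
  have i1: "card (ivs (Suc ?n) (sh S)) = length (nths xs S) + card (ivs ?n S)" if "S \<subseteq> {..<?n}" for S
  proof -
    have eq: "ivs (Suc ?n) (sh S) = (\<lambda>i. (Suc i, 0)) ` S \<union> (\<lambda>(i, j). (Suc i, Suc j)) ` ivs ?n S"
      by (auto simp: ivs_def sh_def image_iff Bex_def) (metis lessE less_Suc_eq_0_disj not_less_eq)+
    have "finite S" using that finite_subset by blast
    have "card (ivs (Suc ?n) (sh S)) = card ((\<lambda>i. (Suc i, 0::nat)) ` S) + card ((\<lambda>(i, j). (Suc i, Suc j)) ` ivs ?n S)"
      unfolding eq by (rule card_Un_disjoint) (use \<open>finite S\<close> fin[OF that] in auto)
    moreover have "card ((\<lambda>i. (Suc i, 0::nat)) ` S) = card S" by (rule card_image) (auto simp: inj_on_def)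
    moreover have "card ((\<lambda>(i, j). (Suc i, Suc j)) ` ivs ?n S) = card (ivs ?n S)"
      by (rule card_image) (auto simp: inj_on_def)
    moreover have "length (nths xs S) = card S"
      unfolding length_nths by (rule arg_cong[of _ _ card]) (use that in auto)
    ultimately show ?thesis by simp
  qed
  have "sum t (Pow {..<Suc ?n}) = sum t (sh ` Pow {..<?n}) + sum t ((\<lambda>S. insert 0 (sh S)) ` Pow {..<?n})"
    unfolding Pow_lessThan_Suc_split sh_def[symmetric]
    by (rule sum.union_disjoint) (use disj in auto)
  also have "sum t (sh ` Pow {..<?n}) = (\<Sum>S\<in>Pow {..<?n}. t (sh S))"
    by (simp add: sum.reindex[OF inj1])
  also have "\<dots> = wedge (\<lambda>l. (-1) ^ length l * \<alpha> l) (\<lambda>l. \<beta> (x # l)) xs"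
    unfolding V by (rule sum.cong) (simp_all add: t_def n1 n3 i1 power_add)
  also have "sum t ((\<lambda>S. insert 0 (sh S)) ` Pow {..<?n}) = (\<Sum>S\<in>Pow {..<?n}. t (insert 0 (sh S)))"
    by (simp add: sum.reindex[OF inj2])
  also have "\<dots> = wedge (\<lambda>l. \<alpha> (x # l)) \<beta> xs"
    unfolding V by (rule sum.cong) (simp_all add: t_def n2 n4 i2)
  finally show ?thesis using W by simp
qed

lemma wedge_cong:
  assumes "\<And>l. set l \<subseteq> set xs \<Longrightarrow> \<alpha> l = \<alpha>' l" "\<And>l. set l \<subseteq> set xs \<Longrightarrow> \<beta> l = \<beta>' l"
  shows "wedge \<alpha> \<beta> xs = wedge \<alpha>' \<beta>' xs"
  unfolding wedge_def by (rule sum.cong) (auto simp: assms set_nths_subset)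

lemma wedge_lincomb_left:
  "wedge (\<lambda>l. c * \<alpha> l + \<alpha>' l) \<beta> xs = c * wedge \<alpha> \<beta> xs + wedge \<alpha>' \<beta> xs"
  unfolding wedge_def by (simp add: sum_distrib_left sum.distrib[symmetric] algebra_simps)

lemma wedge_lincomb_right:
  "wedge \<alpha> (\<lambda>l. c * \<beta> l + \<beta>' l) xs = c * wedge \<alpha> \<beta> xs + wedge \<alpha> \<beta>' xs"
  unfolding wedge_def by (simp add: sum_distrib_left sum.distrib[symmetric] algebra_simps)

lemma wedge_scale: "wedge (\<lambda>l. c * \<alpha> l) (\<lambda>l. d * \<beta> l) xs = c * d * wedge \<alpha> \<beta> xs"
  unfolding wedge_def by (simp add: sum_distrib_left algebra_simps)

lemma wedge_zero_left: "(\<And>l. set l \<subseteq> set xs \<Longrightarrow> \<alpha> l = 0) \<Longrightarrow> wedge \<alpha> \<beta> xs = 0"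
  unfolding wedge_def by (intro sum.neutral) (auto simp: set_nths_subset)

lemma wedge_zero_right: "(\<And>l. set l \<subseteq> set xs \<Longrightarrow> \<beta> l = 0) \<Longrightarrow> wedge \<alpha> \<beta> xs = 0"
  unfolding wedge_def by (intro sum.neutral) (auto simp: set_nths_subset)

lemma wedge_minus_left: "wedge (\<lambda>l. - \<alpha> l) \<beta> xs = - wedge \<alpha> \<beta> xs"
  unfolding wedge_def by (simp add: sum_negf)

lemma wedge_map: "wedge \<alpha> \<beta> (map f xs) = wedge (\<lambda>l. \<alpha> (map f l)) (\<lambda>l. \<beta> (map f l)) xs"
  unfolding wedge_def by (simp add: nths_map)

lemma wedge_length_zero:
  assumes "\<And>l. length l \<noteq> m \<Longrightarrow> \<alpha> l = 0" "\<And>l. length l \<noteq> k \<Longrightarrow> \<beta> l = 0" "length xs \<noteq> m + k"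
  shows "wedge \<alpha> \<beta> xs = 0"
  unfolding wedge_def
proof (rule sum.neutral, rule ballI)
  fix S assume S: "S \<in> Pow {..<length xs}"
  have "length (nths xs S) = card S" "length (nths xs ({..<length xs} - S)) = card ({..<length xs} - S)"
    unfolding length_nths by (rule arg_cong[of _ _ card], use S in auto)+
  moreover have "card S + card ({..<length xs} - S) = length xs"
    using S by (metis PowD card_Diff_subset card_lessThan card_mono finite_lessThan finite_subset
        le_add_diff_inverse)
  ultimately have "length (nths xs S) \<noteq> m \<or> length (nths xs ({..<length xs} - S)) \<noteq> k"
    using assms(3) by auto
  then show "(-1) ^ card {(i, j). i \<in> S \<and> j \<in> {..<length xs} - S \<and> j < i} * \<alpha> (nths xs S) *
             \<beta> (nths xs ({..<length xs} - S)) = 0"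
    using assms(1,2) by auto
qed

lemma wedge_degree_zero_left:
  assumes "\<And>l. l \<noteq> [] \<Longrightarrow> set l \<subseteq> set xs \<Longrightarrow> \<alpha> l = 0"
  shows "wedge \<alpha> \<beta> xs = \<alpha> [] * \<beta> xs"
  using assms
proof (induction xs arbitrary: \<alpha> \<beta>)
  case (Cons x xs)
  have "wedge (\<lambda>l. \<alpha> (x # l)) \<beta> xs = 0"
    by (rule wedge_zero_left, rule Cons.prems) auto
  moreover have "wedge (\<lambda>l. (-1) ^ length l * \<alpha> l) (\<lambda>l. \<beta> (x # l)) xs = \<alpha> [] * \<beta> (x # xs)"
    by (subst Cons.IH) (use Cons.prems in auto)
  ultimately show ?case by (simp add: wedge_Cons)
qed simp

text \<open>Arguments from xs are killed by \<beta>, so all of them go to \<alpha>, and \<alpha>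
  accepts nothing in addition to them. Only the identity shuffle survives, hence no sign.\<close>

lemma wedge_append_factors:
  assumes "\<And>x l l'. x \<in> set xs \<Longrightarrow> set l \<subseteq> set (xs @ ys) \<Longrightarrow> set l' \<subseteq> set (xs @ ys) \<Longrightarrow>
      \<beta> (l @ x # l') = 0"
    and "\<And>l. l \<noteq> [] \<Longrightarrow> \<alpha> (xs @ l) = 0"
  shows "wedge \<alpha> \<beta> (xs @ ys) = \<alpha> xs * \<beta> ys"
  using assms
proof (induction xs arbitrary: \<alpha>)
  case Nil
  then show ?case by (simp add: wedge_degree_zero_left)
next
  case (Cons x xs)
  have \<beta>: "\<beta> (l @ z # l') = 0"
    if "z \<in> set (x # xs)" "set l \<subseteq> set (xs @ ys)" "set l' \<subseteq> set (xs @ ys)" for z l l'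
    by (rule Cons.prems(1)) (use that in auto)
  have "wedge (\<lambda>l. (-1) ^ length l * \<alpha> l) (\<lambda>l. \<beta> (x # l)) (xs @ ys) = 0"
    by (rule wedge_zero_right) (use \<beta>[of x "[]"] in auto)
  moreover have "wedge (\<lambda>l. \<alpha> (x # l)) \<beta> (xs @ ys) = \<alpha> (x # xs) * \<beta> ys"
    by (rule Cons.IH) (use \<beta> Cons.prems(2) in auto)
  ultimately show ?case by (simp add: wedge_Cons)
qed

section \<open>Alternating forms and determinants\<close>

locale complex_space = vector_space scale
  for scale :: "complex \<Rightarrow> 'w::ab_group_add \<Rightarrow> 'w" (infixr "*\<^sub>C" 75)
begin

text \<open>A condition on all degrees at once, because a form is one function on lists. Arguments
  are confined to W since forms such as \<open>restricted_two_form\<close> are multilinear only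
  there. Repetition is excluded for neighbours; the general case follows from the sign change under
  swaps.\<close>

definition alternating :: "'w set \<Rightarrow> ('w list \<Rightarrow> complex) \<Rightarrow> bool" where
  "alternating W F \<longleftrightarrow>
     (\<forall>ys u v zs a. set ys \<subseteq> W \<longrightarrow> u \<in> W \<longrightarrow> v \<in> W \<longrightarrow> set zs \<subseteq> W \<longrightarrow>
        F (ys @ (a *\<^sub>C u + v) # zs) = a * F (ys @ u # zs) + F (ys @ v # zs) \<and> F (ys @ u # u # zs) = 0)"

lemma alternating_lincomb:
  assumes "alternating W F" "set ys \<subseteq> W" "u \<in> W" "v \<in> W" "set zs \<subseteq> W"
  shows "F (ys @ (a *\<^sub>C u + v) # zs) = a * F (ys @ u # zs) + F (ys @ v # zs)"
  using assms unfolding alternating_def by blast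

lemma alternating_adjacent:
  assumes "alternating W F" "set ys \<subseteq> W" "u \<in> W" "set zs \<subseteq> W"
  shows "F (ys @ u # u # zs) = 0"
  using assms unfolding alternating_def by blast

lemma alternating_scale: "alternating W F \<Longrightarrow> alternating W (\<lambda>l. c * F l)"
  unfolding alternating_def by (simp add: algebra_simps)

lemma alternating_Cons: "alternating W F \<Longrightarrow> x \<in> W \<Longrightarrow> alternating W (\<lambda>l. F (x # l))"
  unfolding alternating_def by (metis append_Cons insert_subset list.simps(15))

lemma alternating_sign: "alternating W F \<Longrightarrow> alternating W (\<lambda>l. (-1) ^ length l * F l)"
  unfolding alternating_def by (simp add: algebra_simps)

lemma alternating_zero:
  assumes F: "alternating W F" and W: "subspace W" and "set ys \<subseteq> W" "set zs \<subseteq> W"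
  shows "F (ys @ 0 # zs) = 0"
  using alternating_lincomb[OF F assms(3) _ _ assms(4), of 0 0 1] subspace_0[OF W] by simp

lemma alternating_add:
  assumes F: "alternating W F" "set ys \<subseteq> W" "u \<in> W" "v \<in> W" "set zs \<subseteq> W"
  shows "F (ys @ (u + v) # zs) = F (ys @ u # zs) + F (ys @ v # zs)"
  using alternating_lincomb[OF F, of 1] by simp

lemma alternating_swap:
  assumes F: "alternating W F" and W: "subspace W"
    and "set ys \<subseteq> W" "u \<in> W" "v \<in> W" "set zs \<subseteq> W"
  shows "F (ys @ u # v # zs) = - F (ys @ v # u # zs)"
proof -
  have uv: "u + v \<in> W" using assms subspace_add by blast
  have "0 = F (ys @ (u + v) # (u + v) # zs)"
    using alternating_adjacent[OF F] assms uv by simp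
  also have "\<dots> = F (ys @ u # (u + v) # zs) + F (ys @ v # (u + v) # zs)"
    using alternating_add[OF F, of ys u v "(u + v) # zs"] assms uv by simp
  also have "F (ys @ u # (u + v) # zs) = F (ys @ u # u # zs) + F (ys @ u # v # zs)"
    using alternating_add[OF F, of "ys @ [u]" u v zs] assms by simp
  also have "F (ys @ v # (u + v) # zs) = F (ys @ v # u # zs) + F (ys @ v # v # zs)"
    using alternating_add[OF F, of "ys @ [v]" u v zs] assms by simp
  finally show ?thesis
    using alternating_adjacent[OF F] assms by (simp add: eq_neg_iff_add_eq_0)
qed

lemma alternating_repeat:
  assumes F: "alternating W F" and W: "subspace W"
    and "set ys \<subseteq> W" "u \<in> W" "set zs \<subseteq> W" "set ws \<subseteq> W"
  shows "F (ys @ u # zs @ u # ws) = 0"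
  using assms(5,6)
proof (induction zs arbitrary: ws rule: rev_induct)
  case Nil
  then show ?case using alternating_adjacent[OF F] assms by simp
next
  case (snoc z zs)
  have "F ((ys @ u # zs) @ z # u # ws) = - F ((ys @ u # zs) @ u # z # ws)"
    by (rule alternating_swap[OF F W]) (use snoc.prems assms in auto)
  also have "F ((ys @ u # zs) @ u # z # ws) = 0"
    using snoc.IH[of "z # ws"] snoc.prems by simp
  finally show ?case by simp
qed

lemma alternating_move:
  assumes F: "alternating W F" and W: "subspace W"
    and "u \<in> W" "set ys \<subseteq> W" "set zs \<subseteq> W"
  shows "F (u # ys @ zs) = (-1) ^ length ys * F (ys @ u # zs)"
  using F assms(4)
proof (induction ys arbitrary: F)
  case (Cons y ys)
  have "F (u # (y # ys) @ zs) = - F (y # u # ys @ zs)"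
    using alternating_swap[OF Cons.prems(1) W, of "[]" u y "ys @ zs"] Cons.prems assms by simp
  also have "F (y # u # ys @ zs) = (-1) ^ length ys * F (y # ys @ u # zs)"
    using Cons.IH[OF alternating_Cons[OF Cons.prems(1)]] Cons.prems by simp
  finally show ?case by simp
qed simp

text \<open>Column elimination: multiples of the head u in later entries die because u is repeated.
  The list zs collects entries already cleared.\<close>

lemma alternating_shear:
  assumes F: "alternating W F" and W: "subspace W"
    and "u \<in> W" "set zs \<subseteq> W" "\<And>i. y i \<in> W"
  shows "F (u # zs @ map (\<lambda>i. c i *\<^sub>C u + y i) is) = F (u # zs @ map y is)"
  using assms(4)
proof (induction "is" arbitrary: zs)
  case (Cons i "is")
  let ?r = "map (\<lambda>i. c i *\<^sub>C u + y i) is"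
  have r: "set ?r \<subseteq> W" using assms W by (auto intro!: subspace_add subspace_scale)
  have "F ((u # zs) @ (c i *\<^sub>C u + y i) # ?r) = c i * F ((u # zs) @ u # ?r) + F ((u # zs) @ y i # ?r)"
    by (rule alternating_lincomb[OF F]) (use assms Cons.prems r in auto)
  also have "F ((u # zs) @ u # ?r) = 0"
    using alternating_repeat[OF F W, of "[]" u zs ?r] assms Cons.prems r by simp
  finally show ?case using Cons.IH[of "zs @ [y i]"] Cons.prems assms(5) by simp
qed simp

lemma alternating_sum_head:
  assumes F: "alternating W F" and W: "subspace W"
    and "finite S" "\<And>k. k \<in> S \<Longrightarrow> b k \<in> W" "set zs \<subseteq> W"
  shows "F ((\<Sum>k\<in>S. c k *\<^sub>C b k) # zs) = (\<Sum>k\<in>S. c k * F (b k # zs))"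
  using assms(3,4)
proof (induction S rule: finite_induct)
  case empty
  then show ?case using alternating_zero[OF F W, of "[]"] assms(5) by simp
next
  case (insert k S)
  have "(\<Sum>k\<in>S. c k *\<^sub>C b k) \<in> W" using insert.prems W by (auto intro!: subspace_sum subspace_scale)
  then show ?case
    using alternating_lincomb[OF F, of "[]" "b k" _ zs] insert assms(5) by simp
qed

section \<open>Matrices acting on lists of vectors, and determinants\<close>

definition comb :: "complex mat \<Rightarrow> 'w list \<Rightarrow> 'w list" where
  "comb C bs = map (\<lambda>i. \<Sum>j<length bs. C $$ (i, j) *\<^sub>C bs ! j) [0..<dim_row C]"

lemma length_comb [simp]: "length (comb C bs) = dim_row C"
  by (simp add: comb_def)

lemma nth_comb [simp]: "i < dim_row C \<Longrightarrow> comb C bs ! i = (\<Sum>j<length bs. C $$ (i, j) *\<^sub>C bs ! j)"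
  by (simp add: comb_def)

lemma comb_mult:
  assumes "C \<in> carrier_mat n m" "D \<in> carrier_mat m k" "length bs = k"
  shows "comb (C * D) bs = comb C (comb D bs)"
proof (rule nth_equalityI)
  fix i assume "i < length (comb (C * D) bs)"
  then have i: "i < n" using assms by simp
  have "comb (C * D) bs ! i = (\<Sum>j<k. (\<Sum>l<m. C $$ (i, l) * D $$ (l, j)) *\<^sub>C bs ! j)"
    using i assms by (simp add: scalar_prod_def atLeast0LessThan)
  also have "\<dots> = (\<Sum>l<m. C $$ (i, l) *\<^sub>C (\<Sum>j<k. D $$ (l, j) *\<^sub>C bs ! j))"
    by (simp add: scale_sum_left scale_sum_right) (rule sum.swap)
  also have "\<dots> = comb C (comb D bs) ! i" using i assms by simp
  finally show "comb (C * D) bs ! i = comb C (comb D bs) ! i" .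
qed (use assms in simp)

lemma sum_skip_index:
  assumes "j < Suc n"
  shows "(\<Sum>k<n. f (if k < j then k else Suc k)) = sum f ({..<Suc n} - {j})"
proof (rule sum.reindex_bij_betw)
  show "bij_betw (\<lambda>k. if k < j then k else Suc k) {..<n} ({..<Suc n} - {j})"
    by (rule bij_betwI[where g = "\<lambda>k. if k < j then k else k - 1"]) (use assms in \<open>auto split: if_splits\<close>)
qed

text \<open>The induction is the cofactor expansion along the first row: linearity in the head
  produces the entries of that row, and fixing the head leaves an alternating form in one argument
  less.\<close>

theorem alternating_det:
  assumes "alternating W F" and W: "subspace W"
    and "set bs \<subseteq> W" "C \<in> carrier_mat n n" "length bs = n"
  shows "F (comb C bs) = Determinant.det C * F bs"
  using assms(1,3-)
proof (induction n arbitrary: F C bs)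
  case 0
  then show ?case by (simp add: comb_def)
next
  case (Suc n)
  note F = Suc.prems(1) and bs = Suc.prems(2) and C = Suc.prems(3) and len = Suc.prems(4)
  define row where "row i = (\<Sum>k<Suc n. C $$ (i, k) *\<^sub>C bs ! k)" for i
  have nthW: "bs ! k \<in> W" if "k < Suc n" for k
    using bs nth_mem[of k bs] that unfolding len by blast
  have rowW: "row i \<in> W" for i
    unfolding row_def by (intro subspace_sum[OF W] subspace_scale[OF W] nthW) simp
  define rest where "rest = map (\<lambda>i. row (Suc i)) [0..<n]"
  have comb: "comb C bs = row 0 # rest"
  proof (rule nth_equalityI)
    show "length (comb C bs) = length (row 0 # rest)" using C by (simp add: rest_def)
    fix i assume "i < length (comb C bs)"
    then have i: "i < Suc n" using C by simp
    have "(row 0 # rest) ! i = row i" using i by (cases i) (simp_all add: rest_def)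
    moreover have "comb C bs ! i = row i" using i C len by (simp add: row_def)
    ultimately show "comb C bs ! i = (row 0 # rest) ! i" by simp
  qed
  have restW: "set rest \<subseteq> W"
    using rowW by (auto simp: rest_def)
  \<comment> \<open>With b_j in the head, the b_j-components of the other rows are invisible, which
    deletes column j; returning b_j to its place gives the sign of the cofactor.\<close>
  have minor: "F (bs ! j # rest) = cofactor C 0 j * F bs" if j: "j < Suc n" for j
  proof -
    let ?b = "bs ! j"
    define bs' where "bs' = take j bs @ drop (Suc j) bs"
    let ?D = "mat_delete C 0 j"
    have D: "?D \<in> carrier_mat n n" using mat_delete_carrier[OF C, of 0 j] by simp
    have bs': "set bs' \<subseteq> W" "length bs' = n"
      using bs len j by (auto simp: bs'_def dest: in_set_takeD in_set_dropD)
    have nth': "bs' ! k = bs ! (if k < j then k else Suc k)" if "k < n" for k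
      using that len j by (auto simp: bs'_def nth_append)
    define y where "y i = sum (\<lambda>k. C $$ (Suc i, k) *\<^sub>C bs ! k) ({..<Suc n} - {j})" for i
    have y: "y i \<in> W" for i
      unfolding y_def by (intro subspace_sum[OF W] subspace_scale[OF W] nthW) simp
    have "row (Suc i) = C $$ (Suc i, j) *\<^sub>C ?b + y i" for i
      unfolding row_def y_def by (rule sum.remove) (use j in auto)
    then have "rest = map (\<lambda>i. C $$ (Suc i, j) *\<^sub>C ?b + y i) [0..<n]"
      unfolding rest_def by simp
    then have "F (?b # rest) = F (?b # map y [0..<n])"
      using alternating_shear[OF F W nthW[OF j], of "[]" y "\<lambda>i. C $$ (Suc i, j)"] y by simp
    also have "map y [0..<n] = comb ?D bs'"
    proof (rule nth_equalityI)
      fix i assume "i < length (map y [0..<n])"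
      then have i: "i < n" by simp
      have "y i = (\<Sum>k<n. C $$ (Suc i, if k < j then k else Suc k) *\<^sub>C bs ! (if k < j then k else Suc k))"
        unfolding y_def using sum_skip_index[OF j, of "\<lambda>k. C $$ (Suc i, k) *\<^sub>C bs ! k"] by simp
      also have "\<dots> = (\<Sum>k<n. ?D $$ (i, k) *\<^sub>C bs' ! k)"
        using i C j by (intro sum.cong) (auto simp: nth' mat_delete_def)
      finally show "map y [0..<n] ! i = comb ?D bs' ! i"
        using i bs' carrier_matD(1)[OF D] by (simp only: nth_comb length_map nth_map length_upt nth_upt) simp
    qed (use C in simp)
    also have "F (?b # comb ?D bs') = Determinant.det ?D * F (?b # bs')"
      by (rule Suc.IH[OF alternating_Cons[OF F nthW[OF j]] bs'(1) D bs'(2)])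
    also have "F (?b # bs') = (-1) ^ j * F bs"
      using alternating_move[OF F W nthW[OF j], of "take j bs" "drop (Suc j) bs"] bs len j
      by (simp add: bs'_def id_take_nth_drop[symmetric] subset_trans[OF set_take_subset]
          subset_trans[OF set_drop_subset] min_def)
    finally show ?thesis by (simp add: cofactor_def)
  qed
  have "F (comb C bs) = (\<Sum>j<Suc n. C $$ (0, j) * F (bs ! j # rest))"
    unfolding comb row_def by (rule alternating_sum_head[OF F W _ _ restW]) (use nthW in auto)
  also have "\<dots> = (\<Sum>j<Suc n. C $$ (0, j) * cofactor C 0 j) * F bs"
    using minor by (simp add: sum_distrib_right mult.assoc del: sum.lessThan_Suc)
  also have "(\<Sum>j<Suc n. C $$ (0, j) * cofactor C 0 j) = Determinant.det C"
    using laplace_expansion_row[OF C, of 0] by (simp del: sum.lessThan_Suc)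
  finally show ?case .
qed

text \<open>The forms are generalised in the induction over ys because each use of
  \<open>wedge_Cons\<close> replaces them by contractions or sign twists, which are alternating
  again.\<close>

lemma alternating_wedge:
  assumes \<alpha>: "alternating W \<alpha>" and \<beta>: "alternating W \<beta>" and W: "subspace W"
  shows "alternating W (wedge \<alpha> \<beta>)"
proof -
  have "wedge \<alpha> \<beta> (ys @ (a *\<^sub>C u + v) # zs) = a * wedge \<alpha> \<beta> (ys @ u # zs) + wedge \<alpha> \<beta> (ys @ v # zs) \<and>
        wedge \<alpha> \<beta> (ys @ u # u # zs) = 0"
    if "set ys \<subseteq> W" and u: "u \<in> W" and v: "v \<in> W" and zs: "set zs \<subseteq> W" for ys u v zs a
    using \<alpha> \<beta> \<open>set ys \<subseteq> W\<close>
  proof (induction ys arbitrary: \<alpha> \<beta>)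
    case Nil
    note lin = alternating_lincomb[OF Nil.prems(1), of "[]" u v, simplified, OF u v]
      and lin' = alternating_lincomb[OF Nil.prems(2), of "[]" u v, simplified, OF u v]
    let ?s = "\<lambda>l. (-1) ^ length l * \<alpha> l"
    have "wedge (\<lambda>l. \<alpha> ((a *\<^sub>C u + v) # l)) \<beta> zs = wedge (\<lambda>l. a * \<alpha> (u # l) + \<alpha> (v # l)) \<beta> zs"
      by (rule wedge_cong) (use lin zs in auto)
    moreover have "wedge ?s (\<lambda>l. \<beta> ((a *\<^sub>C u + v) # l)) zs = wedge ?s (\<lambda>l. a * \<beta> (u # l) + \<beta> (v # l)) zs"
      by (rule wedge_cong) (use lin' zs in auto)
    ultimately have 1: "wedge \<alpha> \<beta> ((a *\<^sub>C u + v) # zs) = a * wedge \<alpha> \<beta> (u # zs) + wedge \<alpha> \<beta> (v # zs)"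
      by (simp add: wedge_Cons wedge_lincomb_left wedge_lincomb_right) (simp add: algebra_simps)
    \<comment> \<open>Of the four ways to distribute the two copies of u, those giving both to one
      factor vanish and the two mixed ones cancel through the sign.\<close>
    have "wedge (\<lambda>l. \<alpha> (u # u # l)) \<beta> zs = 0"
      by (rule wedge_zero_left) (use alternating_adjacent[OF Nil.prems(1), of "[]" u] u zs in auto)
    moreover have "wedge (\<lambda>l. (-1) ^ length l * ((-1) ^ length l * \<alpha> l)) (\<lambda>l. \<beta> (u # u # l)) zs = 0"
      by (rule wedge_zero_right) (use alternating_adjacent[OF Nil.prems(2), of "[]" u] u zs in auto)
    ultimately have "wedge \<alpha> \<beta> (u # u # zs) = 0"
      by (simp add: wedge_Cons wedge_minus_left)
    with 1 show ?case by simp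
  next
    case (Cons y ys)
    have y: "y \<in> W" "set ys \<subseteq> W" using Cons.prems by auto
    show ?case
      using Cons.IH[OF alternating_Cons[OF Cons.prems(1) y(1)] Cons.prems(2) y(2)]
        Cons.IH[OF alternating_sign[OF Cons.prems(1)] alternating_Cons[OF Cons.prems(2) y(1)] y(2)]
      by (simp add: wedge_Cons algebra_simps)
  qed
  then show ?thesis unfolding alternating_def by blast
qed

lemma alternating_wedge_power:
  assumes "alternating W \<alpha>" "subspace W"
  shows "alternating W (wedge_power \<alpha> d)"
proof (induction d)
  case 0
  then show ?case by (simp add: alternating_def)
next
  case (Suc d)
  then show ?case using alternating_wedge[OF assms(1) Suc.IH assms(2)] by simp
qed

text \<open>Linearity on a subset: projections given by definite descriptions are uncontrolled
  outside it.\<close>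

definition linear_on :: "'w set \<Rightarrow> 'w set \<Rightarrow> ('w \<Rightarrow> 'w) \<Rightarrow> bool" where
  "linear_on W U f \<longleftrightarrow> f ` W \<subseteq> U \<and> (\<forall>x\<in>W. \<forall>y\<in>W. \<forall>a. f (a *\<^sub>C x + y) = a *\<^sub>C f x + f y)"

lemma alternating_map:
  assumes F: "alternating U F" and f: "linear_on W U f"
  shows "alternating W (\<lambda>l. F (map f l))"
proof -
  have S: "set (map f l) \<subseteq> U" if "set l \<subseteq> W" for l using f that by (auto simp: linear_on_def)
  have M: "f x \<in> U" if "x \<in> W" for x using f that by (auto simp: linear_on_def)
  have L: "f (a *\<^sub>C x + y) = a *\<^sub>C f x + f y" if "x \<in> W" "y \<in> W" for x y a
    using f that by (auto simp: linear_on_def)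
  show ?thesis
    unfolding alternating_def map_append list.map
    using alternating_lincomb[OF F S M M S] alternating_adjacent[OF F S M S] by (auto simp: L)
qed

lemma linear_on_0: "linear_on W U f \<Longrightarrow> subspace W \<Longrightarrow> f 0 = 0"
  unfolding linear_on_def using subspace_0 by (metis add_cancel_right_left add.right_neutral scale_zero_right scale_one)

lemma linear_on_sum:
  assumes f: "linear_on W U f" and W: "subspace W" and "finite S" "\<And>k. k \<in> S \<Longrightarrow> b k \<in> W"
  shows "f (\<Sum>k\<in>S. c k *\<^sub>C b k) = (\<Sum>k\<in>S. c k *\<^sub>C f (b k))"
  using assms(3,4)
proof (induction S rule: finite_induct)
  case (insert k S)
  have "(\<Sum>k\<in>S. c k *\<^sub>C b k) \<in> W" using insert.prems W by (auto intro!: subspace_sum subspace_scale)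
  then show ?case using f insert by (simp add: linear_on_def)
qed (simp add: linear_on_0[OF f W])

lemma map_comb:
  assumes f: "linear_on W U f" and W: "subspace W" and "set bs \<subseteq> W"
  shows "map f (comb C bs) = comb C (map f bs)"
proof (rule nth_equalityI)
  fix i assume "i < length (map f (comb C bs))"
  then show "map f (comb C bs) ! i = comb C (map f bs) ! i"
    using linear_on_sum[OF f W, of "{..<length bs}" "(!) bs"] assms(3) by (simp add: subset_iff)
qed simp

text \<open>Exactly the predicate from which \<open>det_on\<close> picks its basis.\<close>

definition basis_list :: "'w set \<Rightarrow> 'w list \<Rightarrow> bool" where
  "basis_list W bs \<longleftrightarrow> distinct bs \<and> independent (set bs) \<and> span (set bs) = W"

lemma basis_list_subspace: "basis_list W bs \<Longrightarrow> subspace W"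
  unfolding basis_list_def using subspace_span by blast

lemma basis_list_subset: "basis_list W bs \<Longrightarrow> set bs \<subseteq> W"
  unfolding basis_list_def using span_superset by blast

lemma length_basis_list: "basis_list W bs \<Longrightarrow> length bs = dim W"
  unfolding basis_list_def by (metis dim_eq_card distinct_card span_span)

lemma basis_list_coords:
  assumes "basis_list W bs" "x \<in> W"
  shows "x = (\<Sum>j<length bs. representation (set bs) x (bs ! j) *\<^sub>C bs ! j)"
proof -
  have "(\<Sum>b\<in>set bs. representation (set bs) x b *\<^sub>C b) = x"
    using assms by (intro sum_representation_eq) (auto simp: basis_list_def)
  moreover have "(\<Sum>b\<in>set bs. representation (set bs) x b *\<^sub>C b) =
      (\<Sum>j<length bs. representation (set bs) x (bs ! j) *\<^sub>C bs ! j)"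
    using assms(1) by (intro sum.reindex_bij_betw[symmetric] bij_betw_nth) (auto simp: basis_list_def)
  ultimately show ?thesis by simp
qed

lemma basis_list_comb:
  assumes "basis_list W bs" "set xs \<subseteq> W"
  obtains C where "C \<in> carrier_mat (length xs) (length bs)" "xs = comb C bs"
proof
  let ?C = "mat (length xs) (length bs) (\<lambda>(i, j). representation (set bs) (xs ! i) (bs ! j))"
  show "?C \<in> carrier_mat (length xs) (length bs)" by simp
  show "xs = comb ?C bs"
  proof (rule nth_equalityI)
    fix i assume i: "i < length xs"
    then have "xs ! i \<in> W" using assms(2) by auto
    then show "xs ! i = comb ?C bs ! i"
      using basis_list_coords[OF assms(1), of "xs ! i"] i by simp
  qed simp
qed

text \<open>Both sides are computed in the basis picked by \<open>det_on\<close>. As xs may be any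
  list of the right length, determinants can afterwards be read off by evaluating one nonzero top
  form on a convenient basis.\<close>

theorem alternating_det_on:
  assumes F: "alternating W F" and f: "linear_on W W f" and W: "basis_list W bs"
    and xs: "set xs \<subseteq> W" "length xs = dim W"
  shows "F (map f xs) = det_on scale W f * F xs"
proof -
  define sb where "sb = (SOME bs. basis_list W bs)"
  have sb: "basis_list W sb" unfolding sb_def using W by (metis someI)
  let ?n = "dim W"
  have n: "length sb = ?n" using length_basis_list[OF sb] .
  let ?M = "mat ?n ?n (\<lambda>(i, j). representation (set sb) (f (sb ! j)) (sb ! i))"
  have det_on: "det_on scale W f = Determinant.det ?M"
    unfolding det_on_def basis_list_def[symmetric] sb_def[symmetric] Let_def n by simp
  note sub = basis_list_subspace[OF sb] and sbW = basis_list_subset[OF sb]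
  \<comment> \<open>\<open>det_on\<close> writes the images as columns, \<open>comb\<close> reads
    coefficients from rows; hence the transpose.\<close>
  have M: "map f sb = comb (transpose_mat ?M) sb"
  proof (rule nth_equalityI)
    fix i assume "i < length (map f sb)"
    then have i: "i < ?n" using n by simp
    then have "sb ! i \<in> W" using sbW n by auto
    then have "f (sb ! i) \<in> W" using f by (auto simp: linear_on_def)
    then show "map f sb ! i = comb (transpose_mat ?M) sb ! i"
      using basis_list_coords[OF sb, of "f (sb ! i)"] i n by simp
  qed (use n in simp)
  obtain C where C: "C \<in> carrier_mat ?n ?n" "xs = comb C sb"
    using basis_list_comb[OF sb xs(1)] xs(2) n by metis
  have "map f xs = comb (C * transpose_mat ?M) sb"
    using map_comb[OF f sub sbW] C n M comb_mult[OF C(1) _ n, of "transpose_mat ?M"] by simp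
  then have "F (map f xs) = Determinant.det (C * transpose_mat ?M) * F sb"
    using alternating_det[OF F sub sbW _ n] C by simp
  also have "\<dots> = Determinant.det ?M * (Determinant.det C * F sb)"
    using det_mult[OF C(1), of "transpose_mat ?M"] det_transpose[of ?M ?n] by simp
  also have "Determinant.det C * F sb = F xs"
    using alternating_det[OF F sub sbW C(1) n] C by simp
  finally show ?thesis using det_on by simp
qed

end

section \<open>Bilinear forms and symplectic bases\<close>

text \<open>The three matrices share their cofactors along row i, so the Laplace expansion is linear
  in that row.\<close>

lemma det_row_lincomb:
  fixes A B C :: "complex mat"
  assumes "A \<in> carrier_mat n n" "B \<in> carrier_mat n n" "C \<in> carrier_mat n n" and i: "i < n"
    and row: "\<And>j. j < n \<Longrightarrow> A $$ (i, j) = a * B $$ (i, j) + C $$ (i, j)"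
    and B: "\<And>k j. k < n \<Longrightarrow> j < n \<Longrightarrow> k \<noteq> i \<Longrightarrow> B $$ (k, j) = A $$ (k, j)"
    and C: "\<And>k j. k < n \<Longrightarrow> j < n \<Longrightarrow> k \<noteq> i \<Longrightarrow> C $$ (k, j) = A $$ (k, j)"
  shows "Determinant.det A = a * Determinant.det B + Determinant.det C"
proof -
  have "mat_delete B i j = mat_delete A i j" "mat_delete C i j = mat_delete A i j" if "j < n" for j
    by (rule eq_matI; use assms(1-3) that i in \<open>auto simp: mat_delete_def B C\<close>)+
  then have "cofactor B i j = cofactor A i j" "cofactor C i j = cofactor A i j" if "j < n" for j
    using that by (simp_all add: cofactor_def)
  then show ?thesis
    using row laplace_expansion_row[OF assms(1) i] laplace_expansion_row[OF assms(2) i]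
      laplace_expansion_row[OF assms(3) i]
    by (simp add: sum_distrib_left sum.distrib[symmetric] algebra_simps)
qed

text \<open>The value 0 for unequal lengths makes it, for fixed ys, a form of degree
  \<open>length ys\<close> in xs, to which \<open>alternating_det\<close> applies.\<close>

definition gram_det :: "('w \<Rightarrow> 'w \<Rightarrow> complex) \<Rightarrow> 'w list \<Rightarrow> 'w list \<Rightarrow> complex" where
  "gram_det B xs ys = (if length xs = length ys
     then Determinant.det (mat (length ys) (length ys) (\<lambda>(i, j). B (xs ! i) (ys ! j))) else 0)"

lemma gram_det_flip: "gram_det (\<lambda>x y. B y x) ys xs = gram_det B xs ys"
proof (cases "length xs = length ys")
  case True
  let ?n = "length ys"
  have "mat ?n ?n (\<lambda>(i, j). B (xs ! j) (ys ! i)) = transpose_mat (mat ?n ?n (\<lambda>(i, j). B (xs ! i) (ys ! j)))"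
    by (rule eq_matI) auto
  then show ?thesis using True det_transpose[of "mat ?n ?n (\<lambda>(i, j). B (xs ! i) (ys ! j))" ?n]
    by (simp add: gram_det_def)
qed (simp add: gram_det_def)

lemma gram_det_cong:
  assumes "\<And>x y. x \<in> set xs \<Longrightarrow> y \<in> set ys \<Longrightarrow> B x y = B' x y"
  shows "gram_det B xs ys = gram_det B' xs ys"
proof (cases "length xs = length ys")
  case True
  then have "mat (length ys) (length ys) (\<lambda>(i, j). B (xs ! i) (ys ! j)) =
        mat (length ys) (length ys) (\<lambda>(i, j). B' (xs ! i) (ys ! j))"
    by (intro eq_matI) (auto simp: assms)
  then show ?thesis by (simp add: gram_det_def)
qed (simp add: gram_det_def)

lemma gram_det_map_left: "gram_det B (map f xs) ys = gram_det (\<lambda>x y. B (f x) y) xs ys"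
proof (cases "length xs = length ys")
  case True
  then have "mat (length ys) (length ys) (\<lambda>(i, j). B (map f xs ! i) (ys ! j)) =
        mat (length ys) (length ys) (\<lambda>(i, j). B (f (xs ! i)) (ys ! j))"
    by (intro eq_matI) auto
  then show ?thesis by (simp add: gram_det_def)
qed (simp add: gram_det_def)

lemma gram_det_cnj: "gram_det (\<lambda>x y. cnj (B x y)) xs ys = cnj (gram_det B xs ys)"
proof -
  interpret cnj: comm_ring_hom cnj by unfold_locales auto
  have "mat (length ys) (length ys) (\<lambda>(i, j). cnj (B (xs ! i) (ys ! j))) =
        map_mat cnj (mat (length ys) (length ys) (\<lambda>(i, j). B (xs ! i) (ys ! j)))"
    by (rule eq_matI) auto
  then show ?thesis by (simp add: gram_det_def)
qed

text \<open>A Darboux basis listed as p1, q1, p2, q2, and so on. Both orders of the arguments are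
  prescribed because B is an arbitrary function here; the list thus fixes every entry of its Gram
  matrix.\<close>

fun symplectic_list :: "('w \<Rightarrow> 'w \<Rightarrow> complex) \<Rightarrow> 'w list \<Rightarrow> bool" where
  "symplectic_list B [] \<longleftrightarrow> True"
| "symplectic_list B [x] \<longleftrightarrow> False"
| "symplectic_list B (p # q # bs) \<longleftrightarrow> B p q = 1 \<and> B q p = -1 \<and> B p p = 0 \<and> B q q = 0 \<and>
     (\<forall>z\<in>set bs. B p z = 0 \<and> B q z = 0 \<and> B z p = 0 \<and> B z q = 0) \<and> symplectic_list B bs"

lemma symplectic_list_cong:
  assumes "\<And>x y. x \<in> set bs \<Longrightarrow> y \<in> set bs \<Longrightarrow> B x y = B' x y"
  shows "symplectic_list B bs = symplectic_list B' bs"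
  using assms by (induction B bs rule: symplectic_list.induct) auto

lemma even_length_symplectic_list: "symplectic_list B bs \<Longrightarrow> even (length bs)"
  by (induction B bs rule: symplectic_list.induct) auto

lemma symplectic_list_append:
  assumes "symplectic_list B xs" "symplectic_list B ys"
    and "\<And>x y. x \<in> set xs \<Longrightarrow> y \<in> set ys \<Longrightarrow> B x y = 0 \<and> B y x = 0"
  shows "symplectic_list B (xs @ ys)"
  using assms by (induction B xs rule: symplectic_list.induct) auto

lemma symplectic_list_entries:
  assumes "symplectic_list B xs" "symplectic_list B' ys" "length xs = length ys"
    and "i < length xs" "j < length xs"
  shows "B (xs ! i) (xs ! j) = B' (ys ! i) (ys ! j)"
  using assms
proof (induction B xs arbitrary: ys i j rule: symplectic_list.induct)
  case (3 B p q bs)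
  obtain p' q' bs' where ys: "ys = p' # q' # bs'"
    using "3.prems"(3) by (metis Suc_length_conv length_Cons)
  have IH: "B (bs ! i) (bs ! j) = B' (bs' ! i) (bs' ! j)" if "i < length bs" "j < length bs" for i j
    using "3.IH"[of bs' i j] "3.prems" that ys by auto
  have len: "length bs' = length bs" using "3.prems" ys by simp
  have z: "B p (bs ! k) = 0" "B q (bs ! k) = 0" "B (bs ! k) p = 0" "B (bs ! k) q = 0" if "k < length bs" for k
    using "3.prems"(1) that by auto
  have z': "B' p' (bs' ! k) = 0" "B' q' (bs' ! k) = 0" "B' (bs' ! k) p' = 0" "B' (bs' ! k) q' = 0"
    if "k < length bs" for k
    using "3.prems"(2) that ys len by auto
  have pq: "B p q = 1" "B q p = -1" "B p p = 0" "B q q = 0"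
    "B' p' q' = 1" "B' q' p' = -1" "B' p' p' = 0" "B' q' q' = 0"
    using "3.prems"(1,2) ys by auto
  have split: "k = 0 \<or> k = Suc 0 \<or> (\<exists>k'. k = Suc (Suc k') \<and> k' < length bs)" if "k < length (p # q # bs)" for k
    using that by (cases k; cases "k - 1") auto
  show ?case
    using split[OF "3.prems"(4)] split[OF "3.prems"(5)] unfolding ys
    by (elim disjE exE conjE; simp only: nth_Cons_0 nth_Cons_Suc pq z z' IH)
qed auto

lemma gram_det_symplectic_list:
  assumes "symplectic_list B xs" "symplectic_list B' ys" "length xs = length ys"
  shows "gram_det B xs xs = gram_det B' ys ys"
proof -
  have "mat (length ys) (length ys) (\<lambda>(i, j). B (xs ! i) (xs ! j)) =
        mat (length ys) (length ys) (\<lambda>(i, j). B' (ys ! i) (ys ! j))"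
    by (rule eq_matI) (use assms symplectic_list_entries[OF assms] in auto)
  then show ?thesis using assms(3) by (simp add: gram_det_def)
qed

section \<open>Powers of a two-form\<close>

lemma restricted_two_form_pair [simp]:
  "restricted_two_form B W [x, y] = (if x \<in> W \<and> y \<in> W then B x y else 0)"
  by (simp add: restricted_two_form_def)

lemma wedge_power_length:
  assumes "\<And>l. length l \<noteq> 2 \<Longrightarrow> \<alpha> l = 0" "length xs \<noteq> 2 * d"
  shows "wedge_power \<alpha> d xs = 0"
  using assms(2)
proof (induction d arbitrary: xs)
  case (Suc d)
  show ?case
    unfolding wedge_power.simps
    by (rule wedge_length_zero[OF assms(1) Suc.IH]) (use Suc.prems in auto)
qed simp

text \<open>As p and q are orthogonal to all other arguments, they must enter the same factor, and
  there are \<open>Suc d\<close> factors to choose from.\<close>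

lemma wedge_power_pair:
  assumes len: "\<And>l. length l \<noteq> 2 \<Longrightarrow> \<alpha> l = 0"
    and "\<And>z. z \<in> set xs \<Longrightarrow> \<alpha> [p, z] = 0 \<and> \<alpha> [q, z] = 0"
  shows "wedge_power \<alpha> (Suc d) (p # q # xs) = of_nat (Suc d) * \<alpha> [p, q] * wedge_power \<alpha> d xs"
  using assms(2)
proof (induction d arbitrary: xs)
  case (0 xs)
  have "wedge \<alpha> (wedge_power \<alpha> 0) (p # q # xs) = \<alpha> [p, q] * wedge_power \<alpha> 0 xs"
  proof (cases "xs = []")
    case True
    then show ?thesis by (simp add: wedge_Cons len)
  next
    case False
    have "wedge \<alpha> (wedge_power \<alpha> 0) (p # q # xs) = 0"
      by (rule wedge_length_zero[of 2 _ 0]) (use False len in auto)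
    then show ?thesis using False by simp
  qed
  then show ?case by simp
next
  case (Suc d xs)
  let ?\<tau> = "wedge_power \<alpha> (Suc d)"
  have single: "\<alpha> (p # l) = 0" "\<alpha> (q # l) = 0" if "set l \<subseteq> set xs" for l
  proof -
    have "\<alpha> (p # l) = 0 \<and> \<alpha> (q # l) = 0"
    proof (cases "length l = 1")
      case True
      then obtain z where "l = [z]" by (auto simp: length_Suc_conv)
      then show ?thesis using that Suc.prems by auto
    qed (auto intro!: len)
    then show "\<alpha> (p # l) = 0" "\<alpha> (q # l) = 0" by auto
  qed
  \<comment> \<open>Distribution of p and q between the first factor and the remaining power: both
    to the first gives one term, both to the rest gives \<open>Suc d\<close> terms by induction, and
    the mixed cases vanish.\<close>
  have 1: "wedge (\<lambda>l. \<alpha> (p # q # l)) ?\<tau> xs = \<alpha> [p, q] * ?\<tau> xs"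
    by (rule wedge_degree_zero_left) (auto intro!: len)
  have 2: "wedge (\<lambda>l. (-1) ^ length l * \<alpha> (p # l)) (\<lambda>l. ?\<tau> (q # l)) xs = 0"
    by (rule wedge_zero_left) (simp add: single)
  have 3: "wedge (\<lambda>l. (-1) ^ length (q # l) * \<alpha> (q # l)) (\<lambda>l. ?\<tau> (p # l)) xs = 0"
    by (rule wedge_zero_left) (simp add: single)
  have "wedge (\<lambda>l. (-1) ^ length l * ((-1) ^ length l * \<alpha> l)) (\<lambda>l. ?\<tau> (p # q # l)) xs =
        wedge (\<lambda>l. 1 * \<alpha> l) (\<lambda>l. (of_nat (Suc d) * \<alpha> [p, q]) * wedge_power \<alpha> d l) xs"
  proof (rule wedge_cong)
    fix l assume "set l \<subseteq> set xs"
    then show "?\<tau> (p # q # l) = (of_nat (Suc d) * \<alpha> [p, q]) * wedge_power \<alpha> d l"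
      by (intro Suc.IH) (use Suc.prems in auto)
  qed (simp add: mult.assoc[symmetric] power_mult_distrib[symmetric])
  also have "\<dots> = of_nat (Suc d) * \<alpha> [p, q] * ?\<tau> xs"
    unfolding wedge_scale by simp
  finally have 4: "wedge (\<lambda>l. (-1) ^ length l * ((-1) ^ length l * \<alpha> l)) (\<lambda>l. ?\<tau> (p # q # l)) xs =
      of_nat (Suc d) * \<alpha> [p, q] * ?\<tau> xs" .
  have "wedge_power \<alpha> (Suc (Suc d)) (p # q # xs) = \<alpha> [p, q] * ?\<tau> xs + of_nat (Suc d) * \<alpha> [p, q] * ?\<tau> xs"
    unfolding wedge_power.simps(2)[of \<alpha> "Suc d"] wedge_Cons 1 2 3 4 by simp
  also have "\<dots> = of_nat (Suc (Suc d)) * \<alpha> [p, q] * ?\<tau> xs"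
    by (simp add: algebra_simps del: wedge_power.simps)
  finally show ?case .
qed

text \<open>The factor d! counts the orders in which the d hyperbolic pairs fill the factors;
  division by it makes \<open>psi\<close> equal to 1 on symplectic bases.\<close>

lemma wedge_power_symplectic_list:
  assumes "symplectic_list B bs" "set bs \<subseteq> W" "length bs = 2 * d"
  shows "wedge_power (restricted_two_form B W) d bs = fact d"
  using assms
proof (induction B bs arbitrary: d rule: symplectic_list.induct)
  case (3 B p q bs)
  then obtain d' where d: "d = Suc d'" "length bs = 2 * d'" by (cases d) auto
  have "wedge_power (restricted_two_form B W) (Suc d') (p # q # bs) =
        of_nat (Suc d') * restricted_two_form B W [p, q] * wedge_power (restricted_two_form B W) d' bs"
    by (rule wedge_power_pair) (use "3.prems" in \<open>auto simp: restricted_two_form_def\<close>)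
  then show ?case using "3.IH"[of d'] "3.prems" d by (simp del: wedge_power.simps)
qed auto

context complex_space
begin

definition bilinear_on :: "'w set \<Rightarrow> ('w \<Rightarrow> 'w \<Rightarrow> complex) \<Rightarrow> bool" where
  "bilinear_on W B \<longleftrightarrow> (\<forall>x\<in>W. \<forall>y\<in>W. \<forall>z\<in>W. \<forall>a.
     B (a *\<^sub>C x + y) z = a * B x z + B y z \<and> B z (a *\<^sub>C x + y) = a * B z x + B z y)"

text \<open>Hermitian forms are linear in the first argument only; this is the common ground on
  which symplectic and Hermitian forms are treated together.\<close>

definition left_linear_on :: "'w set \<Rightarrow> ('w \<Rightarrow> 'w \<Rightarrow> complex) \<Rightarrow> bool" where
  "left_linear_on W B \<longleftrightarrow> (\<forall>x\<in>W. \<forall>y\<in>W. \<forall>z\<in>W. \<forall>a. B (a *\<^sub>C x + y) z = a * B x z + B y z)"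

definition symplectic_on :: "'w set \<Rightarrow> ('w \<Rightarrow> 'w \<Rightarrow> complex) \<Rightarrow> bool" where
  "symplectic_on W B \<longleftrightarrow> bilinear_on W B \<and> (\<forall>x\<in>W. B x x = 0) \<and>
     (\<forall>x\<in>W. (\<forall>y\<in>W. B x y = 0) \<longrightarrow> x = 0)"

lemma bilinear_on_left: "bilinear_on W B \<Longrightarrow> left_linear_on W B"
  unfolding bilinear_on_def left_linear_on_def by blast

lemma bilinear_on_flip: "bilinear_on W B \<Longrightarrow> bilinear_on W (\<lambda>x y. B y x)"
  unfolding bilinear_on_def by blast

lemma bilinear_on_mono: "bilinear_on W B \<Longrightarrow> U \<subseteq> W \<Longrightarrow> bilinear_on U B"
  unfolding bilinear_on_def by (meson subsetD)

lemma left_linear_on_mono: "left_linear_on W B \<Longrightarrow> U \<subseteq> W \<Longrightarrow> left_linear_on U B"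
  unfolding left_linear_on_def by (meson subsetD)

lemma left_linear_0:
  assumes "left_linear_on W B" "subspace W" "z \<in> W"
  shows "B 0 z = 0"
proof -
  have "B (1 *\<^sub>C 0 + 0) z = 1 * B 0 z + B 0 z"
    using assms subspace_0[OF assms(2)] unfolding left_linear_on_def by blast
  then show ?thesis by simp
qed

lemma left_linear_scale:
  assumes "left_linear_on W B" "subspace W" "x \<in> W" "z \<in> W"
  shows "B (a *\<^sub>C x) z = a * B x z"
proof -
  have "B (a *\<^sub>C x + 0) z = a * B x z + B 0 z"
    using assms subspace_0[OF assms(2)] unfolding left_linear_on_def by blast
  then show ?thesis using left_linear_0[OF assms(1,2,4)] by simp
qed

lemma left_linear_diff:
  assumes "left_linear_on W B" "subspace W" "x \<in> W" "y \<in> W" "z \<in> W"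
  shows "B (x - y) z = B x z - B y z"
proof -
  have "B ((-1) *\<^sub>C y + x) z = (-1) * B y z + B x z"
    using assms unfolding left_linear_on_def by blast
  then show ?thesis by simp
qed

lemma left_linear_add:
  assumes "left_linear_on W B" "x \<in> W" "y \<in> W" "z \<in> W"
  shows "B (x + y) z = B x z + B y z"
proof -
  have "B (1 *\<^sub>C x + y) z = 1 * B x z + B y z"
    using assms unfolding left_linear_on_def by blast
  then show ?thesis by simp
qed

lemma left_linear_sum:
  assumes B: "left_linear_on W B" and W: "subspace W" and z: "z \<in> W"
    and "finite S" "\<And>k. k \<in> S \<Longrightarrow> b k \<in> W"
  shows "B (\<Sum>k\<in>S. c k *\<^sub>C b k) z = (\<Sum>k\<in>S. c k * B (b k) z)"
  using assms(4,5)
proof (induction S rule: finite_induct)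
  case (insert k S)
  have "(\<Sum>k\<in>S. c k *\<^sub>C b k) \<in> W" using insert.prems W by (auto intro!: subspace_sum subspace_scale)
  then show ?case using B insert z by (simp add: left_linear_on_def)
qed (simp add: left_linear_0[OF B W z])

lemma span_orthogonal:
  assumes "left_linear_on W B" "subspace W" "S \<subseteq> W" "y \<in> W" "x \<in> span S" "\<And>z. z \<in> S \<Longrightarrow> B z y = 0"
  shows "B x y = 0"
proof -
  have "subspace {x \<in> W. B x y = 0}"
    using assms left_linear_0[OF assms(1,2,4)] left_linear_scale[OF assms(1,2)]
      left_linear_add[OF assms(1)] unfolding subspace_def by auto
  then have "span S \<subseteq> {x \<in> W. B x y = 0}" by (intro span_minimal) (use assms in auto)
  then show ?thesis using assms(5) by auto
qed

lemma symplectic_antisym: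
  assumes "symplectic_on W B" "subspace W" "x \<in> W" "y \<in> W"
  shows "B y x = - B x y"
proof -
  have B: "bilinear_on W B" "\<And>x. x \<in> W \<Longrightarrow> B x x = 0" using assms(1) by (auto simp: symplectic_on_def)
  note l = left_linear_add[OF bilinear_on_left[OF B(1)]]
  note r = left_linear_add[OF bilinear_on_left[OF bilinear_on_flip[OF B(1)]]]
  have s: "x + y \<in> W" using assms subspace_add by blast
  have "0 = B (x + y) (x + y)" using B(2)[OF s] by simp
  also have "\<dots> = B x (x + y) + B y (x + y)" by (rule l) (use assms s in auto)
  also have "B x (x + y) = B x x + B x y" by (rule r) (use assms in auto)
  also have "B y (x + y) = B y x + B y y" by (rule r) (use assms in auto)
  finally show ?thesis using B(2) assms by (simp add: eq_neg_iff_add_eq_0 add.commute)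
qed

lemma alternating_restricted_two_form:
  assumes B: "bilinear_on W B" "\<And>x. x \<in> W \<Longrightarrow> B x x = 0" and W: "subspace W"
  shows "alternating W (restricted_two_form B W)"
  unfolding alternating_def
proof (intro allI impI)
  fix ys u v zs a
  assume ys: "set ys \<subseteq> W" and u: "u \<in> W" and v: "v \<in> W" and zs: "set zs \<subseteq> W"
  have w: "a *\<^sub>C u + v \<in> W" using u v W by (simp add: subspace_add subspace_scale)
  have lin: "B (a *\<^sub>C u + v) z = a * B u z + B v z" "B z (a *\<^sub>C u + v) = a * B z u + B z v" if "z \<in> W" for z
    using B(1) u v that unfolding bilinear_on_def by blast+
  consider "ys = []" "length zs = 1" | "length ys = 1" "zs = []" | "length ys + length zs \<noteq> 1"
    by (cases "length ys + length zs = 1") (auto simp: add_is_1)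
  then have "restricted_two_form B W (ys @ (a *\<^sub>C u + v) # zs) =
      a * restricted_two_form B W (ys @ u # zs) + restricted_two_form B W (ys @ v # zs)"
  proof cases
    case 1
    then obtain z where "zs = [z]" by (auto simp: length_Suc_conv)
    then show ?thesis using 1 u v w zs lin by simp
  next
    case 2
    then obtain z where "ys = [z]" by (auto simp: length_Suc_conv)
    then show ?thesis using 2 u v w ys lin by simp
  next
    case 3
    then show ?thesis by (simp add: restricted_two_form_def)
  qed
  moreover have "restricted_two_form B W (ys @ u # u # zs) = 0"
    by (cases "ys = [] \<and> zs = []") (use B(2) u in \<open>auto simp: restricted_two_form_def\<close>)
  ultimately show "restricted_two_form B W (ys @ (a *\<^sub>C u + v) # zs) =
      a * restricted_two_form B W (ys @ u # zs) + restricted_two_form B W (ys @ v # zs) \<and>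
      restricted_two_form B W (ys @ u # u # zs) = 0" by blast
qed

lemma alternating_gram_det:
  assumes B: "left_linear_on W B" and "set bs \<subseteq> W"
  shows "alternating W (\<lambda>xs. gram_det B xs bs)"
  unfolding alternating_def
proof (intro allI impI)
  fix ys u v zs a
  assume W: "set ys \<subseteq> W" "u \<in> W" "v \<in> W" "set zs \<subseteq> W"
  let ?n = "length bs"
  have bsW: "bs ! j \<in> W" if "j < ?n" for j using that assms(2) by auto
  define M where "M xs = mat ?n ?n (\<lambda>(i, j). B (xs ! i) (bs ! j))" for xs
  have M: "M xs \<in> carrier_mat ?n ?n" for xs by (simp add: M_def)
  have "gram_det B (ys @ (a *\<^sub>C u + v) # zs) bs = a * gram_det B (ys @ u # zs) bs + gram_det B (ys @ v # zs) bs"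
  proof (cases "length ys + Suc (length zs) = ?n")
    case True
    have "Determinant.det (M (ys @ (a *\<^sub>C u + v) # zs)) =
        a * Determinant.det (M (ys @ u # zs)) + Determinant.det (M (ys @ v # zs))"
      by (rule det_row_lincomb[OF M M M, of "length ys"])
        (use True W bsW B in \<open>auto simp: M_def nth_append left_linear_on_def nth_Cons split: nat.splits\<close>)
    then show ?thesis using True by (simp add: gram_det_def M_def)
  qed (auto simp: gram_det_def)
  moreover have "gram_det B (ys @ u # u # zs) bs = 0"
  proof (cases "length ys + Suc (Suc (length zs)) = ?n")
    case True
    have "Determinant.det (M (ys @ u # u # zs)) = 0"
      by (rule det_identical_rows[OF M, of "length ys" "Suc (length ys)"])
        (use True in \<open>auto simp: M_def nth_append row_def\<close>)
    then show ?thesis using True by (simp add: gram_det_def M_def)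
  qed (auto simp: gram_det_def)
  ultimately show "gram_det B (ys @ (a *\<^sub>C u + v) # zs) bs =
      a * gram_det B (ys @ u # zs) bs + gram_det B (ys @ v # zs) bs \<and>
      gram_det B (ys @ u # u # zs) bs = 0" by blast
qed

text \<open>Expresses det f through a pair of Gram determinants, so that adjointness relations for a
  form turn into equations between determinants.\<close>

lemma gram_det_left_map:
  assumes "left_linear_on W B" "basis_list W bs" "linear_on W W f"
  shows "gram_det (\<lambda>x y. B (f x) y) bs bs = det_on scale W f * gram_det B bs bs"
  using alternating_det_on[OF alternating_gram_det[OF assms(1) basis_list_subset[OF assms(2)]]
      assms(3,2) basis_list_subset[OF assms(2)] length_basis_list[OF assms(2)]]
  by (simp add: gram_det_map_left)

lemma basis_list_independent:
  assumes "basis_list W bs" "(\<Sum>i<length bs. c i *\<^sub>C bs ! i) = 0" "i < length bs"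
  shows "c i = 0"
proof -
  have ind: "independent (set bs)" and bij: "bij_betw ((!) bs) {..<length bs} (set bs)"
    using assms(1) by (auto simp: basis_list_def bij_betw_nth)
  define k where "k = the_inv_into {..<length bs} ((!) bs)"
  have k: "k (bs ! i) = i" if "i < length bs" for i
    unfolding k_def by (rule the_inv_into_f_f) (use bij that in \<open>auto simp: bij_betw_def\<close>)
  have "(\<Sum>v\<in>set bs. c (k v) *\<^sub>C v) = (\<Sum>i<length bs. c (k (bs ! i)) *\<^sub>C bs ! i)"
    by (rule sum.reindex_bij_betw[OF bij, symmetric])
  also have "\<dots> = 0" using assms(2) k by simp
  finally have "c (k (bs ! i)) = 0"
    by (rule independentD[OF ind finite_set subset_refl]) (use assms(3) in simp)
  then show ?thesis using k assms(3) by simp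
qed

lemma gram_det_nonzero:
  assumes B: "left_linear_on W B" and bs: "basis_list W bs"
    and nd: "\<And>x. x \<in> W \<Longrightarrow> (\<And>y. y \<in> set bs \<Longrightarrow> B x y = 0) \<Longrightarrow> x = 0"
  shows "gram_det B bs bs \<noteq> 0"
proof
  assume 0: "gram_det B bs bs = 0"
  let ?n = "length bs"
  \<comment> \<open>The transposed Gram matrix: a kernel vector then lists the coefficients of some
    x for which \<open>B x\<close> vanishes on the basis.\<close>
  define M where "M = mat ?n ?n (\<lambda>(i, j). B (bs ! j) (bs ! i))"
  have M: "M \<in> carrier_mat ?n ?n" by (simp add: M_def)
  have bsW: "bs ! j \<in> W" if "j < ?n" for j using that basis_list_subset[OF bs] by auto
  have "Determinant.det M = 0" using 0 gram_det_flip[of B bs bs] by (simp add: gram_det_def M_def)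
  then obtain v where v: "v \<in> carrier_vec ?n" "v \<noteq> 0\<^sub>v ?n" "M *\<^sub>v v = 0\<^sub>v ?n"
    using det_0_iff_vec_prod_zero[OF M] by auto
  define x where "x = (\<Sum>i<?n. v $ i *\<^sub>C bs ! i)"
  have x: "x \<in> W"
    unfolding x_def by (intro subspace_sum subspace_scale bsW basis_list_subspace[OF bs]) auto
  have "B x (bs ! j) = 0" if j: "j < ?n" for j
  proof -
    have "B x (bs ! j) = (\<Sum>i<?n. v $ i * B (bs ! i) (bs ! j))"
      unfolding x_def
      by (rule left_linear_sum[OF B basis_list_subspace[OF bs] bsW[OF j]]) (use bsW in auto)
    also have "\<dots> = (M *\<^sub>v v) $ j"
      using j v(1) by (simp add: M_def scalar_prod_def atLeast0LessThan mult.commute)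
    finally show ?thesis using v(3) j by simp
  qed
  then have "x = 0" using nd[OF x] by (metis in_set_conv_nth)
  then have "v $ i = 0" if "i < ?n" for i
    using basis_list_independent[OF bs, of "\<lambda>i. v $ i"] that by (simp add: x_def)
  then show False using v(1,2) by (auto intro!: eq_vecI)
qed

text \<open>On a symplectic list this is the orthogonal projection onto its span. The coefficients
  and signs solve B (P x) q = B x q and B (P x) p = B x p, given B p q = 1 and B q p = -1.\<close>

fun symplectic_projection :: "('w \<Rightarrow> 'w \<Rightarrow> complex) \<Rightarrow> 'w list \<Rightarrow> 'w \<Rightarrow> 'w" where
  "symplectic_projection B (p # q # bs) x =
     B x q *\<^sub>C p - B x p *\<^sub>C q + symplectic_projection B bs x"
| "symplectic_projection B _ x = 0"

lemma symplectic_projection_span: "symplectic_projection B bs x \<in> span (set bs)"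
proof (induction B bs x rule: symplectic_projection.induct)
  case (1 B p q bs x)
  have "symplectic_projection B bs x \<in> span (set (p # q # bs))"
    by (rule subsetD[OF span_mono 1]) auto
  then show ?case by (auto intro!: span_add span_diff span_scale intro: span_base)
qed (auto intro: span_zero)

lemma linear_on_symplectic_projection:
  assumes B: "bilinear_on W B" and "set bs \<subseteq> W"
  shows "linear_on W (span (set bs)) (symplectic_projection B bs)"
proof -
  have "symplectic_projection B bs (a *\<^sub>C x + y) =
      a *\<^sub>C symplectic_projection B bs x + symplectic_projection B bs y" if "x \<in> W" "y \<in> W" for x y a
    using assms(2) B
  proof (induction B bs rule: symplectic_list.induct)
    case (3 B p q bs)
    have "B (a *\<^sub>C x + y) p = a * B x p + B y p" "B (a *\<^sub>C x + y) q = a * B x q + B y q"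
      using 3 that by (auto simp: bilinear_on_def)
    then show ?case using 3 by (simp add: algebra_simps)
  qed auto
  then show ?thesis using symplectic_projection_span unfolding linear_on_def by auto
qed

lemma symplectic_projection_form:
  assumes B: "bilinear_on W B" and W: "subspace W" and "set bs \<subseteq> W" "symplectic_list B bs" "x \<in> W"
  shows "z \<in> set bs \<Longrightarrow> B (symplectic_projection B bs x) z = B x z"
  using assms
proof (induction B bs x arbitrary: z rule: symplectic_projection.induct)
  case (1 B p q bs x)
  note L = bilinear_on_left[OF \<open>bilinear_on W B\<close>]
  have W: "p \<in> W" "q \<in> W" "set bs \<subseteq> W" "z \<in> W" using 1 by auto
  let ?P = "symplectic_projection B bs x"
  have "span (set bs) \<subseteq> W" by (rule span_minimal) (use 1 in auto)
  then have P: "?P \<in> W" using symplectic_projection_span by blast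
  have "B (B x q *\<^sub>C p - B x p *\<^sub>C q + ?P) z = B x q * B p z - B x p * B q z + B ?P z"
    using W P \<open>subspace W\<close>
    by (simp add: left_linear_add[OF L] left_linear_diff[OF L] left_linear_scale[OF L]
        subspace_scale subspace_diff)
  moreover have "B ?P p = 0" "B ?P q = 0"
    by (rule span_orthogonal[OF L \<open>subspace W\<close> W(3) _ symplectic_projection_span];
        use 1 in auto)+
  moreover have "B ?P z = B x z" if "z \<in> set bs"
    by (rule "1.IH") (use 1 that in auto)
  ultimately show ?case using "1.prems" by auto
qed auto

text \<open>A vector pairs to 1 or -1 with its partner, whereas the vectors on which it might depend
  pair to 0 with that partner.\<close>

lemma symplectic_list_independent:
  assumes B: "bilinear_on W B" and W: "subspace W" and "set bs \<subseteq> W" "symplectic_list B bs"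
  shows "distinct bs \<and> independent (set bs)"
  using assms
proof (induction B bs rule: symplectic_list.induct)
  case (3 B p q bs)
  note L = bilinear_on_left[OF \<open>bilinear_on W B\<close>]
  have q: "q \<notin> span (set bs)"
    using span_orthogonal[OF L 3(3), of "set bs" p q] 3 by auto
  have p: "p \<notin> span (insert q (set bs))"
    using span_orthogonal[OF L 3(3), of "insert q (set bs)" q p] 3 by auto
  have "independent (insert p (insert q (set bs)))"
    by (rule independent_insertI[OF p independent_insertI[OF q]]) (use 3 in auto)
  then show ?case using 3 p q span_base by auto
qed (auto simp: independent_empty)

text \<open>Symplectic lists are independent, so the spanning set S bounds their length and a
  longest one exists. If it failed to span W, a hyperbolic pair in its orthogonal complement would
  prolong it.\<close>

theorem symplectic_basis_exists:
  assumes B: "symplectic_on W B" and W: "subspace W" and fin: "finite S" "W \<subseteq> span S"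
  obtains bs where "symplectic_list B bs" "basis_list W bs"
proof -
  define P where "P bs \<longleftrightarrow> set bs \<subseteq> W \<and> symplectic_list B bs" for bs
  have bil: "bilinear_on W B" and alt: "\<And>x. x \<in> W \<Longrightarrow> B x x = 0"
    and nd: "\<And>x. x \<in> W \<Longrightarrow> (\<And>y. y \<in> W \<Longrightarrow> B x y = 0) \<Longrightarrow> x = 0"
    using B by (auto simp: symplectic_on_def)
  note L = bilinear_on_left[OF bil] and R = bilinear_on_left[OF bilinear_on_flip[OF bil]]
  have "length bs < Suc (card S)" if "P bs" for bs
  proof -
    have "distinct bs \<and> independent (set bs)"
      using symplectic_list_independent[OF bil W] that by (auto simp: P_def)
    moreover have "set bs \<subseteq> span S" using that fin(2) by (auto simp: P_def)
    ultimately show ?thesis using independent_span_bound[OF fin(1)] distinct_card by fastforce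
  qed
  moreover have "P []" by (simp add: P_def)
  ultimately obtain bs where bs: "P bs" and max: "\<And>cs. P cs \<Longrightarrow> length cs \<le> length bs"
    using ex_has_greatest_nat[of P "[]" length "Suc (card S)"] by blast
  have bsW: "set bs \<subseteq> W" and sl: "symplectic_list B bs" using bs by (auto simp: P_def)
  have spanW: "span (set bs) \<subseteq> W" by (rule span_minimal[OF bsW W])
  have comp: "x - symplectic_projection B bs x \<in> W \<and>
      (\<forall>z\<in>set bs. B (x - symplectic_projection B bs x) z = 0 \<and> B z (x - symplectic_projection B bs x) = 0)"
    if x: "x \<in> W" for x
  proof -
    let ?P = "symplectic_projection B bs x"
    have P: "?P \<in> W" using symplectic_projection_span spanW by blast
    have d: "x - ?P \<in> W" using x P W subspace_diff by blast
    have "B (x - ?P) z = 0" if "z \<in> set bs" for z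
      using left_linear_diff[OF L W x P] symplectic_projection_form[OF bil W bsW sl x that] that bsW
      by auto
    then show ?thesis using d symplectic_antisym[OF B W d] bsW by auto
  qed
  have "x \<in> span (set bs)" if x: "x \<in> W" for x
  proof (rule ccontr)
    assume nspan: "x \<notin> span (set bs)"
    \<comment> \<open>p is the component of x orthogonal to the list. Nondegeneracy supplies y,
      whose orthogonal component r pairs with p as y does and needs only to be rescaled.\<close>
    define p where "p = x - symplectic_projection B bs x"
    have "p \<noteq> 0" using nspan symplectic_projection_span[of B bs x] by (auto simp: p_def)
    moreover have p: "p \<in> W" "\<And>z. z \<in> set bs \<Longrightarrow> B p z = 0 \<and> B z p = 0"
      using comp[OF x] by (auto simp: p_def)
    ultimately obtain y where y: "y \<in> W" "B p y \<noteq> 0" using nd by blast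
    define r where "r = y - symplectic_projection B bs y"
    have r: "r \<in> W" "\<And>z. z \<in> set bs \<Longrightarrow> B r z = 0 \<and> B z r = 0"
      using comp[OF y(1)] by (auto simp: r_def)
    have Py: "symplectic_projection B bs y \<in> W" using symplectic_projection_span spanW by blast
    have "B (symplectic_projection B bs y) p = 0"
      by (rule span_orthogonal[OF L W bsW p(1) symplectic_projection_span]) (use p in auto)
    then have "B p (symplectic_projection B bs y) = 0"
      using symplectic_antisym[OF B W Py p(1)] by simp
    then have pr: "B p r = B p y"
      using left_linear_diff[OF R W y(1) Py p(1)] by (simp add: r_def)
    define q where "q = (1 / B p y) *\<^sub>C r"
    have q: "q \<in> W" using r W by (simp add: q_def subspace_scale)
    have pq: "B p q = 1"
      using left_linear_scale[OF R W r(1) p(1)] y(2) pr by (simp add: q_def)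
    have qz: "B q z = 0 \<and> B z q = 0" if "z \<in> set bs" for z
      using left_linear_scale[OF L W r(1)] left_linear_scale[OF R W r(1)] r(2)[OF that] that bsW
      by (auto simp: q_def)
    have "symplectic_list B (p # q # bs)"
      using pq qz p sl alt q symplectic_antisym[OF B W p(1) q] by auto
    then have "P (p # q # bs)" using p q bsW by (auto simp: P_def)
    then show False using max by fastforce
  qed
  then have "basis_list W bs"
    using symplectic_list_independent[OF bil W bsW sl] spanW unfolding basis_list_def by blast
  then show ?thesis using sl that by blast
qed

text \<open>Both sides change by the square of the determinant of a change of basis, and the normal form
  given by a symplectic basis depends on the dimension only.\<close>
lemma wedge_power_square:
  assumes B: "symplectic_on W B" and W: "subspace W" and fin: "finite S" "W \<subseteq> span S"
    and bs: "set bs \<subseteq> W" "length bs = 2 * d" "dim W = 2 * d"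
    and ys: "symplectic_list B' ys" "length ys = 2 * d"
  shows "(wedge_power (restricted_two_form B W) d bs / fact d)\<^sup>2 * gram_det B' ys ys = gram_det B bs bs"
proof -
  have bil: "bilinear_on W B" and alt: "\<And>x. x \<in> W \<Longrightarrow> B x x = 0"
    using B by (auto simp: symplectic_on_def)
  obtain sb where sb: "symplectic_list B sb" "basis_list W sb"
    using symplectic_basis_exists[OF B W fin] .
  have n: "length sb = 2 * d" using length_basis_list[OF sb(2)] bs(3) by simp
  note sbW = basis_list_subset[OF sb(2)]
  obtain C where C: "C \<in> carrier_mat (2 * d) (2 * d)" "bs = comb C sb"
    using basis_list_comb[OF sb(2) bs(1)] bs(2) n by metis
  have "wedge_power (restricted_two_form B W) d bs = Determinant.det C * fact d"
    using alternating_det[OF alternating_wedge_power[OF alternating_restricted_two_form[OF bil alt W] W]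
        W sbW C(1) n, of d] wedge_power_symplectic_list[OF sb(1) sbW n] C(2) by simp
  moreover have "gram_det B bs bs = Determinant.det C * gram_det B sb bs"
    using alternating_det[OF alternating_gram_det[OF bilinear_on_left[OF bil] bs(1)] W sbW C(1) n] C(2)
    by simp
  moreover have "gram_det B sb bs = Determinant.det C * gram_det B sb sb"
    using alternating_det[OF alternating_gram_det[OF bilinear_on_left[OF bilinear_on_flip[OF bil]] sbW]
        W sbW C(1) n]
    unfolding gram_det_flip[of B bs sb] gram_det_flip[of B sb sb] C(2)[symmetric] by simp
  moreover have "gram_det B sb sb = gram_det B' ys ys"
    by (rule gram_det_symplectic_list[OF sb(1) ys(1)]) (simp add: n ys)
  ultimately show ?thesis by (simp add: power2_eq_square)
qed

end

section \<open>Unitary symplectic maps\<close>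

text \<open>The device behind the signs: a path of nonzero reals that starts positive cannot leave
  the positive half line.\<close>

lemma positive_along_path:
  fixes f :: "real \<Rightarrow> complex"
  assumes cont: "continuous_on {0..1} f" and f: "\<And>t. t \<in> {0..1} \<Longrightarrow> f t \<in> \<real> \<and> f t \<noteq> 0"
    and "0 < Re (f 0)" and t: "t \<in> {0..1}"
  shows "0 < Re (f t)"
proof (rule ccontr)
  assume "\<not> 0 < Re (f t)"
  then have "\<exists>s. 0 \<le> s \<and> s \<le> t \<and> Re (f s) = 0"
    using assms(3) t
    by (intro IVT2') (auto intro!: continuous_intros continuous_on_subset[OF cont])
  then obtain s where s: "0 \<le> s" "s \<le> t" "Re (f s) = 0" by blast
  then have "s \<in> {0..1}" using t by auto
  then have "f s \<in> \<real>" "f s \<noteq> 0" using f by auto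
  then show False using s(3) by (auto elim: Reals_cases)
qed

lemma continuous_on_gram_det:
  fixes B :: "real \<Rightarrow> 'w \<Rightarrow> 'w \<Rightarrow> complex"
  assumes "\<And>x y. x \<in> set xs \<Longrightarrow> y \<in> set ys \<Longrightarrow> continuous_on T (\<lambda>t. B t x y)"
  shows "continuous_on T (\<lambda>t. gram_det (B t) xs ys)"
proof (cases "length xs = length ys")
  case True
  let ?n = "length ys"
  let ?M = "\<lambda>t. mat ?n ?n (\<lambda>(i, j). B t (xs ! i) (ys ! j))"
  have M: "?M t \<in> carrier_mat ?n ?n" for t by simp
  have "continuous_on T (\<lambda>t. \<Sum>p\<in>{p. p permutes {0..<?n}}. signof p * (\<Prod>i=0..<?n. ?M t $$ (i, p i)))"
  proof (intro continuous_on_sum continuous_on_mult continuous_on_const continuous_on_prod)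
    fix p i assume p: "p \<in> {p. p permutes {0..<?n}}" and i: "i \<in> {0..<?n}"
    then have "p i < ?n" using permutes_in_image by fastforce
    then show "continuous_on T (\<lambda>t. ?M t $$ (i, p i))" using assms i True by auto
  qed
  then show ?thesis using True unfolding gram_det_def det_def'[OF M] by simp
qed (simp add: gram_det_def)

lemma continuous_on_wedge_power:
  fixes B :: "real \<Rightarrow> 'w \<Rightarrow> 'w \<Rightarrow> complex"
  assumes "\<And>x y. x \<in> W \<Longrightarrow> y \<in> W \<Longrightarrow> continuous_on T (\<lambda>t. B t x y)"
  shows "continuous_on T (\<lambda>t. wedge_power (restricted_two_form (B t) W) d xs)"
proof (induction d arbitrary: xs)
  case (Suc d)
  have "continuous_on T (\<lambda>t. restricted_two_form (B t) W l)" for l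
  proof (cases "length l = 2 \<and> set l \<subseteq> W")
    case True
    then have "l ! 0 \<in> W" "l ! 1 \<in> W" by auto
    then show ?thesis using True assms by (simp add: restricted_two_form_def)
  next
    case False
    then have "restricted_two_form (B t) W l = 0" for t by (auto simp: restricted_two_form_def)
    then show ?thesis by simp
  qed
  then show ?case
    unfolding wedge_power.simps wedge_def by (intro continuous_intros Suc.IH)
qed simp

context complex_space
begin

definition hermitian_on :: "'w set \<Rightarrow> ('w \<Rightarrow> 'w \<Rightarrow> complex) \<Rightarrow> bool" where
  "hermitian_on W H \<longleftrightarrow> left_linear_on W H \<and> (\<forall>x\<in>W. \<forall>y\<in>W. H y x = cnj (H x y)) \<and>
     (\<forall>x\<in>W. x \<noteq> 0 \<longrightarrow> 0 < Re (H x x))"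

lemma hermitian_onD:
  assumes "hermitian_on W H"
  shows "left_linear_on W H" "x \<in> W \<Longrightarrow> y \<in> W \<Longrightarrow> H y x = cnj (H x y)"
    "x \<in> W \<Longrightarrow> H x x = 0 \<Longrightarrow> x = 0"
proof -
  show "x \<in> W \<Longrightarrow> H x x = 0 \<Longrightarrow> x = 0"
  proof (rule ccontr)
    assume "x \<in> W" "H x x = 0" "x \<noteq> 0"
    moreover from this have "0 < Re (H x x)" using assms unfolding hermitian_on_def by blast
    ultimately show False by simp
  qed
qed (use assms in \<open>unfold hermitian_on_def, blast+\<close>)

lemma hermitian_on_mono:
  assumes H: "hermitian_on W H" and "U \<subseteq> W"
  shows "hermitian_on U H"
  unfolding hermitian_on_def
proof (intro conjI ballI impI)
  show "left_linear_on U H" by (rule left_linear_on_mono[OF hermitian_onD(1)[OF H] assms(2)])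
  show "H y x = cnj (H x y)" if "x \<in> U" "y \<in> U" for x y
    by (rule hermitian_onD(2)[OF H]) (use that assms(2) in auto)
  show "0 < Re (H x x)" if "x \<in> U" "x \<noteq> 0" for x
    using H that assms(2) unfolding hermitian_on_def by blast
qed

lemma hermitian_orthogonal:
  assumes H: "hermitian_on W H" and bs: "basis_list W bs" and x: "x \<in> W" and z: "z \<in> W"
    and "\<And>y. y \<in> set bs \<Longrightarrow> H x y = 0"
  shows "H x z = 0"
proof -
  note sub = basis_list_subset[OF bs]
  have "H z x = 0"
    by (rule span_orthogonal[OF hermitian_onD(1)[OF H] basis_list_subspace[OF bs] sub x])
      (use assms sub hermitian_onD(2)[OF H x] in \<open>auto simp: basis_list_def\<close>)
  then show ?thesis using hermitian_onD(2)[OF H z x] by simp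
qed

text \<open>Definiteness excludes a kernel, and conjugation merely transposes the Gram matrix, so
  the determinant is real.\<close>

lemma hermitian_gram_det:
  assumes H: "hermitian_on W H" and bs: "basis_list W bs"
  shows "gram_det H bs bs \<noteq> 0" "cnj (gram_det H bs bs) = gram_det H bs bs"
proof -
  note sub = basis_list_subset[OF bs]
  show "gram_det H bs bs \<noteq> 0"
  proof (rule gram_det_nonzero[OF hermitian_onD(1)[OF H] bs])
    fix x assume x: "x \<in> W" and 0: "\<And>y. y \<in> set bs \<Longrightarrow> H x y = 0"
    have "H x x = 0" by (rule hermitian_orthogonal[OF H bs x x 0])
    then show "x = 0" by (rule hermitian_onD(3)[OF H x])
  qed
  have "cnj (gram_det H bs bs) = gram_det (\<lambda>x y. cnj (H x y)) bs bs"
    by (rule gram_det_cnj[symmetric])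
  also have "\<dots> = gram_det (\<lambda>x y. H y x) bs bs"
    by (rule gram_det_cong, rule hermitian_onD(2)[OF H, symmetric]) (use sub in auto)
  also have "\<dots> = gram_det H bs bs" by (rule gram_det_flip)
  finally show "cnj (gram_det H bs bs) = gram_det H bs bs" .
qed

lemma symplectic_gram_det_nonzero:
  assumes B: "symplectic_on W B" and bs: "basis_list W bs"
  shows "gram_det B bs bs \<noteq> 0"
proof (rule gram_det_nonzero[OF _ bs])
  have bil: "bilinear_on W B" using B by (simp add: symplectic_on_def)
  show "left_linear_on W B" by (rule bilinear_on_left[OF bil])
  fix x assume x: "x \<in> W" and 0: "\<And>y. y \<in> set bs \<Longrightarrow> B x y = 0"
  have "B x z = 0" if "z \<in> W" for z
    using span_orthogonal[OF bilinear_on_left[OF bilinear_on_flip[OF bil]] basis_list_subspace[OF bs]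
        basis_list_subset[OF bs] x, of z] 0 that bs by (auto simp: basis_list_def)
  then show "x = 0" using B x by (auto simp: symplectic_on_def)
qed

lemma linear_on_comp: "linear_on W U f \<Longrightarrow> linear_on V W g \<Longrightarrow> linear_on V U (\<lambda>x. f (g x))"
  unfolding linear_on_def by (auto simp: image_subset_iff)

lemma linear_on_subset: "linear_on W U f \<Longrightarrow> V \<subseteq> W \<Longrightarrow> f ` V \<subseteq> X \<Longrightarrow> linear_on V X f"
  unfolding linear_on_def by (meson subsetD)

lemma linear_on_id: "linear_on W W (\<lambda>x. x)"
  unfolding linear_on_def by auto

lemma linear_on_lincomb:
  assumes "subspace W" "linear_on V W f" "linear_on V W g"
  shows "linear_on V W (\<lambda>x. a *\<^sub>C f x + b *\<^sub>C g x)"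
  using assms unfolding linear_on_def
  by (auto simp: image_subset_iff algebra_simps intro!: subspace_add subspace_scale)

lemma linear_on_diff:
  assumes "subspace W" "linear_on V W f" "linear_on V W g"
  shows "linear_on V W (\<lambda>x. f x - g x)"
  using assms unfolding linear_on_def
  by (auto simp: image_subset_iff algebra_simps intro!: subspace_diff)

lemma linear_on_add:
  assumes "subspace W" "linear_on V W f" "linear_on V W g"
  shows "linear_on V W (\<lambda>x. f x + g x)"
  using linear_on_lincomb[OF assms, of 1 1] by simp

lemma linear_on_image_subspace:
  assumes f: "linear_on W U f" and W: "subspace W"
  shows "subspace (f ` W)"
proof (rule subspaceI)
  show "0 \<in> f ` W" using linear_on_0[OF f W] subspace_0[OF W] by (metis image_eqI)
next
  fix x y assume "x \<in> f ` W" "y \<in> f ` W"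
  then obtain u v where uv: "x = f u" "y = f v" "u \<in> W" "v \<in> W" by blast
  then have "x + y = f (1 *\<^sub>C u + v)" using f unfolding linear_on_def by (metis scale_one)
  then show "x + y \<in> f ` W" using uv W by (auto intro!: subspace_add)
next
  fix c x assume "x \<in> f ` W"
  then obtain u where u: "x = f u" "u \<in> W" by blast
  then have "c *\<^sub>C x = f (c *\<^sub>C u + 0)"
    using f linear_on_0[OF f W] subspace_0[OF W] unfolding linear_on_def by (metis add.right_neutral)
  then show "c *\<^sub>C x \<in> f ` W" using u W by (auto intro!: subspace_scale)
qed

end

section \<open>Isometries of a symplectic and a Hermitian form\<close>

locale unitary_symplectic_space = complex_space scale
  for scale :: "complex \<Rightarrow> 'w::ab_group_add \<Rightarrow> 'w" (infixr "*\<^sub>C" 75) +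
  fixes W S :: "'w set" and \<omega> H :: "'w \<Rightarrow> 'w \<Rightarrow> complex"
  assumes subspace_W: "subspace W" and fin: "finite S" and W_span: "W \<subseteq> span S"
    and symp: "symplectic_on W \<omega>" and herm: "hermitian_on W H"
begin

text \<open>The inverse A' is carried along because it is the adjoint of A for \<omega> and for
  H.\<close>

definition isometry :: "('w \<Rightarrow> 'w) \<Rightarrow> ('w \<Rightarrow> 'w) \<Rightarrow> bool" where
  "isometry A A' \<longleftrightarrow> linear_on W W A \<and> linear_on W W A' \<and>
     (\<forall>x\<in>W. A (A' x) = x \<and> A' (A x) = x) \<and>
     (\<forall>x\<in>W. \<forall>y\<in>W. \<omega> (A x) (A y) = \<omega> x y \<and> H (A x) (A y) = H x y)"

definition moved :: "('w \<Rightarrow> 'w) \<Rightarrow> 'w set" where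
  "moved A = (\<lambda>x. x - A x) ` W"

lemma bil: "bilinear_on W \<omega>" and alt: "x \<in> W \<Longrightarrow> \<omega> x x = 0"
  and nondeg: "x \<in> W \<Longrightarrow> (\<And>y. y \<in> W \<Longrightarrow> \<omega> x y = 0) \<Longrightarrow> x = 0"
  using symp by (auto simp: symplectic_on_def)

lemmas \<omega>L = bilinear_on_left[OF bil]
  and \<omega>R = bilinear_on_left[OF bilinear_on_flip[OF bil]]
  and HL = hermitian_onD(1)[OF herm]

lemma H_cnj: "x \<in> W \<Longrightarrow> y \<in> W \<Longrightarrow> H y x = cnj (H x y)"
  using hermitian_onD(2)[OF herm] .

lemma isometryD:
  assumes "isometry A A'"
  shows "linear_on W W A" "linear_on W W A'" "x \<in> W \<Longrightarrow> A x \<in> W" "x \<in> W \<Longrightarrow> A' x \<in> W"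
    "x \<in> W \<Longrightarrow> A (A' x) = x" "x \<in> W \<Longrightarrow> A' (A x) = x"
    "x \<in> W \<Longrightarrow> y \<in> W \<Longrightarrow> \<omega> (A x) (A y) = \<omega> x y" "x \<in> W \<Longrightarrow> y \<in> W \<Longrightarrow> H (A x) (A y) = H x y"
  using assms by (auto simp: isometry_def linear_on_def)

lemma isometry_inverse:
  assumes "isometry A A'"
  shows "isometry A' A"
proof -
  note D = isometryD[OF assms]
  have "\<omega> (A' x) (A' y) = \<omega> x y \<and> H (A' x) (A' y) = H x y" if "x \<in> W" "y \<in> W" for x y
    using D(7)[OF D(4) D(4)] D(8)[OF D(4) D(4)] D(5) that by simp
  then show ?thesis using D(1,2,5,6) unfolding isometry_def by blast
qed

lemma isometry_comp:
  assumes "isometry A A'" "isometry B B'"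
  shows "isometry (\<lambda>x. A (B x)) (\<lambda>x. B' (A' x))"
proof -
  note D = isometryD[OF assms(1)] and E = isometryD[OF assms(2)]
  show ?thesis
    unfolding isometry_def
    using linear_on_comp[OF D(1) E(1)] linear_on_comp[OF E(2) D(2)] D(3-8) E(3-8) by simp
qed

lemma isometry_diff:
  assumes "isometry A A'" "x \<in> W" "y \<in> W"
  shows "A (x - y) = A x - A y"
proof -
  have "A ((-1) *\<^sub>C y + x) = (-1) *\<^sub>C A y + A x"
    using isometryD(1)[OF assms(1)] assms(2,3) unfolding linear_on_def by blast
  then show ?thesis by simp
qed

lemma linear_on_one_minus:
  assumes "isometry A A'"
  shows "linear_on W W (\<lambda>x. x - A x)"
  by (rule linear_on_diff[OF subspace_W linear_on_id isometryD(1)[OF assms]])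

lemma
  assumes "isometry A A'"
  shows subspace_moved: "subspace (moved A)" and moved_subset: "moved A \<subseteq> W"
  using linear_on_image_subspace[OF linear_on_one_minus[OF assms] subspace_W]
    linear_on_one_minus[OF assms]
  by (auto simp: moved_def linear_on_def)

lemma moved_image:
  assumes "isometry A A'" "x \<in> moved A"
  shows "A x \<in> moved A"
proof -
  obtain y where "y \<in> W" "x = y - A y" using assms(2) by (auto simp: moved_def)
  then have "A x = A y - A (A y)" "A y \<in> W" using isometry_diff[OF assms(1)] isometryD[OF assms(1)] by auto
  then show ?thesis by (auto simp: moved_def)
qed

lemma moved_inverse_subset:
  assumes "isometry A A'"
  shows "moved A' \<subseteq> moved A"
proof
  fix x assume "x \<in> moved A'"
  then obtain y where y: "y \<in> W" "x = y - A' y" by (auto simp: moved_def)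
  have "- A' y \<in> W" using isometryD(4)[OF assms y(1)] subspace_W subspace_neg by blast
  moreover have "x = (- A' y) - A (- A' y)"
    using isometry_diff[OF assms subspace_0[OF subspace_W] isometryD(4)[OF assms y(1)]]
      isometryD(5)[OF assms y(1)] linear_on_0[OF isometryD(1)[OF assms] subspace_W] y by simp
  ultimately show "x \<in> moved A" unfolding moved_def by blast
qed

text \<open>As A' is adjoint to A, pairing x - A' x with y amounts to pairing x with y - A y, and
  the vectors x - A' x lie in Im (1 - A).\<close>

lemma fixed_if_orthogonal:
  assumes A: "isometry A A'" and y: "y \<in> W" and orth: "\<And>w. w \<in> moved A \<Longrightarrow> \<omega> w y = 0"
  shows "A y = y"
proof -
  note D = isometryD[OF A]
  have "\<omega> (y - A y) x = 0" if x: "x \<in> W" for x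
  proof -
    have "x - A' x \<in> moved A" using moved_inverse_subset[OF A] x by (auto simp: moved_def)
    then have "\<omega> x y - \<omega> (A' x) y = 0"
      using orth left_linear_diff[OF \<omega>L subspace_W x D(4)[OF x] y] by simp
    moreover have "\<omega> (A' x) y = \<omega> x (A y)" using D(7)[OF D(4)[OF x] y] D(5)[OF x] by simp
    ultimately have "\<omega> x (y - A y) = 0"
      using left_linear_diff[OF \<omega>R subspace_W y D(3)[OF y] x] by simp
    then show ?thesis
      using symplectic_antisym[OF symp subspace_W x] subspace_diff[OF subspace_W y D(3)[OF y]] by simp
  qed
  then have "y - A y = 0" by (intro nondeg) (use y D subspace_diff[OF subspace_W] in auto)
  then show ?thesis by simp
qed

lemma fixed_orthogonal:
  assumes A: "isometry A A'" and w: "w \<in> moved A" and y: "y \<in> W" "A y = y"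
  shows "H w y = 0" "H y w = 0"
proof -
  obtain x where x: "x \<in> W" "w = x - A x" using w by (auto simp: moved_def)
  note D = isometryD[OF A]
  show "H w y = 0"
    using left_linear_diff[OF HL subspace_W x(1) D(3)[OF x(1)] y(1)] D(8)[OF x(1) y(1)] x y by simp
  then show "H y w = 0" using H_cnj[of w y] w y moved_subset[OF A] by auto
qed

text \<open>Here definiteness of H, and so compactness, enters: kernel and image of 1 - A are
  H-orthogonal, which excludes Jordan blocks for the eigenvalue 1.\<close>

lemma fixed_moved_zero:
  assumes A: "isometry A A'" and "y \<in> moved A" "A y = y"
  shows "y = 0"
proof -
  have y: "y \<in> W" using moved_subset[OF A] assms(2) by (rule subsetD)
  show ?thesis
    by (rule hermitian_onD(3)[OF herm y]) (rule fixed_orthogonal(1)[OF A assms(2) y assms(3)])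
qed

text \<open>A vector of Im (1 - A) that is orthogonal to the whole image is fixed by A, hence
  0.\<close>

lemma symplectic_on_moved:
  assumes A: "isometry A A'"
  shows "symplectic_on (moved A) \<omega>"
  unfolding symplectic_on_def
proof (intro conjI ballI impI)
  note sub = moved_subset[OF A]
  show "bilinear_on (moved A) \<omega>" by (rule bilinear_on_mono[OF bil sub])
  fix x assume x: "x \<in> moved A"
  then show "\<omega> x x = 0" using alt sub by auto
  have xW: "x \<in> W" using x sub by blast
  assume 0: "\<forall>y\<in>moved A. \<omega> x y = 0"
  have "A x = x"
  proof (rule fixed_if_orthogonal[OF A xW])
    fix w assume w: "w \<in> moved A"
    then have "w \<in> W" using sub by blast
    from symplectic_antisym[OF symp subspace_W xW this] show "\<omega> w x = 0" using 0 w by simp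
  qed
  then show "x = 0" using fixed_moved_zero[OF A x] by simp
qed

lemma moved_basis:
  assumes A: "isometry A A'"
  obtains bs where "symplectic_list \<omega> bs" "basis_list (moved A) bs"
  by (rule symplectic_basis_exists[OF symplectic_on_moved[OF A] subspace_moved[OF A] fin
        subset_trans[OF moved_subset[OF A] W_span]]) (rule that)

section \<open>The orthogonal projection onto Im (1 - A)\<close>

abbreviation proj :: "('w \<Rightarrow> 'w) \<Rightarrow> 'w \<Rightarrow> 'w" where
  "proj A \<equiv> symplectic_proj \<omega> (moved A)"

text \<open>Existence comes from the explicit projection along a symplectic basis, uniqueness from
  \<open>fixed_moved_zero\<close>; together they evaluate the definite description in
  \<open>symplectic_proj\<close>.\<close>

lemma
  assumes A: "isometry A A'"
  shows linear_on_proj: "linear_on W (moved A) (proj A)"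
    and proj_form: "x \<in> W \<Longrightarrow> w \<in> moved A \<Longrightarrow> \<omega> (proj A x) w = \<omega> x w"
proof -
  note sub = moved_subset[OF A] and sp = subspace_moved[OF A]
  obtain bs where bs: "symplectic_list \<omega> bs" "basis_list (moved A) bs" using moved_basis[OF A] .
  have bsM: "set bs \<subseteq> moved A" and bsW: "set bs \<subseteq> W" and span: "span (set bs) = moved A"
    using basis_list_subset[OF bs(2)] sub bs(2) by (auto simp: basis_list_def)
  let ?P = "symplectic_projection \<omega> bs"
  have lin: "linear_on W (moved A) ?P"
    using linear_on_symplectic_projection[OF bil bsW] span by simp
  then have PM: "?P x \<in> moved A" if "x \<in> W" for x using that by (auto simp: linear_on_def)
  have form: "\<omega> (?P x) w = \<omega> x w" if x: "x \<in> W" and w: "w \<in> moved A" for x w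
  proof -
    have PW: "?P x \<in> W" using PM[OF x] sub by blast
    have d: "x - ?P x \<in> W" using subspace_diff[OF subspace_W x PW] .
    have "\<omega> (x - ?P x) w = 0"
    proof (rule span_orthogonal[OF \<omega>R subspace_W bsW d])
      show "w \<in> span (set bs)" using w span by simp
      fix z assume z: "z \<in> set bs"
      then show "\<omega> (x - ?P x) z = 0"
        using left_linear_diff[OF \<omega>L subspace_W x PW, of z] bsW
          symplectic_projection_form[OF bil subspace_W bsW bs(1) x z] by auto
    qed
    then show ?thesis using left_linear_diff[OF \<omega>L subspace_W x PW, of w] w sub by auto
  qed
  have eq: "proj A x = ?P x" if x: "x \<in> W" for x
    unfolding symplectic_proj_def
  proof (rule the_equality)
    have PW: "?P x \<in> W" using PM[OF x] sub by blast
    show "?P x \<in> moved A \<and> (\<forall>w\<in>moved A. \<omega> w (?P x) = \<omega> w x)"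
      using PM[OF x] form[OF x] sub symplectic_antisym[OF symp subspace_W x]
        symplectic_antisym[OF symp subspace_W PW] by (metis subsetD)
    fix u assume u: "u \<in> moved A \<and> (\<forall>w\<in>moved A. \<omega> w u = \<omega> w x)"
    then have uW: "u \<in> W" using sub by blast
    have "u - ?P x = 0"
    proof (rule fixed_moved_zero[OF A])
      show "u - ?P x \<in> moved A" using u PM[OF x] subspace_diff[OF sp] by blast
      show "A (u - ?P x) = u - ?P x"
      proof (rule fixed_if_orthogonal[OF A subspace_diff[OF subspace_W uW PW]])
        fix w assume w: "w \<in> moved A"
        then have wW: "w \<in> W" using sub by blast
        have "\<omega> w (?P x) = \<omega> w x"
          using form[OF x w] symplectic_antisym[OF symp subspace_W x wW]
            symplectic_antisym[OF symp subspace_W PW wW] by simp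
        then show "\<omega> w (u - ?P x) = 0"
          using left_linear_diff[OF \<omega>R subspace_W uW PW wW] u w by simp
      qed
    qed
    then show "u = ?P x" by simp
  qed
  show "linear_on W (moved A) (proj A)"
    using lin eq subspace_W unfolding linear_on_def
    by (simp add: image_subset_iff subspace_add subspace_scale)
  show "x \<in> W \<Longrightarrow> w \<in> moved A \<Longrightarrow> \<omega> (proj A x) w = \<omega> x w" using form eq by simp
qed

text \<open>The remainder x - P x is \<omega>-orthogonal to Im (1 - A), hence fixed by A, hence
  H-orthogonal to Im (1 - A) too. So one projection serves both forms, and (1 - A) P = 1 -
  A.\<close>

lemma
  assumes A: "isometry A A'" and x: "x \<in> W"
  shows proj_in: "proj A x \<in> moved A" and proj_W: "proj A x \<in> W"
    and proj_fixed: "A (x - proj A x) = x - proj A x"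
    and proj_H: "w \<in> moved A \<Longrightarrow> H (proj A x) w = H x w"
    and proj_minus: "proj A x - A (proj A x) = x - A x"
proof -
  note sub = moved_subset[OF A]
  show P: "proj A x \<in> moved A" using linear_on_proj[OF A] x by (auto simp: linear_on_def)
  then show PW: "proj A x \<in> W" using sub by blast
  have d: "x - proj A x \<in> W" using subspace_diff[OF subspace_W x PW] .
  show fix': "A (x - proj A x) = x - proj A x"
  proof (rule fixed_if_orthogonal[OF A d])
    fix w assume w: "w \<in> moved A"
    then have wW: "w \<in> W" using sub by blast
    have "\<omega> (x - proj A x) w = 0"
      using left_linear_diff[OF \<omega>L subspace_W x PW wW] proj_form[OF A x w] by simp
    then show "\<omega> w (x - proj A x) = 0" using symplectic_antisym[OF symp subspace_W d wW] by simp
  qed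
  show "H (proj A x) w = H x w" if w: "w \<in> moved A"
    using fixed_orthogonal(2)[OF A w d fix'] left_linear_diff[OF HL subspace_W x PW, of w] w sub by auto
  show "proj A x - A (proj A x) = x - A x"
    using fix' isometry_diff[OF A x PW] by (simp add: algebra_simps)
qed

text \<open>Eigenvalues are avoided by following 1 - s A from s = 0 to s = 1. Its determinant is
  real because 1 - s A' has the conjugate determinant, by adjointness for H, and the same
  determinant, by adjointness for \<omega>. It does not vanish because A preserves H.\<close>

theorem det_one_minus_positive:
  assumes A: "isometry A A'"
  obtains r where "0 < r" "det_on scale (moved A) (\<lambda>x. x - A x) = complex_of_real r"
proof -
  note D = isometryD[OF A] and sub = moved_subset[OF A] and sp = subspace_moved[OF A]
  let ?U = "moved A"
  obtain bs where bs: "symplectic_list \<omega> bs" "basis_list ?U bs" using moved_basis[OF A] .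
  define f where "f s x = x - complex_of_real s *\<^sub>C A x" for s x
  define f' where "f' s x = x - complex_of_real s *\<^sub>C A' x" for s x
  define \<delta> where "\<delta> s = det_on scale ?U (f s)" for s
  define \<delta>' where "\<delta>' s = det_on scale ?U (f' s)" for s
  have A_U: "linear_on ?U ?U A"
    by (rule linear_on_subset[OF D(1) sub]) (use moved_image[OF A] in auto)
  have A'_img: "A' x \<in> ?U" if "x \<in> ?U" for x
    using moved_image[OF isometry_inverse[OF A]] that moved_inverse_subset[OF A]
      moved_inverse_subset[OF isometry_inverse[OF A]] by blast
  have A'_U: "linear_on ?U ?U A'"
    by (rule linear_on_subset[OF D(2) sub]) (use A'_img in auto)
  have f: "linear_on ?U ?U (f s)" "linear_on ?U ?U (f' s)" for s
    using linear_on_lincomb[OF sp linear_on_id A_U, of 1 "- complex_of_real s"]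
      linear_on_lincomb[OF sp linear_on_id A'_U, of 1 "- complex_of_real s"]
    by (simp_all add: f_def[abs_def] f'_def[abs_def])
  have fU: "f s x \<in> ?U" "f' s x \<in> ?U" if "x \<in> ?U" for s x
    using f[of s] that by (auto simp: linear_on_def)
  have fW: "f s x \<in> W" "f' s x \<in> W" if "x \<in> ?U" for s x
    using fU[OF that] sub by auto
  have HU: "hermitian_on ?U H" and \<omega>U: "symplectic_on ?U \<omega>"
    using hermitian_on_mono[OF herm sub] symplectic_on_moved[OF A] by auto
  have bU: "set bs \<subseteq> ?U" using basis_list_subset[OF bs(2)] .
  have lin: "B (f s x) y = B x y - s * B (A x) y"
    if B: "left_linear_on W B" and xy: "x \<in> ?U" "y \<in> ?U" for s x y B
  proof -
    have "x \<in> W" "y \<in> W" "A x \<in> W" using xy sub D(3) by auto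
    then show ?thesis
      using left_linear_diff[OF B subspace_W, of x "s *\<^sub>C A x" y] left_linear_scale[OF B subspace_W, of "A x" y s]
        subspace_scale[OF subspace_W, of "A x" s] by (simp add: f_def)
  qed
  have lin': "B (f' s x) y = B x y - s * B (A' x) y"
    if B: "left_linear_on W B" and xy: "x \<in> ?U" "y \<in> ?U" for s x y B
  proof -
    have "x \<in> W" "y \<in> W" "A' x \<in> W" using xy sub D(4) by auto
    then show ?thesis
      using left_linear_diff[OF B subspace_W, of x "s *\<^sub>C A' x" y] left_linear_scale[OF B subspace_W, of "A' x" y s]
        subspace_scale[OF subspace_W, of "A' x" s] by (simp add: f'_def)
  qed
  have adj: "\<omega> (A x) y = \<omega> x (A' y)" "H (A x) y = H x (A' y)" if "x \<in> ?U" "y \<in> ?U" for x y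
  proof -
    have W: "x \<in> W" "y \<in> W" "A' y \<in> W" using that sub D(4) by auto
    show "\<omega> (A x) y = \<omega> x (A' y)" "H (A x) y = H x (A' y)"
      using D(7)[OF W(1,3)] D(8)[OF W(1,3)] D(5)[OF W(2)] by simp_all
  qed
  have H_adj: "H (f s x) y = cnj (H (f' s y) x)" if "x \<in> ?U" "y \<in> ?U" for s x y
  proof -
    have W: "x \<in> W" "y \<in> W" "A' y \<in> W" using that sub D(4) by auto
    show ?thesis
      using lin[OF HL that, of s] lin'[OF HL that(2,1), of s] adj(2)[OF that]
        H_cnj[OF W(2,1)] H_cnj[OF W(3,1)] by simp
  qed
  have \<omega>_adj: "\<omega> (f s x) y = \<omega> x (f' s y)" if "x \<in> ?U" "y \<in> ?U" for s x y
    using lin[OF \<omega>L that, of s] lin'[OF \<omega>R that(2,1), of s] adj(1)[OF that] by simp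
  define G where "G = gram_det H bs bs"
  have G: "G \<noteq> 0" "cnj G = G" using hermitian_gram_det[OF HU bs(2)] by (auto simp: G_def)
  have H\<delta>: "gram_det (\<lambda>x y. H (f s x) y) bs bs = \<delta> s * G" for s
    unfolding G_def \<delta>_def by (rule gram_det_left_map[OF hermitian_onD(1)[OF HU] bs(2) f(1)])
  have "\<delta> s = cnj (\<delta>' s)" for s
  proof -
    have "\<delta> s * G = gram_det (\<lambda>x y. cnj (H (f' s y) x)) bs bs"
      unfolding H\<delta>[symmetric] by (rule gram_det_cong) (use H_adj bU in blast)
    also have "\<dots> = cnj (gram_det (\<lambda>x y. H (f' s y) x) bs bs)" by (rule gram_det_cnj)
    also have "gram_det (\<lambda>x y. H (f' s y) x) bs bs = gram_det (\<lambda>x y. H (f' s x) y) bs bs"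
      by (rule gram_det_flip)
    also have "\<dots> = \<delta>' s * G"
      unfolding G_def \<delta>'_def by (rule gram_det_left_map[OF hermitian_onD(1)[OF HU] bs(2) f(2)])
    finally show ?thesis using G by simp
  qed
  moreover have "\<delta> s = \<delta>' s" for s
  proof -
    note L = bilinear_on_left[OF bilinear_on_mono[OF bil sub]]
      and R = bilinear_on_left[OF bilinear_on_flip[OF bilinear_on_mono[OF bil sub]]]
    have "\<delta> s * gram_det \<omega> bs bs = gram_det (\<lambda>x y. \<omega> (f s x) y) bs bs"
      unfolding \<delta>_def by (rule gram_det_left_map[OF L bs(2) f(1), symmetric])
    also have "\<dots> = gram_det (\<lambda>x y. \<omega> x (f' s y)) bs bs"
      by (rule gram_det_cong) (use \<omega>_adj bU in blast)
    also have "\<dots> = gram_det (\<lambda>x y. \<omega> y (f' s x)) bs bs" by (rule gram_det_flip[symmetric])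
    also have "\<dots> = \<delta>' s * gram_det (\<lambda>x y. \<omega> y x) bs bs"
      unfolding \<delta>'_def by (rule gram_det_left_map[OF R bs(2) f(2)])
    also have "gram_det (\<lambda>x y. \<omega> y x) bs bs = gram_det \<omega> bs bs" by (rule gram_det_flip)
    finally show ?thesis using symplectic_gram_det_nonzero[OF \<omega>U bs(2)] by simp
  qed
  ultimately have real: "\<delta> s \<in> \<real>" for s by (metis complex_cnj_cnj Reals_cnj_iff)
  have nonzero: "\<delta> s \<noteq> 0" if s: "s \<in> {0..1}" for s
  proof -
    have "gram_det (\<lambda>x y. H (f s x) y) bs bs \<noteq> 0"
    proof (rule gram_det_nonzero[OF _ bs(2)])
      show "left_linear_on ?U (\<lambda>x y. H (f s x) y)"
        using hermitian_onD(1)[OF HU] f(1)[of s] unfolding left_linear_on_def linear_on_def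
        by (auto simp: image_subset_iff)
      fix x assume x: "x \<in> ?U" and 0: "\<And>y. y \<in> set bs \<Longrightarrow> H (f s x) y = 0"
      have "H (f s x) (f s x) = 0"
        by (rule hermitian_orthogonal[OF HU bs(2) fU(1)[OF x] fU(1)[OF x] 0])
      then have "f s x = 0" by (rule hermitian_onD(3)[OF HU fU(1)[OF x]])
      \<comment> \<open>Now H x x = s^2 H x x. Either x = 0, or s = 1 and x is fixed by A while
        lying in Im (1 - A).\<close>
      then have eq: "x = complex_of_real s *\<^sub>C A x" by (simp add: f_def)
      have W: "x \<in> W" "A x \<in> W" using x sub D(3) by auto
      have "H x x = complex_of_real s * H (A x) x"
        using left_linear_scale[OF HL subspace_W W(2,1), of s] eq by simp
      also have "H (A x) x = complex_of_real s * H (A x) (A x)"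
        using left_linear_scale[OF HL subspace_W W(2,2), of s] eq H_cnj[OF W] H_cnj[OF W(2,2)]
        by (metis complex_cnj_complex_of_real complex_cnj_mult)
      also have "H (A x) (A x) = H x x" using D(8) W by simp
      finally have "(1 - complex_of_real (s * s)) * H x x = 0" by (simp add: algebra_simps)
      then have "complex_of_real (s * s) = 1 \<or> H x x = 0" by auto
      then have "s * s = 1 \<or> H x x = 0" by (metis of_real_eq_1_iff)
      moreover have "x = 0" if "s * s = 1"
      proof -
        have "s = 1" using that s by (simp add: square_eq_1_iff)
        then show ?thesis using eq fixed_moved_zero[OF A x] by simp
      qed
      ultimately show "x = 0" using hermitian_onD(3)[OF herm W(1)] by blast
    qed
    then show ?thesis using H\<delta> by auto
  qed
  \<comment> \<open>Continuity is read off from a quotient of Gram determinants, whose entries are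
    affine in s, rather than from \<open>det_on\<close> itself.\<close>
  have "continuous_on {0..1} (\<lambda>s. gram_det (\<lambda>x y. H x y - complex_of_real s * H (A x) y) bs bs / G)"
    using G by (intro continuous_on_divide continuous_on_gram_det continuous_intros) auto
  moreover have "gram_det (\<lambda>x y. H x y - complex_of_real s * H (A x) y) bs bs / G = \<delta> s" for s
  proof -
    have "gram_det (\<lambda>x y. H x y - complex_of_real s * H (A x) y) bs bs = gram_det (\<lambda>x y. H (f s x) y) bs bs"
      by (rule gram_det_cong, rule lin[OF HL, symmetric]) (use bU in auto)
    then show ?thesis using H\<delta> G by simp
  qed
  ultimately have "continuous_on {0..1} \<delta>" by simp
  moreover have "\<delta> 0 = 1"
    using H\<delta>[of 0] G by (simp add: f_def G_def[symmetric])
  ultimately have "0 < Re (\<delta> 1)"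
    using positive_along_path[of \<delta> 1] real nonzero by simp
  moreover have "\<delta> 1 = complex_of_real (Re (\<delta> 1))" using real[of 1] by (simp add: complex_is_Real_iff complex_eq_iff)
  moreover have "f 1 = (\<lambda>x. x - A x)" by (simp add: f_def[abs_def])
  ultimately show ?thesis using that unfolding \<delta>_def by metis
qed

end

section \<open>Transversal pairs\<close>

context unitary_symplectic_space
begin

text \<open>The vector k - B k = A (B k) - B k lies in both images, so it is 0.\<close>

lemma fixed_product:
  assumes A: "isometry A A'" and B: "isometry B B'" and disj: "moved A \<inter> moved B = {0}"
    and k: "k \<in> W" "A (B k) = k"
  shows "A k = k \<and> B k = k"
proof -
  have Bk: "B k \<in> W" using isometryD(3)[OF B k(1)] .
  have "B k - A (B k) \<in> moved A" using Bk by (auto simp: moved_def)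
  then have "k - B k \<in> moved A" using subspace_neg[OF subspace_moved[OF A]] k(2) by fastforce
  moreover have "k - B k \<in> moved B" using k(1) by (auto simp: moved_def)
  ultimately have "k - B k \<in> moved A \<inter> moved B" by simp
  then have "B k = k" using disj by auto
  then show ?thesis using k(2) by simp
qed

text \<open>One inclusion is 1 - A B = (1 - A) B + (1 - B). For the other, the part k of z left over
  by the projection is fixed by A B, hence by A and by B, and so it is H-orthogonal to both
  summands; but it lies in their sum.\<close>

lemma moved_product:
  assumes A: "isometry A A'" and B: "isometry B B'" and disj: "moved A \<inter> moved B = {0}"
  shows "moved (\<lambda>x. A (B x)) = {x + y | x y. x \<in> moved A \<and> y \<in> moved B}"
proof (intro equalityI subsetI)
  fix z assume "z \<in> moved (\<lambda>x. A (B x))"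
  then obtain x where x: "x \<in> W" "z = x - A (B x)" by (auto simp: moved_def)
  then have "z = (B x - A (B x)) + (x - B x)" by simp
  moreover have "B x - A (B x) \<in> moved A" "x - B x \<in> moved B"
    using x isometryD(3)[OF B] by (auto simp: moved_def)
  ultimately show "z \<in> {x + y | x y. x \<in> moved A \<and> y \<in> moved B}" by blast
next
  let ?C = "\<lambda>x. A (B x)"
  have C: "isometry ?C (\<lambda>x. B' (A' x))" by (rule isometry_comp[OF A B])
  fix z assume "z \<in> {x + y | x y. x \<in> moved A \<and> y \<in> moved B}"
  then obtain x y where z: "z = x + y" "x \<in> moved A" "y \<in> moved B" by blast
  have zW: "z \<in> W" using z moved_subset[OF A] moved_subset[OF B] subspace_add[OF subspace_W] by blast
  define k where "k = z - proj ?C z"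
  have kW: "k \<in> W" unfolding k_def by (rule subspace_diff[OF subspace_W zW proj_W[OF C zW]])
  have k: "A k = k" "B k = k"
    using fixed_product[OF A B disj kW] proj_fixed[OF C zW] by (simp_all add: k_def)
  obtain u where u: "u \<in> W" "proj ?C z = u - A (B u)" using proj_in[OF C zW] by (auto simp: moved_def)
  \<comment> \<open>Subtracting from x and y the two components of u - A (B u) writes k as a sum of
    members of the two images.\<close>
  define v w where "v = x - (B u - A (B u))" and "w = y - (u - B u)"
  have v: "v \<in> moved A"
    unfolding v_def
    by (rule subspace_diff[OF subspace_moved[OF A] z(2)]) (use u isometryD(3)[OF B] in \<open>auto simp: moved_def\<close>)
  have w: "w \<in> moved B"
    unfolding w_def
    by (rule subspace_diff[OF subspace_moved[OF B] z(3)]) (use u in \<open>auto simp: moved_def\<close>)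
  have kvw: "k = v + w" unfolding k_def u(2) v_def w_def by (simp add: z(1))
  have "H (v + w) k = H v k + H w k"
    using left_linear_add[OF HL _ _ kW] v w moved_subset[OF A] moved_subset[OF B] by blast
  then have "H k k = 0"
    using fixed_orthogonal(1)[OF A v kW k(1)] fixed_orthogonal(1)[OF B w kW k(2)] kvw by simp
  then have "k = 0" by (rule hermitian_onD(3)[OF herm kW])
  then have "z = proj ?C z" by (simp add: k_def)
  then show "z \<in> moved ?C" using proj_in[OF C zW] by simp
qed

end

section \<open>Two isometries with independent images, and the factorisation of 1 - A B\<close>

locale transversal_isometries = unitary_symplectic_space scale
  for scale :: "complex \<Rightarrow> 'w::ab_group_add \<Rightarrow> 'w" (infixr "*\<^sub>C" 75) +
  fixes A A' B B' :: "'w \<Rightarrow> 'w"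
  assumes A: "isometry A A'" and B: "isometry B B'" and disj: "moved A \<inter> moved B = {0}"
begin

abbreviation "AB \<equiv> (\<lambda>x. A (B x))"
abbreviation "U \<equiv> moved AB"
abbreviation "UA \<equiv> moved A"
abbreviation "UB \<equiv> moved B"

lemma AB: "isometry AB (\<lambda>x. B' (A' x))"
  by (rule isometry_comp[OF A B])

lemmas sub_U = moved_subset[OF AB] and sub_UA = moved_subset[OF A] and sub_UB = moved_subset[OF B]
lemmas subspace_U = subspace_moved[OF AB] and subspace_UA = subspace_moved[OF A]
  and subspace_UB = subspace_moved[OF B]

lemma U_eq: "U = {x + y | x y. x \<in> UA \<and> y \<in> UB}"
  by (rule moved_product[OF A B disj])

lemma UA_U: "UA \<subseteq> U" and UB_U: "UB \<subseteq> U"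
proof -
  have "u + 0 \<in> U" if "u \<in> UA" for u using that subspace_0[OF subspace_UB] unfolding U_eq by blast
  then show "UA \<subseteq> U" by auto
  have "0 + v \<in> U" if "v \<in> UB" for v using that subspace_0[OF subspace_UA] unfolding U_eq by blast
  then show "UB \<subseteq> U" by auto
qed

text \<open>The projection along UB, in contrast to the \<omega>-orthogonal \<open>proj A\<close>;
  they agree on U only when the summands are \<omega>-orthogonal.\<close>

definition p :: "'w \<Rightarrow> 'w" where
  "p x = (THE u. u \<in> UA \<and> x - u \<in> UB)"

abbreviation q :: "'w \<Rightarrow> 'w" where
  "q x \<equiv> x - p x"

lemma p_eq: "u \<in> UA \<Longrightarrow> x - u \<in> UB \<Longrightarrow> p x = u"
  unfolding p_def
proof (rule the_equality)
  fix v assume u: "u \<in> UA" "x - u \<in> UB" and v: "v \<in> UA \<and> x - v \<in> UB"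
  have "v - u \<in> UA" using u v subspace_diff[OF subspace_UA] by blast
  moreover have "(x - u) - (x - v) \<in> UB" using u v subspace_diff[OF subspace_UB] by blast
  moreover have "(x - u) - (x - v) = v - u" by simp
  ultimately have "v - u \<in> UA \<inter> UB" by simp
  then show "v = u" using disj by simp
qed auto

lemma p_in: "x \<in> U \<Longrightarrow> p x \<in> UA" and q_in: "x \<in> U \<Longrightarrow> q x \<in> UB"
  unfolding U_eq using p_eq by fastforce+

lemma p_add: "u \<in> UA \<Longrightarrow> v \<in> UB \<Longrightarrow> p (u + v) = u"
  by (rule p_eq) auto

lemma p_UA: "u \<in> UA \<Longrightarrow> p u = u"
  using p_add[of u 0] subspace_0[OF subspace_UB] by simp

lemma p_UB: "v \<in> UB \<Longrightarrow> p v = 0"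
  using p_add[of 0 v] subspace_0[OF subspace_UA] by simp

lemma linear_p: "linear_on U UA p"
  unfolding linear_on_def
proof (intro conjI ballI allI)
  show "p ` U \<subseteq> UA" using p_in by auto
  fix x y a assume x: "x \<in> U" and y: "y \<in> U"
  show "p (a *\<^sub>C x + y) = a *\<^sub>C p x + p y"
  proof (rule p_eq)
    show "a *\<^sub>C p x + p y \<in> UA"
      using p_in[OF x] p_in[OF y] subspace_UA by (simp add: subspace_add subspace_scale)
    have "a *\<^sub>C q x + q y \<in> UB"
      using q_in[OF x] q_in[OF y] subspace_UB by (simp add: subspace_add subspace_scale)
    moreover have "a *\<^sub>C q x + q y = a *\<^sub>C x + y - (a *\<^sub>C p x + p y)"
      by (simp add: algebra_simps)
    ultimately show "a *\<^sub>C x + y - (a *\<^sub>C p x + p y) \<in> UB" by simp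
  qed
qed

lemma linear_q: "linear_on U UB q"
proof -
  have "linear_on U U p" using linear_on_subset[OF linear_p subset_refl] p_in UA_U by blast
  then have "linear_on U U q" by (rule linear_on_diff[OF subspace_U linear_on_id])
  then show ?thesis using q_in unfolding linear_on_def by auto
qed

definition \<Psi> :: "'w \<Rightarrow> 'w" where
  "\<Psi> x = proj A x + proj B x"

definition L :: "'w \<Rightarrow> 'w" where
  "L y = (p y - A (p y)) + A (q y - B (q y))"

text \<open>Composition with \<Psi> turns the projections p and q of the direct sum into the
  orthogonal ones, which translates between the two ways of extending forms.\<close>

lemma p_\<Psi>: "x \<in> W \<Longrightarrow> p (\<Psi> x) = proj A x" and q_\<Psi>: "x \<in> W \<Longrightarrow> q (\<Psi> x) = proj B x"
  using p_add[OF proj_in[OF A] proj_in[OF B]] by (simp_all add: \<Psi>_def)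

lemma linear_\<Psi>: "linear_on U U \<Psi>"
proof -
  have "linear_on U U (proj A)"
    by (rule linear_on_subset[OF linear_on_proj[OF A] sub_U]) (use proj_in[OF A] sub_U UA_U in blast)
  moreover have "linear_on U U (proj B)"
    by (rule linear_on_subset[OF linear_on_proj[OF B] sub_U]) (use proj_in[OF B] sub_U UB_U in blast)
  ultimately show ?thesis unfolding \<Psi>_def[abs_def] by (rule linear_on_add[OF subspace_U])
qed

lemma L_\<Psi>:
  assumes x: "x \<in> W"
  shows "L (\<Psi> x) = x - A (B x)"
proof -
  have "L (\<Psi> x) = (proj A x - A (proj A x)) + A (proj B x - B (proj B x))"
    unfolding L_def q_\<Psi>[OF x] unfolding p_\<Psi>[OF x] ..
  also have "\<dots> = (x - A x) + A (x - B x)"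
    by (simp only: proj_minus[OF A x] proj_minus[OF B x])
  also have "\<dots> = x - A (B x)"
    using isometry_diff[OF A x isometryD(3)[OF B x]] by simp
  finally show ?thesis .
qed

lemma one_minus_A: "z \<in> W \<Longrightarrow> z - A z \<in> UA" and one_minus_B: "z \<in> W \<Longrightarrow> z - B z \<in> UB"
  by (auto simp: moved_def)

lemma A_U: "z \<in> UB \<Longrightarrow> A z \<in> U"
proof -
  assume z: "z \<in> UB"
  then have "z - (z - A z) \<in> U"
    using UB_U UA_U sub_UB one_minus_A[of z] subspace_diff[OF subspace_U] by blast
  then show "A z \<in> U" by simp
qed

lemma linear_L: "linear_on U U L"
proof -
  have pU: "linear_on U W p" and qU: "linear_on U W q"
    by (rule linear_on_subset[OF linear_p subset_refl] linear_on_subset[OF linear_q subset_refl];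
        use p_in q_in sub_UA sub_UB in blast)+
  have "linear_on U W L"
    unfolding L_def[abs_def]
    by (rule linear_on_add[OF subspace_W
          linear_on_comp[OF linear_on_one_minus[OF A] pU]
          linear_on_comp[OF isometryD(1)[OF A] linear_on_comp[OF linear_on_one_minus[OF B] qU]]])
  moreover have "L ` U \<subseteq> U"
  proof safe
    fix x assume x: "x \<in> U"
    have "p x - A (p x) \<in> U" using p_in[OF x] sub_UA UA_U one_minus_A by blast
    moreover have "A (q x - B (q x)) \<in> U" using q_in[OF x] sub_UB one_minus_B A_U by blast
    ultimately show "L x \<in> U" unfolding L_def by (rule subspace_add[OF subspace_U])
  qed
  ultimately show ?thesis by (rule linear_on_subset[OF _ subset_refl])
qed

lemma L_UA: "u \<in> UA \<Longrightarrow> L u = u - A u"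
proof -
  assume u: "u \<in> UA"
  have "A 0 = 0" by (rule linear_on_0[OF isometryD(1)[OF A] subspace_W])
  moreover have "B 0 = 0" by (rule linear_on_0[OF isometryD(1)[OF B] subspace_W])
  ultimately show "L u = u - A u" using p_UA[OF u] by (simp add: L_def)
qed

text \<open>A z differs from z by an element of UA, so the factor A in L leaves the diagonal block 1
  - B unchanged.\<close>

lemma q_L_UB: "v \<in> UB \<Longrightarrow> q (L v) = v - B v"
proof -
  assume v: "v \<in> UB"
  let ?z = "v - B v"
  have z: "?z \<in> UB" using v sub_UB one_minus_B by blast
  have zW: "?z \<in> W" using z sub_UB by blast
  have "A 0 = 0" by (rule linear_on_0[OF isometryD(1)[OF A] subspace_W])
  then have "L v = A ?z" using p_UB[OF v] by (simp add: L_def)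
  also have "\<dots> = - (?z - A ?z) + ?z" by simp
  finally have L: "L v = - (?z - A ?z) + ?z" .
  have "- (?z - A ?z) \<in> UA" using one_minus_A[OF zW] subspace_neg[OF subspace_UA] by blast
  then have "p (L v) = - (?z - A ?z)" unfolding L by (rule p_add[OF _ z])
  then show "q (L v) = v - B v" unfolding L by simp
qed

section \<open>Deformation to the orthogonal sum of the restrictions\<close>

definition split_form :: "('w \<Rightarrow> 'w \<Rightarrow> complex) \<Rightarrow> 'w \<Rightarrow> 'w \<Rightarrow> complex" where
  "split_form F x y = F (p x) (p y) + F (q x) (q y)"

definition path_form :: "('w \<Rightarrow> 'w \<Rightarrow> complex) \<Rightarrow> real \<Rightarrow> 'w \<Rightarrow> 'w \<Rightarrow> complex" where
  "path_form F t x y = complex_of_real (1 - t) * split_form F x y + complex_of_real t * F x y"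

definition \<Psi>t :: "real \<Rightarrow> 'w \<Rightarrow> 'w" where
  "\<Psi>t t x = complex_of_real (1 - t) *\<^sub>C x + complex_of_real t *\<^sub>C \<Psi> x"

lemma linear_\<Psi>t: "linear_on U U (\<Psi>t t)"
  unfolding \<Psi>t_def[abs_def] by (rule linear_on_lincomb[OF subspace_U linear_on_id linear_\<Psi>])

lemma left_linear_split:
  assumes F: "left_linear_on W F"
  shows "left_linear_on U (split_form F)"
  unfolding left_linear_on_def
proof (intro ballI allI)
  fix x y z a assume x: "x \<in> U" and y: "y \<in> U" and z: "z \<in> U"
  have "p (a *\<^sub>C x + y) = a *\<^sub>C p x + p y" "q (a *\<^sub>C x + y) = a *\<^sub>C q x + q y"
    using linear_p linear_q x y unfolding linear_on_def by blast+
  moreover have "F (a *\<^sub>C p x + p y) (p z) = a * F (p x) (p z) + F (p y) (p z)"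
    using F p_in[OF x] p_in[OF y] p_in[OF z] sub_UA unfolding left_linear_on_def by blast
  moreover have "F (a *\<^sub>C q x + q y) (q z) = a * F (q x) (q z) + F (q y) (q z)"
    using F q_in[OF x] q_in[OF y] q_in[OF z] sub_UB unfolding left_linear_on_def by blast
  ultimately show "split_form F (a *\<^sub>C x + y) z = a * split_form F x z + split_form F y z"
    unfolding split_form_def by (simp add: algebra_simps)
qed

lemma left_linear_path:
  assumes F: "left_linear_on W F"
  shows "left_linear_on U (path_form F t)"
  using left_linear_split[OF F] left_linear_on_mono[OF F sub_U]
  unfolding left_linear_on_def path_form_def by (simp add: algebra_simps)

text \<open>Pairing \<open>proj A x\<close> with p y is pairing x with p y, likewise for B and q y,
  and the two values add up because p y + q y = y. The disjunction admits bilinear and sesquilinear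
  F alike.\<close>

lemma split_\<Psi>:
  assumes F: "left_linear_on W F" "left_linear_on W (\<lambda>x y. cnj (F y x)) \<or> left_linear_on W (\<lambda>x y. F y x)"
    and adj: "\<And>x w. x \<in> W \<Longrightarrow> w \<in> UA \<Longrightarrow> F (proj A x) w = F x w"
      "\<And>x w. x \<in> W \<Longrightarrow> w \<in> UB \<Longrightarrow> F (proj B x) w = F x w"
    and x: "x \<in> U" and y: "y \<in> U"
  shows "split_form F (\<Psi> x) y = F x y"
proof -
  have W: "x \<in> W" "p y \<in> W" "q y \<in> W" using x y sub_U sub_UA sub_UB p_in[OF y] q_in[OF y] by auto
  have "split_form F (\<Psi> x) y = F x (p y) + F x (q y)"
    unfolding split_form_def q_\<Psi>[OF W(1)] unfolding p_\<Psi>[OF W(1)] using adj W(1) p_in[OF y] q_in[OF y] by simp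
  also have "\<dots> = F x (p y + q y)"
    using F(2)
  proof
    assume R: "left_linear_on W (\<lambda>x y. cnj (F y x))"
    have "cnj (F x (p y + q y)) = cnj (F x (p y)) + cnj (F x (q y))"
      by (rule left_linear_add[OF R W(2,3,1)])
    then show ?thesis by (metis complex_cnj_add complex_cnj_cnj)
  next
    assume R: "left_linear_on W (\<lambda>x y. F y x)"
    show ?thesis by (rule left_linear_add[OF R W(2,3,1), symmetric])
  qed
  finally show ?thesis by simp
qed

lemma split_\<Psi>_\<omega>: "x \<in> U \<Longrightarrow> y \<in> U \<Longrightarrow> split_form \<omega> (\<Psi> x) y = \<omega> x y"
  by (rule split_\<Psi>[OF \<omega>L _ proj_form[OF A] proj_form[OF B]]) (use \<omega>R in auto)

lemma split_\<Psi>_H: "x \<in> U \<Longrightarrow> y \<in> U \<Longrightarrow> split_form H (\<Psi> x) y = H x y"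
proof (rule split_\<Psi>[OF HL _ proj_H[OF A] proj_H[OF B]])
  have "left_linear_on W (\<lambda>x y. cnj (H y x))"
    unfolding left_linear_on_def
  proof (intro ballI allI)
    fix x y z a assume W: "x \<in> W" "y \<in> W" "z \<in> W"
    then have "a *\<^sub>C x + y \<in> W" using subspace_W by (simp add: subspace_add subspace_scale)
    moreover have "cnj (H z u) = H u z" if "u \<in> W" for u using H_cnj[OF W(3) that] by simp
    moreover have "H (a *\<^sub>C x + y) z = a * H x z + H y z"
      using HL W unfolding left_linear_on_def by blast
    ultimately show "cnj (H z (a *\<^sub>C x + y)) = a * cnj (H z x) + cnj (H z y)"
      using W by simp
  qed
  then show "left_linear_on W (\<lambda>x y. cnj (H y x)) \<or> left_linear_on W (\<lambda>x y. H y x)" ..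
qed

text \<open>The form F enters only through the relation for \<Psi>, so the same map
  \<open>\<Psi>t t\<close> governs the paths of \<omega> and of H.\<close>

lemma path_\<Psi>t:
  assumes F: "left_linear_on W F" and split: "\<And>x y. x \<in> U \<Longrightarrow> y \<in> U \<Longrightarrow> split_form F (\<Psi> x) y = F x y"
    and x: "x \<in> U" and y: "y \<in> U"
  shows "split_form F (\<Psi>t t x) y = path_form F t x y"
proof -
  have \<Psi>x: "\<Psi> x \<in> U" using linear_\<Psi> x unfolding linear_on_def by blast
  have s: "complex_of_real t *\<^sub>C \<Psi> x \<in> U" using \<Psi>x subspace_U by (rule subspace_scale[rotated])
  have "split_form F (\<Psi>t t x) y =
      complex_of_real (1 - t) * split_form F x y + split_form F (complex_of_real t *\<^sub>C \<Psi> x) y"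
    unfolding \<Psi>t_def using left_linear_split[OF F] x y s unfolding left_linear_on_def by blast
  also have "split_form F (complex_of_real t *\<^sub>C \<Psi> x) y = complex_of_real t * F x y"
    using left_linear_scale[OF left_linear_split[OF F] subspace_U \<Psi>x y] split[OF x y] by simp
  finally show ?thesis by (simp add: path_form_def)
qed

lemma hermitian_path:
  assumes t: "t \<in> {0..1}"
  shows "hermitian_on U (path_form H t)"
  unfolding hermitian_on_def
proof (intro conjI ballI impI)
  show "left_linear_on U (path_form H t)" by (rule left_linear_path[OF HL])
  fix x assume x: "x \<in> U"
  have W: "x \<in> W" "p x \<in> W" "q x \<in> W" using x sub_U sub_UA sub_UB p_in[OF x] q_in[OF x] by auto
  {
    fix y assume y: "y \<in> U"
    have Wy: "y \<in> W" "p y \<in> W" "q y \<in> W" using y sub_U sub_UA sub_UB p_in[OF y] q_in[OF y] by auto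
    show "path_form H t y x = cnj (path_form H t x y)"
      unfolding path_form_def split_form_def H_cnj[OF W(1) Wy(1)] H_cnj[OF W(2) Wy(2)] H_cnj[OF W(3) Wy(3)]
      by simp
  next
    assume "x \<noteq> 0"
    have pos: "0 < Re (H z z)" if "z \<in> W" "z \<noteq> 0" for z
      using herm that unfolding hermitian_on_def by blast
    have nonneg: "0 \<le> Re (H z z)" if "z \<in> W" for z
    proof (cases "z = 0")
      case True
      then show ?thesis using left_linear_0[OF HL subspace_W that] by simp
    qed (use pos[OF that] in simp)
    have posx: "0 < Re (H x x)" by (rule pos[OF W(1) \<open>x \<noteq> 0\<close>])
    have "p x \<noteq> 0 \<or> q x \<noteq> 0" using \<open>x \<noteq> 0\<close> by auto
    then have "0 < Re (H (p x) (p x)) \<or> 0 < Re (H (q x) (q x))"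
      using pos[OF W(2)] pos[OF W(3)] by blast
    then have pos0: "0 < Re (split_form H x x)"
      using nonneg[OF W(2)] nonneg[OF W(3)] unfolding split_form_def by auto
    have "Re (path_form H t x x) = (1 - t) * Re (split_form H x x) + t * Re (H x x)"
      by (simp add: path_form_def)
    also have "\<dots> > 0"
    proof (cases "t = 1")
      case False
      then have "0 < (1 - t) * Re (split_form H x x)" using t pos0 by (intro mult_pos_pos) auto
      moreover have "0 \<le> t * Re (H x x)" using t posx by (intro mult_nonneg_nonneg) auto
      ultimately show ?thesis by linarith
    qed (use posx in simp)
    finally show "0 < Re (path_form H t x x)" .
  }
qed

text \<open>A segment between symplectic forms may meet degenerate ones, so nondegeneracy is
  borrowed from H. If x is in the kernel, then \<open>\<Psi>t t x\<close> = 0 because \<omega> is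
  nondegenerate on each summand, and so the positive definite form \<open>path_form H t\<close>
  vanishes at (x, x).\<close>

lemma symplectic_path:
  assumes t: "t \<in> {0..1}"
  shows "symplectic_on U (path_form \<omega> t)"
  unfolding symplectic_on_def
proof (intro conjI ballI impI)
  have flip: "(\<lambda>x y. path_form \<omega> t y x) = path_form (\<lambda>x y. \<omega> y x) t"
    by (intro ext) (simp add: path_form_def split_form_def)
  have L: "left_linear_on U (path_form \<omega> t)" by (rule left_linear_path[OF \<omega>L])
  have R: "left_linear_on U (\<lambda>x y. path_form \<omega> t y x)" unfolding flip by (rule left_linear_path[OF \<omega>R])
  show "bilinear_on U (path_form \<omega> t)"
    using L R unfolding bilinear_on_def left_linear_on_def by blast
  fix x assume x: "x \<in> U"
  have W: "x \<in> W" "p x \<in> W" "q x \<in> W" using x sub_U sub_UA sub_UB p_in[OF x] q_in[OF x] by auto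
  show "path_form \<omega> t x x = 0"
    unfolding path_form_def split_form_def using alt[OF W(1)] alt[OF W(2)] alt[OF W(3)] by simp
  assume 0: "\<forall>y\<in>U. path_form \<omega> t x y = 0"
  define z where "z = \<Psi>t t x"
  have z: "z \<in> U" using linear_\<Psi>t[of t] x unfolding linear_on_def z_def by blast
  have zy: "split_form \<omega> z y = 0" if "y \<in> U" for y
    using path_\<Psi>t[OF \<omega>L split_\<Psi>_\<omega> x that] 0 that by (simp add: z_def)
  have pz: "p z \<in> UA" and qz: "q z \<in> UB" using p_in[OF z] q_in[OF z] by auto
  have \<omega>0: "\<omega> w 0 = 0" if "w \<in> W" for w using left_linear_0[OF \<omega>R subspace_W that] .
  have pzW: "p z \<in> W" and qzW: "q z \<in> W" using pz qz sub_UA sub_UB by auto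
  have "p z = 0"
  proof -
    have "\<omega> (p z) y = 0" if y: "y \<in> UA" for y
      using zy[OF subsetD[OF UA_U y]] p_UA[OF y] \<omega>0[OF qzW] by (simp add: split_form_def)
    then show ?thesis using symplectic_on_moved[OF A] pz unfolding symplectic_on_def by blast
  qed
  moreover have "q z = 0"
  proof -
    have "\<omega> (q z) y = 0" if y: "y \<in> UB" for y
      using zy[OF subsetD[OF UB_U y]] p_UB[OF y] \<omega>0[OF pzW] by (simp add: split_form_def)
    then show ?thesis using symplectic_on_moved[OF B] qz unfolding symplectic_on_def by blast
  qed
  ultimately have "z = 0" by simp
  then have "path_form H t x x = 0"
    using path_\<Psi>t[OF HL split_\<Psi>_H x x, of t] left_linear_0[OF left_linear_split[OF HL] subspace_U x]
    by (simp add: z_def)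
  then show "x = 0" by (rule hermitian_onD(3)[OF hermitian_path[OF t] x])
qed

end

section \<open>Volume forms and the comparison in top degree\<close>

context unitary_symplectic_space
begin

definition volume :: "'w set \<Rightarrow> 'w list \<Rightarrow> complex" where
  "volume V xs = 1 / fact (dim V div 2) * wedge_power (restricted_two_form \<omega> V) (dim V div 2) xs"

lemma alternating_volume:
  assumes A: "isometry A A'"
  shows "alternating (moved A) (volume (moved A))"
  unfolding volume_def[abs_def]
proof (intro alternating_scale alternating_wedge_power alternating_restricted_two_form)
  show "bilinear_on (moved A) \<omega>" by (rule bilinear_on_mono[OF bil moved_subset[OF A]])
  show "\<omega> x x = 0" if "x \<in> moved A" for x using that alt moved_subset[OF A] by blast
qed (rule subspace_moved[OF A])+

lemma volume_length:
  assumes "length xs \<noteq> 2 * (dim V div 2)"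
  shows "volume V xs = 0"
proof -
  have "wedge_power (restricted_two_form \<omega> V) (dim V div 2) xs = 0"
    by (rule wedge_power_length) (use assms in \<open>auto simp: restricted_two_form_def\<close>)
  then show ?thesis by (simp add: volume_def)
qed

lemma volume_basis:
  assumes "symplectic_list \<omega> bs" "basis_list V bs"
  shows "volume V bs = 1" "length bs = 2 * (dim V div 2)"
proof -
  show len: "length bs = 2 * (dim V div 2)"
    using even_length_symplectic_list[OF assms(1)] length_basis_list[OF assms(2)] by simp
  show "volume V bs = 1"
    using wedge_power_symplectic_list[OF assms(1) basis_list_subset[OF assms(2)] len]
    by (simp add: volume_def)
qed

end

lemma real_if_square_positive:
  fixes z :: complex
  assumes "z\<^sup>2 \<in> \<real>" "0 < Re (z\<^sup>2)"
  shows "z \<in> \<real>"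
proof -
  have "Re z * Im z = 0" using assms(1) by (auto simp: complex_is_Real_iff power2_eq_square)
  moreover have "Re z \<noteq> 0"
  proof
    assume "Re z = 0"
    then have "Re (z\<^sup>2) = - (Im z * Im z)" by (simp add: power2_eq_square)
    then show False using assms(2) by (simp add: not_sum_squares_lt_zero)
  qed
  ultimately show ?thesis by (simp add: complex_is_Real_iff)
qed

context transversal_isometries
begin

lemma split_UA: "x \<in> UA \<Longrightarrow> y \<in> UA \<Longrightarrow> split_form \<omega> x y = \<omega> x y"
  using p_UA left_linear_0[OF \<omega>L subspace_W subspace_0[OF subspace_W]] by (simp add: split_form_def)

lemma split_UB: "x \<in> UB \<Longrightarrow> y \<in> UB \<Longrightarrow> split_form \<omega> x y = \<omega> x y"
  using p_UB left_linear_0[OF \<omega>L subspace_W subspace_0[OF subspace_W]] by (simp add: split_form_def)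

lemma split_UA_UB:
  assumes x: "x \<in> UA" and y: "y \<in> UB"
  shows "split_form \<omega> x y = 0 \<and> split_form \<omega> y x = 0"
proof -
  have W: "x \<in> W" "y \<in> W" using x y sub_UA sub_UB by auto
  show ?thesis
    using p_UA[OF x] p_UB[OF y] left_linear_0[OF \<omega>L subspace_W W(1)] left_linear_0[OF \<omega>L subspace_W W(2)]
      left_linear_0[OF \<omega>R subspace_W W(1)] left_linear_0[OF \<omega>R subspace_W W(2)]
    by (simp add: split_form_def)
qed

lemma path_form_0: "path_form F 0 = split_form F" and path_form_1: "path_form F 1 = F"
  by (intro ext, simp add: path_form_def)+

text \<open>Independence of e @ f comes from its being a symplectic list for the split form.\<close>

lemma joint_basis:
  assumes e: "symplectic_list \<omega> e" "basis_list UA e" and f: "symplectic_list \<omega> f" "basis_list UB f"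
  shows "symplectic_list (split_form \<omega>) (e @ f)" "basis_list U (e @ f)"
proof -
  note eU = basis_list_subset[OF e(2)] and fU = basis_list_subset[OF f(2)]
  have "symplectic_list (split_form \<omega>) e = symplectic_list \<omega> e"
    by (rule symplectic_list_cong, rule split_UA) (use eU in auto)
  moreover have "symplectic_list (split_form \<omega>) f = symplectic_list \<omega> f"
    by (rule symplectic_list_cong, rule split_UB) (use fU in auto)
  ultimately show sl: "symplectic_list (split_form \<omega>) (e @ f)"
    using e(1) f(1) eU fU by (intro symplectic_list_append) (auto intro: split_UA_UB[THEN conjunct1] split_UA_UB[THEN conjunct2])
  have "bilinear_on U (split_form \<omega>)"
    using symplectic_path[of 0] unfolding path_form_0 symplectic_on_def by simp
  then have "distinct (e @ f) \<and> independent (set (e @ f))"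
    by (rule symplectic_list_independent[OF _ subspace_U _ sl]) (use eU fU UA_U UB_U in auto)
  moreover have "span (set (e @ f)) = U"
    using e(2) f(2) unfolding U_eq basis_list_def set_append span_Un by simp
  ultimately show "basis_list U (e @ f)" by (simp add: basis_list_def)
qed

text \<open>Built with p and q, which gives it the value 1 on e @ f; composed with \<Psi> it becomes
  the wedge product of the extensions by orthogonal projection.\<close>

definition volume_AB :: "'w list \<Rightarrow> complex" where
  "volume_AB = wedge (\<lambda>l. volume UA (map p l)) (\<lambda>l. volume UB (map q l))"

lemma alternating_volume_AB: "alternating U volume_AB"
  unfolding volume_AB_def
  by (rule alternating_wedge[OF alternating_map[OF alternating_volume[OF A] linear_p]
        alternating_map[OF alternating_volume[OF B] linear_q] subspace_U])

lemma volume_AB_append: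
  assumes xs: "set xs \<subseteq> UA" "length xs = 2 * (dim UA div 2)" and ys: "set ys \<subseteq> U"
  shows "volume_AB (xs @ ys) = volume UA xs * volume UB (map q ys)"
proof -
  have "map p xs = xs" using xs(1) p_UA by (intro map_idI) auto
  moreover have "volume_AB (xs @ ys) = volume UA (map p xs) * volume UB (map q ys)"
    unfolding volume_AB_def
  proof (rule wedge_append_factors)
    fix x l l' assume x: "x \<in> set xs" and l: "set l \<subseteq> set (xs @ ys)" "set l' \<subseteq> set (xs @ ys)"
    have "set (xs @ ys) \<subseteq> U" using subset_trans[OF xs(1) UA_U] ys by simp
    then have "set l \<subseteq> U" "set l' \<subseteq> U" using l by (meson subset_trans)+
    then have "set (map q l) \<subseteq> UB" "set (map q l') \<subseteq> UB" using q_in by auto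
    then have "volume UB (map q l @ 0 # map q l') = 0"
      by (rule alternating_zero[OF alternating_volume[OF B] subspace_UB])
    moreover have "q x = 0" using x xs(1) p_UA by auto
    ultimately show "volume UB (map q (l @ x # l')) = 0" by simp
  next
    fix l :: "'w list" assume "l \<noteq> []"
    then show "volume UA (map p (xs @ l)) = 0" by (intro volume_length) (simp add: xs(2))
  qed
  ultimately show ?thesis by simp
qed

text \<open>Block triangularity is used in this form: L maps UA into itself, so on L e @ L f only
  the shuffle handing L e to the first factor counts, and L f is seen only through its
  UB-component.\<close>

lemma det_L:
  assumes e: "symplectic_list \<omega> e" "basis_list UA e" and f: "symplectic_list \<omega> f" "basis_list UB f"
  shows "volume_AB (e @ f) = 1"
    and "det_on scale U L = det_on scale UA (\<lambda>x. x - A x) * det_on scale UB (\<lambda>x. x - B x)"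
proof -
  note eU = basis_list_subset[OF e(2)] and fU = basis_list_subset[OF f(2)]
  note bs = joint_basis(2)[OF e f]
  have fU': "set f \<subseteq> U" using fU UB_U by blast
  have "map q f = f" using fU p_UB by (intro map_idI) auto
  then show 1: "volume_AB (e @ f) = 1"
    using volume_AB_append[OF eU volume_basis(2)[OF e] fU'] volume_basis(1)[OF e] volume_basis(1)[OF f]
    by simp
  have oneA: "linear_on UA UA (\<lambda>x. x - A x)"
    by (rule linear_on_subset[OF linear_on_one_minus[OF A] sub_UA]) (use one_minus_A sub_UA in blast)
  have oneB: "linear_on UB UB (\<lambda>x. x - B x)"
    by (rule linear_on_subset[OF linear_on_one_minus[OF B] sub_UB]) (use one_minus_B sub_UB in blast)
  have Le: "map L e = map (\<lambda>x. x - A x) e" using eU L_UA by auto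
  have Lf: "map q (map L f) = map (\<lambda>x. x - B x) f" using fU q_L_UB by auto
  have LeU: "set (map L e) \<subseteq> UA" unfolding Le using eU oneA by (auto simp: linear_on_def)
  have LfU: "set (map L f) \<subseteq> U" using fU' linear_L by (auto simp: linear_on_def)
  have "det_on scale U L = volume_AB (map L (e @ f))"
    using alternating_det_on[OF alternating_volume_AB linear_L bs basis_list_subset[OF bs] length_basis_list[OF bs]] 1
    by simp
  also have "\<dots> = volume UA (map L e) * volume UB (map q (map L f))"
    unfolding map_append by (rule volume_AB_append[OF LeU _ LfU]) (simp add: volume_basis(2)[OF e])
  also have "volume UA (map L e) = det_on scale UA (\<lambda>x. x - A x)"
    unfolding Le using alternating_det_on[OF alternating_volume[OF A] oneA e(2) eU length_basis_list[OF e(2)]]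
      volume_basis(1)[OF e] by simp
  also have "volume UB (map q (map L f)) = det_on scale UB (\<lambda>x. x - B x)"
    unfolding Lf using alternating_det_on[OF alternating_volume[OF B] oneB f(2) fU length_basis_list[OF f(2)]]
      volume_basis(1)[OF f] by simp
  finally show "det_on scale U L = det_on scale UA (\<lambda>x. x - A x) * det_on scale UB (\<lambda>x. x - B x)" .
qed

text \<open>The sign of the Pfaffian of \<open>\<omega>\<close> is found by deforming \<open>\<omega>\<close> into the orthogonal sum of its
  restrictions: along the way the square of the Pfaffian is a quotient of Gram determinants of
  positive definite Hermitian forms.\<close>
lemma volume_joint_basis:
  assumes e: "symplectic_list \<omega> e" "basis_list UA e" and f: "symplectic_list \<omega> f" "basis_list UB f"
  obtains r where "0 < r" "volume U (e @ f) = complex_of_real r" "det_on scale U \<Psi> = (complex_of_real r)\<^sup>2"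
proof -
  let ?bs = "e @ f"
  note sl = joint_basis(1)[OF e f] and bs = joint_basis(2)[OF e f]
  note bsU = basis_list_subset[OF bs] and dimU = length_basis_list[OF bs]
  define d where "d = dim U div 2"
  have "even (dim U)" using even_length_symplectic_list[OF sl] unfolding dimU .
  then have len: "length ?bs = 2 * d" "dim U = 2 * d" unfolding dimU by (simp_all add: d_def)
  define F where "F t = wedge_power (restricted_two_form (path_form \<omega> t) U) d ?bs / fact d" for t
  define D where "D t = det_on scale U (\<Psi>t t)" for t
  \<comment> \<open>Applied to \<omega> it identifies D t with the square of the Pfaffian; applied
    to H it shows that D t is real and nonzero.\<close>
  have gram: "gram_det (path_form K t) ?bs ?bs = D t * gram_det (split_form K) ?bs ?bs"
    if K: "left_linear_on W K" and spl: "\<And>x y. x \<in> U \<Longrightarrow> y \<in> U \<Longrightarrow> split_form K (\<Psi> x) y = K x y" for K t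
  proof -
    have "gram_det (path_form K t) ?bs ?bs = gram_det (\<lambda>x y. split_form K (\<Psi>t t x) y) ?bs ?bs"
      by (rule gram_det_cong, rule path_\<Psi>t[OF K spl, symmetric]) (use bsU in auto)
    also have "\<dots> = D t * gram_det (split_form K) ?bs ?bs"
      unfolding D_def by (rule gram_det_left_map[OF left_linear_split[OF K] bs linear_\<Psi>t])
    finally show ?thesis .
  qed
  have square: "(F t)\<^sup>2 = D t" if t: "t \<in> {0..1}" for t
  proof -
    have "(F t)\<^sup>2 * gram_det (split_form \<omega>) ?bs ?bs = gram_det (path_form \<omega> t) ?bs ?bs"
      unfolding F_def
      by (rule wedge_power_square[OF symplectic_path[OF t] subspace_U fin _ bsU len(1) len(2) sl len(1)])
        (use sub_U W_span in blast)
    also have "\<dots> = D t * gram_det (split_form \<omega>) ?bs ?bs" by (rule gram[OF \<omega>L split_\<Psi>_\<omega>])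
    finally show ?thesis
      using symplectic_gram_det_nonzero[OF symplectic_path[of 0] bs] by (simp add: path_form_0)
  qed
  have H0: "hermitian_on U (split_form H)" using hermitian_path[of 0] by (simp add: path_form_0)
  have D: "D t \<in> \<real>" "D t \<noteq> 0" if t: "t \<in> {0..1}" for t
  proof -
    note g = gram[OF HL split_\<Psi>_H, of t]
      and gt = hermitian_gram_det[OF hermitian_path[OF t] bs] and g0 = hermitian_gram_det[OF H0 bs]
    show "D t \<noteq> 0" using g gt(1) by auto
    have "cnj (D t) * gram_det (split_form H) ?bs ?bs = D t * gram_det (split_form H) ?bs ?bs"
      using g gt(2) g0(2) by (metis complex_cnj_mult)
    then have "cnj (D t) = D t" using g0(1) by simp
    then show "D t \<in> \<real>" by (simp add: Reals_cnj_iff)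
  qed
  have contF: "continuous_on {0..1} F"
    unfolding F_def path_form_def[abs_def]
    by (intro continuous_on_divide continuous_on_wedge_power continuous_intros) auto
  have F0: "F 0 = 1"
    using wedge_power_symplectic_list[OF sl bsU len(1)] by (simp add: F_def path_form_0)
  \<comment> \<open>Two passes: F^2 = D is a path of nonzero reals from 1, so it is positive and F
    is real; only then does the same argument apply to F.\<close>
  have posF: "0 < Re ((F t)\<^sup>2)" if t: "t \<in> {0..1}" for t
    by (rule positive_along_path[OF _ _ _ t])
      (use contF D square F0 in \<open>auto intro!: continuous_intros\<close>)
  have Freal: "F t \<in> \<real>" "F t \<noteq> 0" if "t \<in> {0..1}" for t
    using real_if_square_positive[of "F t"] posF[OF that] square[OF that] D[OF that] by auto
  have pos: "0 < Re (F 1)"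
    by (rule positive_along_path[OF contF]) (use Freal F0 in auto)
  have F1: "F 1 = complex_of_real (Re (F 1))"
    using Freal(1)[of 1] by (simp add: complex_is_Real_iff complex_eq_iff)
  have "volume U ?bs = F 1" by (simp add: volume_def F_def path_form_1 d_def)
  moreover have "\<Psi>t 1 = \<Psi>" by (simp add: \<Psi>t_def[abs_def])
  ultimately show ?thesis using that[OF pos] F1 square[of 1] by (simp add: D_def)
qed

text \<open>Top forms on U are unique up to scale, so both sides are measured against
  \<open>volume_AB\<close>. On the left, r comes once from the square root of det \<Psi> and once as
  the Pfaffian in \<open>volume U\<close>; on the right, \<Psi> contributes r^2.\<close>

theorem product_formula:
  assumes xs: "set xs \<subseteq> U"
  shows "csqrt (det_on scale U (\<lambda>x. x - A (B x))) * volume U xs =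
    wedge (\<lambda>l. csqrt (det_on scale UA (\<lambda>x. x - A x)) * volume UA (map (proj A) l))
          (\<lambda>l. csqrt (det_on scale UB (\<lambda>x. x - B x)) * volume UB (map (proj B) l)) xs"
proof -
  obtain e where e: "symplectic_list \<omega> e" "basis_list UA e" using moved_basis[OF A] .
  obtain f where f: "symplectic_list \<omega> f" "basis_list UB f" using moved_basis[OF B] .
  note bs = joint_basis(2)[OF e f]
  note bsU = basis_list_subset[OF bs] and dimU = length_basis_list[OF bs]
  obtain r where r: "0 < r" "volume U (e @ f) = complex_of_real r" "det_on scale U \<Psi> = (complex_of_real r)\<^sup>2"
    using volume_joint_basis[OF e f] .
  obtain \<alpha> where \<alpha>: "0 < \<alpha>" "det_on scale UA (\<lambda>x. x - A x) = complex_of_real \<alpha>"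
    using det_one_minus_positive[OF A] .
  obtain \<beta> where \<beta>: "0 < \<beta>" "det_on scale UB (\<lambda>x. x - B x) = complex_of_real \<beta>"
    using det_one_minus_positive[OF B] .
  let ?N = "\<lambda>x. x - A (B x)"
  have N: "linear_on U U ?N"
    by (rule linear_on_subset[OF linear_on_one_minus[OF AB] sub_U]) (use sub_U in \<open>auto simp: moved_def\<close>)
  have \<Psi>bs: "set (map \<Psi> (e @ f)) \<subseteq> U" using linear_\<Psi> image_mono[OF bsU, of \<Psi>] unfolding linear_on_def set_map by blast
  have "det_on scale U ?N = volume_AB (map ?N (e @ f))"
    using alternating_det_on[OF alternating_volume_AB N bs bsU dimU] det_L(1)[OF e f] by simp
  also have "map ?N (e @ f) = map L (map \<Psi> (e @ f))"
    using L_\<Psi> bsU sub_U by (auto simp del: map_append)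
  also have "volume_AB \<dots> = det_on scale U L * volume_AB (map \<Psi> (e @ f))"
    using alternating_det_on[OF alternating_volume_AB linear_L bs \<Psi>bs] dimU by simp
  also have "volume_AB (map \<Psi> (e @ f)) = det_on scale U \<Psi>"
    using alternating_det_on[OF alternating_volume_AB linear_\<Psi> bs bsU dimU] det_L(1)[OF e f] by simp
  finally have "det_on scale U ?N = complex_of_real (\<alpha> * \<beta> * r\<^sup>2)"
    unfolding det_L(2)[OF e f] \<alpha>(2) \<beta>(2) r(3) by simp
  then have sqrtN: "csqrt (det_on scale U ?N) = complex_of_real (sqrt \<alpha> * sqrt \<beta> * r)"
    using \<alpha>(1) \<beta>(1) r(1) by (simp add: csqrt_of_real_nonneg real_sqrt_mult)
  have sqrtAB: "csqrt (det_on scale UA (\<lambda>x. x - A x)) = complex_of_real (sqrt \<alpha>)"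
    "csqrt (det_on scale UB (\<lambda>x. x - B x)) = complex_of_real (sqrt \<beta>)"
    unfolding \<alpha>(2) \<beta>(2) using \<alpha>(1) \<beta>(1) by (simp_all add: csqrt_of_real_nonneg)
  have "wedge (\<lambda>l. volume UA (map (proj A) l)) (\<lambda>l. volume UB (map (proj B) l)) xs =
      volume_AB (map \<Psi> xs)"
    unfolding volume_AB_def wedge_map
  proof (rule wedge_cong)
    fix l assume "set l \<subseteq> set xs"
    then have l: "set l \<subseteq> W" using xs sub_U by blast
    have "map p (map \<Psi> l) = map (proj A) l" using l p_\<Psi> by auto
    then show "volume UA (map (proj A) l) = volume UA (map p (map \<Psi> l))" by (simp only:)
    have "map q (map \<Psi> l) = map (proj B) l" using l q_\<Psi> by auto
    then show "volume UB (map (proj B) l) = volume UB (map q (map \<Psi> l))" by (simp only:)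
  qed
  also have "\<dots> = complex_of_real r * volume U xs"
  \<comment> \<open>Forms are functions on lists of every length, so the identity also has to be
    checked off the top degree, where both sides vanish.\<close>
  proof (cases "length xs = dim U")
    case True
    have "volume_AB (map \<Psi> xs) = (complex_of_real r)\<^sup>2 * volume_AB xs"
      using alternating_det_on[OF alternating_volume_AB linear_\<Psi> bs xs True] r(3) by simp
    moreover obtain C where C: "C \<in> carrier_mat (dim U) (dim U)" "xs = comb C (e @ f)"
      using basis_list_comb[OF bs xs] dimU True by metis
    moreover have "volume_AB xs = Determinant.det C"
      using alternating_det[OF alternating_volume_AB subspace_U bsU C(1) dimU] C(2) det_L(1)[OF e f] by simp
    moreover have "volume U xs = Determinant.det C * complex_of_real r"
      using alternating_det[OF alternating_volume[OF AB] subspace_U bsU C(1) dimU] C(2) r(2) by simp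
    ultimately show ?thesis by (simp add: power2_eq_square)
  next
    case False
    have even: "dim U = 2 * (dim UA div 2) + 2 * (dim UB div 2)"
      using dimU volume_basis(2)[OF e] volume_basis(2)[OF f] by simp
    have "volume U xs = 0" by (rule volume_length) (use False even in presburger)
    moreover have "volume_AB (map \<Psi> xs) = 0"
      unfolding volume_AB_def
      by (rule wedge_length_zero[of "2 * (dim UA div 2)" _ "2 * (dim UB div 2)"])
        (use False even in \<open>auto intro!: volume_length\<close>)
    ultimately show ?thesis by simp
  qed
  finally have "wedge (\<lambda>l. volume UA (map (proj A) l)) (\<lambda>l. volume UB (map (proj B) l)) xs =
      complex_of_real r * volume U xs" .
  then show ?thesis unfolding sqrtN sqrtAB wedge_scale by simp
qed

end

section \<open>Invariant Hermitian forms\<close>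

interpretation fun_space: complex_space fscale
  by unfold_locales (auto simp: fscale_def fun_eq_iff algebra_simps)

lemma sum_fun_apply: "(\<Sum>i\<in>S. f i) x = (\<Sum>i\<in>S. f i x)"
  by (induction S rule: infinite_finite_induct) auto

locale compact_symplectic_action =
  fixes scl :: "complex \<Rightarrow> 'v::ab_group_add \<Rightarrow> 'v" and Basis :: "'v set"
    and \<pi> :: "('v \<Rightarrow> complex) \<Rightarrow> ('v \<Rightarrow> complex) \<Rightarrow> complex" and K :: "('v \<Rightarrow> 'v) set"
  assumes fdvs: "finite_dimensional_vector_space scl Basis"
    and symplectic: "symplectic scl \<pi>" and compact_K: "compact_subgroup_Sp scl \<pi> K"
begin

sublocale V: finite_dimensional_vector_space scl Basis
  by (rule fdvs)

abbreviation W :: "('v \<Rightarrow> complex) set" where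
  "W \<equiv> dual scl"

lemma dual_iff: "\<phi> \<in> W \<longleftrightarrow> (\<forall>x y. \<phi> (x + y) = \<phi> x + \<phi> y) \<and> (\<forall>c x. \<phi> (scl c x) = c * \<phi> x)"
proof -
  have "vector_space ((*) :: complex \<Rightarrow> complex \<Rightarrow> complex)" by unfold_locales (auto simp: algebra_simps)
  then show ?thesis using V.vector_space_axioms by (simp add: dual_def Vector_Spaces.linear_iff)
qed

lemma dual_add: "\<phi> \<in> W \<Longrightarrow> \<phi> (x + y) = \<phi> x + \<phi> y"
  and dual_scale: "\<phi> \<in> W \<Longrightarrow> \<phi> (scl c x) = c * \<phi> x"
  using dual_iff by blast+

lemma dual_zero: "\<phi> \<in> W \<Longrightarrow> \<phi> 0 = 0"
  using dual_scale[of \<phi> 0 0] by simp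

lemma dual_diff: "\<phi> \<in> W \<Longrightarrow> \<phi> (x - y) = \<phi> x - \<phi> y"
  using dual_add[of \<phi> "x - y" y] by simp

lemma dual_sum: "\<phi> \<in> W \<Longrightarrow> \<phi> (\<Sum>i\<in>S. f i) = (\<Sum>i\<in>S. \<phi> (f i))"
  by (induction S rule: infinite_finite_induct) (auto simp: dual_zero dual_add)

lemma subspace_dual: "fun_space.subspace W"
proof (rule fun_space.subspaceI)
  show "0 \<in> W" by (simp add: dual_iff)
  show "\<phi> + \<psi> \<in> W" if "\<phi> \<in> W" "\<psi> \<in> W" for \<phi> \<psi>
    unfolding dual_iff[of "\<phi> + \<psi>"] using that by (simp add: dual_add dual_scale algebra_simps)
  show "fscale c \<phi> \<in> W" if "\<phi> \<in> W" for c \<phi>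
    unfolding dual_iff[of "fscale c \<phi>"] using that
    by (simp add: fscale_def dual_add dual_scale algebra_simps)
qed

definition coord :: "'v \<Rightarrow> 'v \<Rightarrow> complex" where
  "coord b v = V.representation Basis v b"

lemma coord_dual: "coord b \<in> W"
  unfolding dual_iff coord_def
  using V.representation_add[OF V.independent_Basis] V.representation_scale[OF V.independent_Basis]
  by (simp add: V.span_Basis)

lemma coord_expand: "v = (\<Sum>b\<in>Basis. scl (coord b v) b)"
  unfolding coord_def
  using V.sum_representation_eq[OF V.independent_Basis _ V.finite_Basis subset_refl, of v]
  by (simp add: V.span_Basis)

lemma dual_apply_expand: "\<phi> \<in> W \<Longrightarrow> \<phi> v = (\<Sum>b\<in>Basis. coord b v * \<phi> b)"
  by (subst coord_expand[of v]) (simp add: dual_sum dual_scale)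

lemma dual_expand:
  assumes "\<phi> \<in> W"
  shows "\<phi> = (\<Sum>b\<in>Basis. fscale (\<phi> b) (coord b))"
proof
  fix v
  show "\<phi> v = (\<Sum>b\<in>Basis. fscale (\<phi> b) (coord b)) v"
    unfolding sum_fun_apply fscale_def using dual_apply_expand[OF assms, of v] by (simp add: mult.commute)
qed

lemma dual_subset_span: "W \<subseteq> fun_space.span (coord ` Basis)"
proof
  fix \<phi> assume "\<phi> \<in> W"
  then have "\<phi> = (\<Sum>b\<in>Basis. fscale (\<phi> b) (coord b))" by (rule dual_expand)
  also have "\<dots> \<in> fun_space.span (coord ` Basis)"
    by (intro fun_space.span_sum fun_space.span_scale fun_space.span_base) auto
  finally show "\<phi> \<in> fun_space.span (coord ` Basis)" .
qed

lemma dual_eq_zero: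
  assumes "\<phi> \<in> W" "\<And>b. b \<in> Basis \<Longrightarrow> \<phi> b = 0"
  shows "\<phi> = 0"
proof
  show "\<phi> v = 0 v" for v using dual_apply_expand[OF assms(1), of v] assms(2) by simp
qed

section \<open>The compact group and its action on the dual\<close>

lemma K_subgroup: "subgroup K (Sp scl \<pi>)" and compact_image: "compact (matrix_coeffs scl ` K)"
  using compact_K by (auto simp: compact_subgroup_Sp_def)

lemma K_carrier: "k \<in> K \<Longrightarrow> k \<in> carrier (Sp scl \<pi>)"
  using subgroup.subset[OF K_subgroup] by blast

lemma K_add: "k \<in> K \<Longrightarrow> k (x + y) = k x + k y"
  and K_scale: "k \<in> K \<Longrightarrow> k (scl c x) = scl c (k x)"
  and K_bij: "k \<in> K \<Longrightarrow> bij k"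
  and K_pi: "k \<in> K \<Longrightarrow> \<phi> \<in> W \<Longrightarrow> \<psi> \<in> W \<Longrightarrow> \<pi> (\<phi> \<circ> k) (\<psi> \<circ> k) = \<pi> \<phi> \<psi>"
  using K_carrier[of k] by (auto simp: Sp_def Vector_Spaces.linear_iff)

lemma K_comp: "k \<in> K \<Longrightarrow> k' \<in> K \<Longrightarrow> k \<circ> k' \<in> K"
  using subgroup.m_closed[OF K_subgroup, of k k'] by (simp add: Sp_def)

lemma K_id: "id \<in> K"
  using subgroup.one_closed[OF K_subgroup] by (simp add: Sp_def)

lemma pullback_dual: "k \<in> K \<Longrightarrow> \<phi> \<in> W \<Longrightarrow> \<phi> \<circ> k \<in> W"
  unfolding dual_iff by (simp add: K_add K_scale)

abbreviation inverse_map :: "('v \<Rightarrow> 'v) \<Rightarrow> 'v \<Rightarrow> 'v" where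
  "inverse_map k \<equiv> inv_into UNIV k"

lemma inverse_map: "k \<in> K \<Longrightarrow> k (inverse_map k x) = x" "k \<in> K \<Longrightarrow> inverse_map k (k x) = x"
  using K_bij[of k] by (simp_all add: bij_is_surj surj_f_inv_f bij_is_inj)

lemma inverse_map_comp: "k \<in> K \<Longrightarrow> k \<circ> inverse_map k = id" "k \<in> K \<Longrightarrow> inverse_map k \<circ> k = id"
  by (auto simp: fun_eq_iff inverse_map)

text \<open>The inverse in the structure \<open>Sp\<close> is a definite description; it is
  identified with the inverse function before closure of K under inverses can be used.\<close>

lemma K_inverse:
  assumes k: "k \<in> K"
  shows "inverse_map k \<in> K"
proof -
  let ?k = "inverse_map k" and ?G = "Sp scl \<pi>"
  have add: "?k (x + y) = ?k x + ?k y" for x y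
    using inverse_map[OF k] K_add[OF k] by metis
  have scale: "?k (scl c x) = scl c (?k x)" for c x
    using inverse_map[OF k] K_scale[OF k] by metis
  have pull: "\<phi> \<circ> ?k \<in> W" if "\<phi> \<in> W" for \<phi>
    using that unfolding dual_iff by (simp add: add scale)
  have "\<pi> (\<phi> \<circ> ?k) (\<psi> \<circ> ?k) = \<pi> \<phi> \<psi>" if "\<phi> \<in> W" "\<psi> \<in> W" for \<phi> \<psi>
    using K_pi[OF k pull[OF that(1)] pull[OF that(2)]] by (simp add: comp_assoc inverse_map_comp[OF k])
  then have car: "?k \<in> carrier ?G"
    using add scale K_bij[OF k] V.vector_space_axioms
    by (simp add: Sp_def Vector_Spaces.linear_iff bij_imp_bij_inv)
  have "inv\<^bsub>?G\<^esub> k = ?k"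
    unfolding m_inv_def
  proof (rule the_equality)
    show "?k \<in> carrier ?G \<and> k \<otimes>\<^bsub>?G\<^esub> ?k = \<one>\<^bsub>?G\<^esub> \<and> ?k \<otimes>\<^bsub>?G\<^esub> k = \<one>\<^bsub>?G\<^esub>"
      using car inverse_map_comp[OF k] by (simp add: Sp_def)
    fix y assume "y \<in> carrier ?G \<and> k \<otimes>\<^bsub>?G\<^esub> y = \<one>\<^bsub>?G\<^esub> \<and> y \<otimes>\<^bsub>?G\<^esub> k = \<one>\<^bsub>?G\<^esub>"
    then have "k \<circ> y = id" by (simp add: Sp_def)
    then have "k (y x) = x" for x by (simp add: fun_eq_iff)
    then show "y = ?k" by (metis ext inverse_map(2)[OF k])
  qed
  then show ?thesis using subgroup.m_inv_closed[OF K_subgroup k] by simp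
qed

lemma matrix_coeffs_apply: "\<phi> \<in> W \<Longrightarrow> matrix_coeffs scl k (\<phi>, v) = \<phi> (k v)"
  by (simp add: matrix_coeffs_def)

text \<open>Compactness is given for the set of matrix coefficients, so a function on K attains its
  bounds once it is written as a continuous function of these coefficients.\<close>

lemma compact_attains:
  fixes f :: "(('v \<Rightarrow> complex) \<times> 'v \<Rightarrow> complex) \<Rightarrow> real"
  assumes "continuous_on UNIV f" "\<And>k. k \<in> K \<Longrightarrow> F k = f (matrix_coeffs scl k)"
  shows "\<exists>k\<in>K. \<forall>k'\<in>K. F k \<le> F k'" "\<exists>k\<in>K. \<forall>k'\<in>K. F k' \<le> F k"
proof -
  have ne: "matrix_coeffs scl ` K \<noteq> {}" using K_id by blast
  have cont: "continuous_on (matrix_coeffs scl ` K) f" by (rule continuous_on_subset[OF assms(1)]) simp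
  show "\<exists>k\<in>K. \<forall>k'\<in>K. F k \<le> F k'"
    using continuous_attains_inf[OF compact_image ne cont] assms(2) by auto
  show "\<exists>k\<in>K. \<forall>k'\<in>K. F k' \<le> F k"
    using continuous_attains_sup[OF compact_image ne cont] assms(2) by auto
qed

section \<open>Hermitian forms as points of a product space\<close>

lemma continuous_coordinate [continuous_intros]:
  "continuous_on S (\<lambda>X :: 'a \<Rightarrow> complex. X z)"
  by (rule continuous_on_subset[OF continuous_on_product_coordinates]) simp

text \<open>A form is a function on pairs, so that the product topology and Tychonoff's theorem are
  available.\<close>

definition sesq :: "(('v \<Rightarrow> complex) \<times> ('v \<Rightarrow> complex) \<Rightarrow> complex) \<Rightarrow> bool" where
  "sesq X \<longleftrightarrow> fun_space.left_linear_on W (\<lambda>\<phi> \<psi>. X (\<phi>, \<psi>)) \<and>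
     (\<forall>\<phi>\<in>W. \<forall>\<psi>\<in>W. X (\<psi>, \<phi>) = cnj (X (\<phi>, \<psi>)))"

lemma sesq_left: "sesq X \<Longrightarrow> fun_space.left_linear_on W (\<lambda>\<phi> \<psi>. X (\<phi>, \<psi>))"
  and sesq_cnj: "sesq X \<Longrightarrow> \<phi> \<in> W \<Longrightarrow> \<psi> \<in> W \<Longrightarrow> X (\<psi>, \<phi>) = cnj (X (\<phi>, \<psi>))"
  unfolding sesq_def by (blast, blast)

lemma sesq_sum:
  assumes X: "sesq X" and f: "\<And>b. b \<in> Basis \<Longrightarrow> f b \<in> W" and g: "\<And>b. b \<in> Basis \<Longrightarrow> g b \<in> W"
  shows "X (\<Sum>b\<in>Basis. fscale (c b) (f b), \<Sum>b\<in>Basis. fscale (d b) (g b)) =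
    (\<Sum>a\<in>Basis. \<Sum>b\<in>Basis. c a * cnj (d b) * X (f a, g b))"
proof -
  let ?F = "\<Sum>b\<in>Basis. fscale (c b) (f b)" and ?G = "\<Sum>b\<in>Basis. fscale (d b) (g b)"
  have G: "?G \<in> W"
    using g by (intro fun_space.subspace_sum[OF subspace_dual] fun_space.subspace_scale[OF subspace_dual])
  have "X (?F, ?G) = (\<Sum>a\<in>Basis. c a * X (f a, ?G))"
    by (rule fun_space.left_linear_sum[OF sesq_left[OF X] subspace_dual G V.finite_Basis f])
  also have "\<dots> = (\<Sum>a\<in>Basis. \<Sum>b\<in>Basis. c a * cnj (d b) * X (f a, g b))"
  proof (rule sum.cong[OF refl])
    fix a assume a: "a \<in> Basis"
    have "X (?G, f a) = (\<Sum>b\<in>Basis. d b * X (g b, f a))"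
      by (rule fun_space.left_linear_sum[OF sesq_left[OF X] subspace_dual f[OF a] V.finite_Basis g])
    then have "X (f a, ?G) = (\<Sum>b\<in>Basis. cnj (d b) * cnj (X (g b, f a)))"
      using sesq_cnj[OF X G f[OF a]] by simp
    also have "\<dots> = (\<Sum>b\<in>Basis. cnj (d b) * X (f a, g b))"
      by (rule sum.cong[OF refl]) (simp add: sesq_cnj[OF X g f[OF a], symmetric])
    finally show "c a * X (f a, ?G) = (\<Sum>b\<in>Basis. c a * cnj (d b) * X (f a, g b))"
      by (simp add: sum_distrib_left mult.assoc)
  qed
  finally show ?thesis .
qed

text \<open>The value of X at a pair pulled back by k, as a polynomial in the matrix coefficients of
  k and their conjugates; this is the source of continuity in k.\<close>

definition orbit_value ::
  "(('v \<Rightarrow> complex) \<times> ('v \<Rightarrow> complex) \<Rightarrow> complex) \<Rightarrow> ('v \<Rightarrow> complex) \<Rightarrow> ('v \<Rightarrow> complex) \<Rightarrow>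
   (('v \<Rightarrow> complex) \<times> 'v \<Rightarrow> complex) \<Rightarrow> complex" where
  "orbit_value X \<phi> \<psi> y =
     (\<Sum>a\<in>Basis. \<Sum>b\<in>Basis. y (\<phi>, a) * cnj (y (\<psi>, b)) * X (coord a, coord b))"

lemma orbit_value:
  assumes X: "sesq X" and k: "k \<in> K" and \<phi>: "\<phi> \<in> W" and \<psi>: "\<psi> \<in> W"
  shows "X (\<phi> \<circ> k, \<psi> \<circ> k) = orbit_value X \<phi> \<psi> (matrix_coeffs scl k)"
proof -
  have "\<phi> \<circ> k = (\<Sum>b\<in>Basis. fscale (\<phi> (k b)) (coord b))" "\<psi> \<circ> k = (\<Sum>b\<in>Basis. fscale (\<psi> (k b)) (coord b))"
    using dual_expand[OF pullback_dual[OF k \<phi>]] dual_expand[OF pullback_dual[OF k \<psi>]] by simp_all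
  then show ?thesis
    using sesq_sum[OF X coord_dual coord_dual] \<phi> \<psi> by (simp add: orbit_value_def matrix_coeffs_apply)
qed

lemma continuous_orbit_value: "continuous_on S (orbit_value X \<phi> \<psi>)"
  unfolding orbit_value_def by (intro continuous_intros)

definition base_form :: "('v \<Rightarrow> complex) \<times> ('v \<Rightarrow> complex) \<Rightarrow> complex" where
  "base_form = (\<lambda>(\<phi>, \<psi>). if \<phi> \<in> W \<and> \<psi> \<in> W then \<Sum>b\<in>Basis. \<phi> b * cnj (\<psi> b) else 0)"

lemma sesq_base_form: "sesq base_form"
proof -
  have "fscale a \<phi> + \<psi> \<in> W" if "\<phi> \<in> W" "\<psi> \<in> W" for a \<phi> \<psi>
    using that fun_space.subspace_add[OF subspace_dual] fun_space.subspace_scale[OF subspace_dual] by blast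
  then show ?thesis
    unfolding sesq_def fun_space.left_linear_on_def
    by (auto simp: base_form_def fscale_def sum_distrib_left sum.distrib algebra_simps)
qed

lemma base_form_diag: "\<phi> \<in> W \<Longrightarrow> base_form (\<phi>, \<phi>) = complex_of_real (\<Sum>b\<in>Basis. (cmod (\<phi> b))\<^sup>2)"
  by (simp add: base_form_def complex_norm_square del: of_real_power)

definition orbit_bounds :: "('v \<Rightarrow> complex) \<Rightarrow> real \<Rightarrow> real \<Rightarrow> bool" where
  "orbit_bounds \<phi> l u \<longleftrightarrow> (\<forall>k\<in>K. l \<le> Re (base_form (\<phi> \<circ> k, \<phi> \<circ> k)) \<and> Re (base_form (\<phi> \<circ> k, \<phi> \<circ> k)) \<le> u)"

lemma orbit_bounds_exist:
  assumes \<phi>: "\<phi> \<in> W"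
  shows "\<exists>u. orbit_bounds \<phi> 0 u" "\<phi> \<noteq> 0 \<Longrightarrow> \<exists>l>0. \<exists>u. orbit_bounds \<phi> l u"
proof -
  let ?F = "\<lambda>k. Re (base_form (\<phi> \<circ> k, \<phi> \<circ> k))"
  have pos: "0 \<le> ?F k" if "k \<in> K" for k
    using base_form_diag[OF pullback_dual[OF that \<phi>]] by (simp add: sum_nonneg)
  have cont: "continuous_on UNIV (\<lambda>y. Re (orbit_value base_form \<phi> \<phi> y))"
    by (intro continuous_intros continuous_orbit_value)
  have eq: "?F k = Re (orbit_value base_form \<phi> \<phi> (matrix_coeffs scl k))" if "k \<in> K" for k
    using orbit_value[OF sesq_base_form that \<phi> \<phi>] by simp
  obtain k1 where k1: "k1 \<in> K" "\<forall>k\<in>K. ?F k1 \<le> ?F k"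
    using compact_attains(1)[OF cont, of ?F] eq by blast
  obtain k2 where k2: "k2 \<in> K" "\<forall>k\<in>K. ?F k \<le> ?F k2"
    using compact_attains(2)[OF cont, of ?F] eq by blast
  show "\<exists>u. orbit_bounds \<phi> 0 u" using pos k2 unfolding orbit_bounds_def by blast
  assume "\<phi> \<noteq> 0"
  have "\<phi> \<circ> k1 \<noteq> 0"
  proof
    assume "\<phi> \<circ> k1 = 0"
    then have "\<phi> (k1 (inverse_map k1 x)) = 0" for x by (simp add: fun_eq_iff)
    then show False using \<open>\<phi> \<noteq> 0\<close> inverse_map(1)[OF k1(1)] by (auto simp: fun_eq_iff)
  qed
  then obtain b where b: "b \<in> Basis" "(\<phi> \<circ> k1) b \<noteq> 0"
    using dual_eq_zero[OF pullback_dual[OF k1(1) \<phi>]] by blast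
  have "0 < (\<Sum>b\<in>Basis. (cmod ((\<phi> \<circ> k1) b))\<^sup>2)"
    by (rule sum_pos2[OF V.finite_Basis b(1)]) (use b(2) in auto)
  then have "0 < ?F k1" using base_form_diag[OF pullback_dual[OF k1(1) \<phi>]] by simp
  then show "\<exists>l>0. \<exists>u. orbit_bounds \<phi> l u" using k1 k2 unfolding orbit_bounds_def by blast
qed

lemma orbit_bounds_pullback:
  assumes k: "k \<in> K" and b: "orbit_bounds (\<phi> \<circ> k) l u"
  shows "orbit_bounds \<phi> l u"
  unfolding orbit_bounds_def
proof
  fix k' assume k': "k' \<in> K"
  let ?k = "inverse_map k \<circ> k'"
  have "?k \<in> K" by (rule K_comp[OF K_inverse[OF k] k'])
  moreover have "(\<phi> \<circ> k) \<circ> ?k = \<phi> \<circ> k'" by (auto simp: fun_eq_iff inverse_map[OF k])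
  ultimately show "l \<le> Re (base_form (\<phi> \<circ> k', \<phi> \<circ> k')) \<and> Re (base_form (\<phi> \<circ> k', \<phi> \<circ> k')) \<le> u"
    using b unfolding orbit_bounds_def by metis
qed

text \<open>Stands in for the closed convex hull of the orbit of \<open>base_form\<close>: convex,
  stable under K and compact, but cut out by explicit inequalities. Upper bounds yield compactness,
  lower bounds keep every member positive definite, and the value 0 off W x W tames the remaining
  coordinates.\<close>

definition forms :: "(('v \<Rightarrow> complex) \<times> ('v \<Rightarrow> complex) \<Rightarrow> complex) set" where
  "forms = {X. sesq X \<and> (\<forall>z. z \<notin> W \<times> W \<longrightarrow> X z = 0) \<and>
     (\<forall>\<phi>\<in>W. \<forall>l u. orbit_bounds \<phi> l u \<longrightarrow> l \<le> Re (X (\<phi>, \<phi>)) \<and> Re (X (\<phi>, \<phi>)) \<le> u)}"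

lemma formsD:
  assumes "X \<in> forms"
  shows "sesq X" "z \<notin> W \<times> W \<Longrightarrow> X z = 0"
    "\<phi> \<in> W \<Longrightarrow> orbit_bounds \<phi> l u \<Longrightarrow> l \<le> Re (X (\<phi>, \<phi>))"
    "\<phi> \<in> W \<Longrightarrow> orbit_bounds \<phi> l u \<Longrightarrow> Re (X (\<phi>, \<phi>)) \<le> u"
  using assms unfolding forms_def by blast+

lemma base_form_forms: "base_form \<in> forms"
proof -
  have "l \<le> Re (base_form (\<phi>, \<phi>)) \<and> Re (base_form (\<phi>, \<phi>)) \<le> u" if "orbit_bounds \<phi> l u" for \<phi> l u
    using that K_id unfolding orbit_bounds_def by (metis comp_id)
  moreover have "base_form z = 0" if "z \<notin> W \<times> W" for z
    using that by (cases z) (auto simp: base_form_def)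
  ultimately show ?thesis using sesq_base_form unfolding forms_def by blast
qed

text \<open>Polarisation: the diagonal bounds at \<phi>, \<psi> and \<phi> + \<psi> control the real
  part off the diagonal, and replacing \<phi> by its multiple with -i turns the imaginary part into
  a real part.\<close>

lemma forms_bounded: "\<exists>r. \<forall>X\<in>forms. cmod (X z) \<le> r"
proof (cases "z \<in> W \<times> W")
  case True
  then obtain \<phi> \<psi> where z: "z = (\<phi>, \<psi>)" "\<phi> \<in> W" "\<psi> \<in> W" by blast
  have bound: "\<exists>r. \<forall>X\<in>forms. \<bar>Re (X (\<phi>, \<psi>))\<bar> \<le> r" if \<phi>: "\<phi> \<in> W" and \<psi>: "\<psi> \<in> W" for \<phi> \<psi>
  proof -
    have s: "\<phi> + \<psi> \<in> W" using fun_space.subspace_add[OF subspace_dual \<phi> \<psi>] .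
    obtain u1 u2 u3 where u: "orbit_bounds (\<phi> + \<psi>) 0 u1" "orbit_bounds \<phi> 0 u2" "orbit_bounds \<psi> 0 u3"
      using orbit_bounds_exist(1)[OF s] orbit_bounds_exist(1)[OF \<phi>] orbit_bounds_exist(1)[OF \<psi>] by auto
    have "\<bar>Re (X (\<phi>, \<psi>))\<bar> \<le> u1 + u2 + u3" if X: "X \<in> forms" for X
    proof -
      note D = formsD[OF X] and L = sesq_left[OF formsD(1)[OF X]]
      have "X (\<phi> + \<psi>, \<phi> + \<psi>) = X (\<phi>, \<phi> + \<psi>) + X (\<psi>, \<phi> + \<psi>)"
        by (rule fun_space.left_linear_add[OF L \<phi> \<psi> s])
      moreover have "X (\<phi> + \<psi>, \<phi>) = X (\<phi>, \<phi>) + X (\<psi>, \<phi>)" "X (\<phi> + \<psi>, \<psi>) = X (\<phi>, \<psi>) + X (\<psi>, \<psi>)"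
        by (rule fun_space.left_linear_add[OF L \<phi> \<psi> \<phi>], rule fun_space.left_linear_add[OF L \<phi> \<psi> \<psi>])
      moreover have "X (\<phi>, \<phi> + \<psi>) = cnj (X (\<phi> + \<psi>, \<phi>))" "X (\<psi>, \<phi> + \<psi>) = cnj (X (\<phi> + \<psi>, \<psi>))"
        "X (\<psi>, \<phi>) = cnj (X (\<phi>, \<psi>))"
        using sesq_cnj[OF D(1) s \<phi>] sesq_cnj[OF D(1) s \<psi>] sesq_cnj[OF D(1) \<phi> \<psi>] .
      ultimately have "Re (X (\<phi> + \<psi>, \<phi> + \<psi>)) = Re (X (\<phi>, \<phi>)) + Re (X (\<psi>, \<psi>)) + 2 * Re (X (\<phi>, \<psi>))"
        by simp
      then show ?thesis
        using D(3)[OF s u(1)] D(4)[OF s u(1)] D(3)[OF \<phi> u(2)] D(4)[OF \<phi> u(2)] D(3)[OF \<psi> u(3)] D(4)[OF \<psi> u(3)]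
        by linarith
    qed
    then show ?thesis by blast
  qed
  let ?\<phi> = "fscale (- \<i>) \<phi>"
  have i\<phi>: "?\<phi> \<in> W" by (rule fun_space.subspace_scale[OF subspace_dual z(2)])
  obtain r1 r2 where r: "\<And>X. X \<in> forms \<Longrightarrow> \<bar>Re (X (\<phi>, \<psi>))\<bar> \<le> r1" "\<And>X. X \<in> forms \<Longrightarrow> \<bar>Re (X (?\<phi>, \<psi>))\<bar> \<le> r2"
    using bound[OF z(2,3)] bound[OF i\<phi> z(3)] by blast
  have "cmod (X z) \<le> r1 + r2" if X: "X \<in> forms" for X
  proof -
    have "X (?\<phi>, \<psi>) = - \<i> * X (\<phi>, \<psi>)"
      by (rule fun_space.left_linear_scale[OF sesq_left[OF formsD(1)[OF X]] subspace_dual z(2,3)])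
    then have "Im (X (\<phi>, \<psi>)) = Re (X (?\<phi>, \<psi>))" by simp
    then show ?thesis using cmod_le[of "X z"] r(1)[OF X] r(2)[OF X] z(1) by simp
  qed
  then show ?thesis by blast
next
  case False
  then have "cmod (X z) \<le> 0" if "X \<in> forms" for X using formsD(2)[OF that] by simp
  then show ?thesis by blast
qed

lemma closed_forms: "closed forms"
proof -
  let ?L = "\<Inter>\<phi>\<in>W. \<Inter>\<eta>\<in>W. \<Inter>\<psi>\<in>W. \<Inter>a. {X. X (fscale a \<phi> + \<eta>, \<psi>) = a * X (\<phi>, \<psi>) + X (\<eta>, \<psi>)}"
  let ?C = "\<Inter>\<phi>\<in>W. \<Inter>\<psi>\<in>W. {X. X (\<psi>, \<phi>) = cnj (X (\<phi>, \<psi>))}"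
  let ?Z = "\<Inter>z\<in>- (W \<times> W). {X. X z = (0::complex)}"
  let ?B = "\<Inter>\<phi>\<in>W. \<Inter>(l, u)\<in>{(l, u). orbit_bounds \<phi> l u}.
      {X. l \<le> Re (X (\<phi>, \<phi>))} \<inter> {X. Re (X (\<phi>, \<phi>)) \<le> u}"
  have "closed ?L" by (intro closed_INT ballI closed_Collect_eq continuous_intros)
  moreover have "closed ?C" by (intro closed_INT ballI closed_Collect_eq continuous_intros)
  moreover have "closed ?Z" by (intro closed_INT ballI closed_Collect_eq continuous_intros)
  moreover have "closed ?B"
    by (intro closed_INT ballI) (auto intro!: closed_Int closed_Collect_le continuous_intros)
  moreover have "forms = ?L \<inter> ?C \<inter> ?Z \<inter> ?B"
    unfolding forms_def sesq_def fun_space.left_linear_on_def by blast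
  ultimately show ?thesis by (simp only: closed_Int)
qed

lemma compact_forms: "compact forms"
proof -
  obtain r where r: "\<And>z X. X \<in> forms \<Longrightarrow> cmod (X z) \<le> r z" using forms_bounded by metis
  let ?B = "Pi\<^sub>E UNIV (\<lambda>z. cball (0::complex) (r z))"
  have "compact ?B"
    using compactin_PiE[of "\<lambda>_. euclidean" UNIV "\<lambda>z. cball (0::complex) (r z)"]
    by (simp add: euclidean_product_topology)
  moreover have "forms \<subseteq> ?B" using r by (auto simp: PiE_iff)
  ultimately have "compact (forms \<inter> ?B)" by (intro closed_Int_compact closed_forms)
  then show ?thesis using \<open>forms \<subseteq> ?B\<close> by (simp add: inf.absorb1)
qed

text \<open>The squared Hilbert-Schmidt norm, in the dual basis, of the translate of X by k.\<close>

definition orbit_norm :: "(('v \<Rightarrow> complex) \<times> ('v \<Rightarrow> complex) \<Rightarrow> complex) \<Rightarrow> ('v \<Rightarrow> 'v) \<Rightarrow> real" where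
  "orbit_norm X k = (\<Sum>a\<in>Basis. \<Sum>b\<in>Basis. (cmod (X (coord a \<circ> k, coord b \<circ> k)))\<^sup>2)"

lemma orbit_norm_attains:
  assumes X: "sesq X"
  shows "\<exists>k\<in>K. \<forall>k'\<in>K. orbit_norm X k \<le> orbit_norm X k'"
    "\<exists>k\<in>K. \<forall>k'\<in>K. orbit_norm X k' \<le> orbit_norm X k"
proof -
  let ?f = "\<lambda>y. \<Sum>a\<in>Basis. \<Sum>b\<in>Basis. (cmod (orbit_value X (coord a) (coord b) y))\<^sup>2"
  have cont: "continuous_on UNIV ?f" by (intro continuous_intros continuous_orbit_value)
  have eq: "orbit_norm X k = ?f (matrix_coeffs scl k)" if "k \<in> K" for k
    unfolding orbit_norm_def by (simp add: orbit_value[OF X that coord_dual coord_dual])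
  show "\<exists>k\<in>K. \<forall>k'\<in>K. orbit_norm X k \<le> orbit_norm X k'" by (rule compact_attains(1)[OF cont eq])
  show "\<exists>k\<in>K. \<forall>k'\<in>K. orbit_norm X k' \<le> orbit_norm X k" by (rule compact_attains(2)[OF cont eq])
qed

lemma orbit_norm_nonneg: "0 \<le> orbit_norm X k"
  unfolding orbit_norm_def by (intro sum_nonneg) auto

text \<open>The parallelogram law, which supplies the strict convexity.\<close>

lemma orbit_norm_midpoint:
  "orbit_norm (\<lambda>z. (X z + Y z) / 2) k =
     orbit_norm X k / 2 + orbit_norm Y k / 2 - orbit_norm (\<lambda>z. X z - Y z) k / 4"
proof -
  have "(cmod ((x + y) / 2))\<^sup>2 = (cmod x)\<^sup>2 / 2 + (cmod y)\<^sup>2 / 2 - (cmod (x - y))\<^sup>2 / 4" for x y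
    by (simp add: cmod_power2 norm_divide power_divide) (simp add: power2_eq_square field_simps)
  then show ?thesis
    unfolding orbit_norm_def by (simp add: sum.distrib sum_subtractf sum_divide_distrib)
qed

text \<open>The coordinate functionals pulled back by the bijection k again span the dual, so a form
  vanishing on them vanishes.\<close>

lemma orbit_norm_zero:
  assumes X: "sesq X" and k: "k \<in> K" and 0: "orbit_norm X k = 0" and \<phi>: "\<phi> \<in> W" and \<psi>: "\<psi> \<in> W"
  shows "X (\<phi>, \<psi>) = 0"
proof -
  have "X (coord a \<circ> k, coord b \<circ> k) = 0" if "a \<in> Basis" "b \<in> Basis" for a b
    using 0 that V.finite_Basis unfolding orbit_norm_def
    by (simp add: sum_nonneg_eq_0_iff sum_nonneg)
  moreover have "\<eta> = (\<Sum>b\<in>Basis. fscale (\<eta> (inverse_map k b)) (coord b \<circ> k))" if \<eta>: "\<eta> \<in> W" for \<eta>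
  proof
    fix v
    have "\<eta> v = (\<eta> \<circ> inverse_map k) (k v)" by (simp add: inverse_map[OF k])
    also have "\<dots> = (\<Sum>b\<in>Basis. coord b (k v) * (\<eta> \<circ> inverse_map k) b)"
      by (rule dual_apply_expand[OF pullback_dual[OF K_inverse[OF k] \<eta>]])
    finally show "\<eta> v = (\<Sum>b\<in>Basis. fscale (\<eta> (inverse_map k b)) (coord b \<circ> k)) v"
      by (simp add: sum_fun_apply fscale_def mult.commute)
  qed
  ultimately have zero: "\<And>a b. a \<in> Basis \<Longrightarrow> b \<in> Basis \<Longrightarrow> X (coord a \<circ> k, coord b \<circ> k) = 0"
    and eta: "\<And>\<eta>. \<eta> \<in> W \<Longrightarrow> \<eta> = (\<Sum>b\<in>Basis. fscale (\<eta> (inverse_map k b)) (coord b \<circ> k))"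
    by blast+
  have "X (\<phi>, \<psi>) = X (\<Sum>b\<in>Basis. fscale (\<phi> (inverse_map k b)) (coord b \<circ> k),
      \<Sum>b\<in>Basis. fscale (\<psi> (inverse_map k b)) (coord b \<circ> k))"
    by (rule arg_cong[of _ _ X]) (simp only: prod.inject, intro conjI eta \<phi> \<psi>)
  also have "\<dots> = (\<Sum>a\<in>Basis. \<Sum>b\<in>Basis. \<phi> (inverse_map k a) * cnj (\<psi> (inverse_map k b)) *
      X (coord a \<circ> k, coord b \<circ> k))"
    by (rule sesq_sum[OF X]) (rule pullback_dual[OF k coord_dual])+
  also have "\<dots> = 0" by (simp add: zero)
  finally show ?thesis .
qed

lemma sesq_diff:
  assumes X: "sesq X" and Y: "sesq Y"
  shows "sesq (\<lambda>z. X z - Y z)"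
  unfolding sesq_def
proof (intro conjI ballI)
  show "fun_space.left_linear_on W (\<lambda>\<phi> \<psi>. X (\<phi>, \<psi>) - Y (\<phi>, \<psi>))"
    using sesq_left[OF X] sesq_left[OF Y] unfolding fun_space.left_linear_on_def
    by (simp add: algebra_simps)
  show "X (\<psi>, \<phi>) - Y (\<psi>, \<phi>) = cnj (X (\<phi>, \<psi>) - Y (\<phi>, \<psi>))" if "\<phi> \<in> W" "\<psi> \<in> W" for \<phi> \<psi>
    unfolding sesq_cnj[OF X that] sesq_cnj[OF Y that] by simp
qed

lemma forms_midpoint:
  assumes X: "X \<in> forms" and Y: "Y \<in> forms"
  shows "(\<lambda>z. (X z + Y z) / 2) \<in> forms"
proof -
  have "fun_space.left_linear_on W (\<lambda>\<phi> \<psi>. (X (\<phi>, \<psi>) + Y (\<phi>, \<psi>)) / 2)"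
    using sesq_left[OF formsD(1)[OF X]] sesq_left[OF formsD(1)[OF Y]]
    unfolding fun_space.left_linear_on_def by (simp add: field_simps)
  moreover have "(X (\<psi>, \<phi>) + Y (\<psi>, \<phi>)) / 2 = cnj ((X (\<phi>, \<psi>) + Y (\<phi>, \<psi>)) / 2)"
    if "\<phi> \<in> W" "\<psi> \<in> W" for \<phi> \<psi>
    unfolding sesq_cnj[OF formsD(1)[OF X] that] sesq_cnj[OF formsD(1)[OF Y] that] by simp
  moreover have "l \<le> Re ((X (\<phi>, \<phi>) + Y (\<phi>, \<phi>)) / 2) \<and> Re ((X (\<phi>, \<phi>) + Y (\<phi>, \<phi>)) / 2) \<le> u"
    if "\<phi> \<in> W" "orbit_bounds \<phi> l u" for \<phi> l u
    using formsD(3,4)[OF X that] formsD(3,4)[OF Y that] by simp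
  ultimately show ?thesis
    unfolding forms_def sesq_def using formsD(2)[OF X] formsD(2)[OF Y] by auto
qed

definition translate ::
  "('v \<Rightarrow> 'v) \<Rightarrow> (('v \<Rightarrow> complex) \<times> ('v \<Rightarrow> complex) \<Rightarrow> complex) \<Rightarrow>
   ('v \<Rightarrow> complex) \<times> ('v \<Rightarrow> complex) \<Rightarrow> complex" where
  "translate k X = (\<lambda>(\<phi>, \<psi>). if \<phi> \<in> W \<and> \<psi> \<in> W then X (\<phi> \<circ> k, \<psi> \<circ> k) else 0)"

text \<open>The bounds refer to the whole K-orbit of \<phi>, so they are the same for \<phi> and for
  its pullback by k.\<close>

lemma translate_forms:
  assumes X: "X \<in> forms" and k: "k \<in> K"
  shows "translate k X \<in> forms"
proof -
  note L = sesq_left[OF formsD(1)[OF X]] and P = pullback_dual[OF k]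
  have comb: "fscale a \<phi> + \<eta> \<in> W" if "\<phi> \<in> W" "\<eta> \<in> W" for a \<phi> \<eta>
    using that fun_space.subspace_add[OF subspace_dual] fun_space.subspace_scale[OF subspace_dual] by blast
  have "(fscale a \<phi> + \<eta>) \<circ> k = fscale a (\<phi> \<circ> k) + (\<eta> \<circ> k)" for a \<phi> \<eta>
    by (auto simp: fscale_def)
  then have "fun_space.left_linear_on W (\<lambda>\<phi> \<psi>. translate k X (\<phi>, \<psi>))"
    using L P comb unfolding fun_space.left_linear_on_def translate_def by simp
  moreover have "translate k X (\<psi>, \<phi>) = cnj (translate k X (\<phi>, \<psi>))" if "\<phi> \<in> W" "\<psi> \<in> W" for \<phi> \<psi>
    using sesq_cnj[OF formsD(1)[OF X] P[OF that(1)] P[OF that(2)]] that by (simp add: translate_def)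
  moreover have "l \<le> Re (translate k X (\<phi>, \<phi>)) \<and> Re (translate k X (\<phi>, \<phi>)) \<le> u"
    if \<phi>: "\<phi> \<in> W" and b: "orbit_bounds \<phi> l u" for \<phi> l u
  proof -
    have "(\<phi> \<circ> k) \<circ> inverse_map k = \<phi>" by (simp add: comp_assoc inverse_map_comp[OF k])
    then have "orbit_bounds (\<phi> \<circ> k) l u"
      using orbit_bounds_pullback[OF K_inverse[OF k], of "\<phi> \<circ> k"] b by simp
    then show ?thesis using formsD(3,4)[OF X P[OF \<phi>]] \<phi> by (simp add: translate_def)
  qed
  moreover have "translate k X z = 0" if "z \<notin> W \<times> W" for z
    using that by (cases z) (auto simp: translate_def)
  ultimately show ?thesis unfolding forms_def sesq_def by blast
qed

text \<open>Kakutani's fixed point argument: by strict convexity of the Hilbert-Schmidt norm there is a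
  unique form whose orbit has least possible radius, so that form is invariant.\<close>
theorem invariant_hermitian_form:
  obtains H where "fun_space.hermitian_on W H"
    "\<And>k \<phi> \<psi>. k \<in> K \<Longrightarrow> \<phi> \<in> W \<Longrightarrow> \<psi> \<in> W \<Longrightarrow> H (\<phi> \<circ> k) (\<psi> \<circ> k) = H \<phi> \<psi>"
proof -
  define radii where "radii = {u. \<exists>X\<in>forms. \<forall>k\<in>K. orbit_norm X k \<le> u}"
  define s where "s = Inf radii"
  have "radii \<noteq> {}"
    using base_form_forms orbit_norm_attains(2)[OF sesq_base_form] unfolding radii_def by blast
  have lower: "0 \<le> u" if "u \<in> radii" for u
    using that K_id orbit_norm_nonneg[of _ id] unfolding radii_def by (blast intro: order_trans)
  then have bdd: "bdd_below radii" by (rule bdd_belowI)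
  \<comment> \<open>The radius is a supremum over K, so its sublevel sets are closed as
    intersections; decreasing in n and met with the compact \<open>forms\<close>, they contain a
    form of least radius.\<close>
  define T where "T n = {X. \<forall>k\<in>K. orbit_norm X k \<le> s + 1 / real (Suc n)}" for n
  have closedT: "closed (T n)" for n
  proof -
    have "T n = (\<Inter>k\<in>K. {X. orbit_norm X k \<le> s + 1 / real (Suc n)})" by (auto simp: T_def)
    also have "closed \<dots>"
      unfolding orbit_norm_def by (intro closed_INT ballI closed_Collect_le continuous_intros)
    finally show ?thesis .
  qed
  have fip: "forms \<inter> (\<Inter>n\<in>I. T n) \<noteq> {}" if "finite I" for I
  proof -
    define m where "m = (if I = {} then 0 else Max I)"
    have m: "n \<le> m" if "n \<in> I" for n using that \<open>finite I\<close> by (auto simp: m_def)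
    have "s < s + 1 / real (Suc m)" by simp
    then obtain u where "u \<in> radii" "u < s + 1 / real (Suc m)"
      using cInf_lessD[OF \<open>radii \<noteq> {}\<close>] unfolding s_def by blast
    then obtain X where X: "X \<in> forms" "\<forall>k\<in>K. orbit_norm X k \<le> s + 1 / real (Suc m)"
      unfolding radii_def by force
    have "X \<in> T n" if "n \<in> I" for n
    proof -
      have "1 / real (Suc m) \<le> 1 / real (Suc n)" using m[OF that] by (simp add: frac_le)
      then show ?thesis using X(2) unfolding T_def by force
    qed
    then show ?thesis using X(1) by blast
  qed
  have "forms \<inter> (\<Inter>n\<in>UNIV. T n) \<noteq> {}"
    by (rule compact_imp_fip_image[OF compact_forms closedT fip])
  then obtain X where X: "X \<in> forms" "\<And>n. X \<in> T n" by blast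
  have min: "orbit_norm X k \<le> s" if "k \<in> K" for k
  proof (rule field_le_epsilon)
    fix e :: real assume "0 < e"
    then obtain n where "inverse (real (Suc n)) < e" using reals_Archimedean by blast
    then show "orbit_norm X k \<le> s + e" using X(2)[of n] that unfolding T_def by (force simp: inverse_eq_divide)
  qed
  have unique: "Y (\<phi>, \<psi>) = X (\<phi>, \<psi>)"
    if Y: "Y \<in> forms" "\<And>k. k \<in> K \<Longrightarrow> orbit_norm Y k \<le> s" and W: "\<phi> \<in> W" "\<psi> \<in> W" for Y \<phi> \<psi>
  proof -
    let ?D = "\<lambda>z. X z - Y z" and ?M = "\<lambda>z. (X z + Y z) / 2"
    have D: "sesq ?D" using sesq_diff formsD(1) X(1) Y(1) by blast
    \<comment> \<open>Choosing k with the least difference norm makes the gain of the midpoint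
      uniform along the orbit; a positive gain would contradict the choice of s.\<close>
    obtain k where k: "k \<in> K" "\<forall>k'\<in>K. orbit_norm ?D k \<le> orbit_norm ?D k'"
      using orbit_norm_attains(1)[OF D] by blast
    have "orbit_norm ?M k' \<le> s - orbit_norm ?D k / 4" if "k' \<in> K" for k'
      using orbit_norm_midpoint[of X Y k'] min[OF that] Y(2)[OF that] k(2) that by fastforce
    then have "s - orbit_norm ?D k / 4 \<in> radii"
      using forms_midpoint[OF X(1) Y(1)] unfolding radii_def by blast
    then have "s \<le> s - orbit_norm ?D k / 4" unfolding s_def by (rule cInf_lower[OF _ bdd])
    then have "orbit_norm ?D k = 0" using orbit_norm_nonneg[of ?D k] by linarith
    then show ?thesis using orbit_norm_zero[OF D k(1) _ W] by simp
  qed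
  have inv: "X (\<phi> \<circ> k, \<psi> \<circ> k) = X (\<phi>, \<psi>)" if k: "k \<in> K" and W: "\<phi> \<in> W" "\<psi> \<in> W" for k \<phi> \<psi>
  proof -
    have "orbit_norm (translate k X) k' \<le> s" if k': "k' \<in> K" for k'
    proof -
      \<comment> \<open>The translate stays within the orbit of X, so its radius is at most s and
        uniqueness equates it with X.\<close>
      have "orbit_norm (translate k X) k' = orbit_norm X (k' \<circ> k)"
        unfolding orbit_norm_def translate_def by (simp add: pullback_dual[OF k' coord_dual] comp_assoc)
      then show ?thesis using min[OF K_comp[OF k' k]] by simp
    qed
    then have "translate k X (\<phi>, \<psi>) = X (\<phi>, \<psi>)" by (rule unique[OF translate_forms[OF X(1) k] _ W])
    then show ?thesis using W by (simp add: translate_def)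
  qed
  have "fun_space.hermitian_on W (\<lambda>\<phi> \<psi>. X (\<phi>, \<psi>))"
    unfolding fun_space.hermitian_on_def
  proof (intro conjI ballI impI)
    show "fun_space.left_linear_on W (\<lambda>\<phi> \<psi>. X (\<phi>, \<psi>))" by (rule sesq_left[OF formsD(1)[OF X(1)]])
    show "X (\<psi>, \<phi>) = cnj (X (\<phi>, \<psi>))" if "\<phi> \<in> W" "\<psi> \<in> W" for \<phi> \<psi>
      by (rule sesq_cnj[OF formsD(1)[OF X(1)] that])
    fix \<phi> :: "'v \<Rightarrow> complex" assume "\<phi> \<in> W" "\<phi> \<noteq> 0"
    \<comment> \<open>Compactness of K gives a positive lower bound on the orbit, which every member
      of \<open>forms\<close> inherits.\<close>
    obtain l u where "0 < l" "orbit_bounds \<phi> l u"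
      using orbit_bounds_exist(2)[OF \<open>\<phi> \<in> W\<close> \<open>\<phi> \<noteq> 0\<close>] by auto
    then show "0 < Re (X (\<phi>, \<phi>))" using formsD(3)[OF X(1) \<open>\<phi> \<in> W\<close>] by fastforce
  qed
  then show ?thesis using that inv by blast
qed

end

section \<open>The product formula\<close>

context compact_symplectic_action
begin

lemma symplectic_on_dual: "fun_space.symplectic_on W \<pi>"
  unfolding fun_space.symplectic_on_def fun_space.bilinear_on_def
proof (intro conjI ballI allI impI)
  note S = symplectic[unfolded symplectic_def]
  note add = S[THEN conjunct1, rule_format] and scale = S[THEN conjunct2, THEN conjunct1, rule_format]
  fix \<phi> \<eta> \<psi> a assume W: "\<phi> \<in> W" "\<eta> \<in> W" "\<psi> \<in> W"
  have s: "fscale a \<phi> \<in> W" by (rule fun_space.subspace_scale[OF subspace_dual W(1)])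
  have "\<pi> (fscale a \<phi> + \<eta>) \<psi> = \<pi> (fscale a \<phi>) \<psi> + \<pi> \<eta> \<psi>"
    "\<pi> \<psi> (fscale a \<phi> + \<eta>) = \<pi> \<psi> (fscale a \<phi>) + \<pi> \<psi> \<eta>"
    using add[OF s W(2,3)] by blast+
  moreover have "\<pi> (fscale a \<phi>) \<psi> = a * \<pi> \<phi> \<psi>" "\<pi> \<psi> (fscale a \<phi>) = a * \<pi> \<psi> \<phi>"
    using scale[OF W(1,3)] scale[OF W(3,1)] by blast+
  ultimately show "\<pi> (fscale a \<phi> + \<eta>) \<psi> = a * \<pi> \<phi> \<psi> + \<pi> \<eta> \<psi>"
    "\<pi> \<psi> (fscale a \<phi> + \<eta>) = a * \<pi> \<psi> \<phi> + \<pi> \<psi> \<eta>" by simp_all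
next
  note S = symplectic[unfolded symplectic_def]
  show "\<pi> \<phi> \<phi> = 0" if "\<phi> \<in> W" for \<phi>
    using S[THEN conjunct2, THEN conjunct2, THEN conjunct1] that by blast
  show "\<phi> = 0" if "\<phi> \<in> W" "\<forall>\<psi>\<in>W. \<pi> \<phi> \<psi> = 0" for \<phi>
    using S[THEN conjunct2, THEN conjunct2, THEN conjunct2] that by blast
qed

text \<open>Links the annihilator of the invariants to Im (1 - A), on which the linear algebra is
  based. Solving for \<eta> means factoring \<phi> through T, which maps v to v minus its preimage
  under k; this works because \<phi> vanishes on ker T, the invariants of k.\<close>

lemma inv_perp_eq:
  assumes k: "k \<in> K"
  shows "inv_perp scl k = (\<lambda>\<phi>. \<phi> - dual_act k \<phi>) ` W"
proof (intro equalityI subsetI)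
  fix \<phi> assume "\<phi> \<in> inv_perp scl k"
  then have \<phi>: "\<phi> \<in> W" and 0: "\<And>v. k v = v \<Longrightarrow> \<phi> v = 0" by (auto simp: inv_perp_def invariants_def)
  define T where "T v = v - inverse_map k v" for v
  note k' = K_inverse[OF k]
  interpret VV: vector_space_pair scl scl ..
  have "Vector_Spaces.linear scl scl T"
    using V.vector_space_axioms
    by (simp add: Vector_Spaces.linear_iff T_def K_add[OF k'] K_scale[OF k'] V.scale_right_diff_distrib)
  \<comment> \<open>With a generalised inverse s of T, the vector v - s (T v) lies in ker T, so
    \<phi> composed with s is the wanted factor.\<close>
  then obtain s where s: "Vector_Spaces.linear scl scl s" "\<And>v. T (s (T v)) = T v"
    using VV.linear_exists_right_inverse_on[of T UNIV] V.subspace_UNIV by blast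
  have s_lin: "s (x + y) = s x + s y" "s (scl c x) = scl c (s x)" for x y c
    using s(1) by (auto simp: Vector_Spaces.linear_iff)
  have T_diff: "T (x - y) = T x - T y" for x y
    using K_add[OF k', of "x - y" y] by (simp add: T_def algebra_simps)
  define \<eta> where "\<eta> = \<phi> \<circ> s"
  have \<eta>: "\<eta> \<in> W" unfolding dual_iff[of \<eta>] by (simp add: \<eta>_def s_lin dual_add[OF \<phi>] dual_scale[OF \<phi>])
  have "\<phi> v = (\<eta> - dual_act k \<eta>) v" for v
  proof -
    let ?w = "v - s (T v)"
    have "T ?w = 0" by (simp add: T_diff s(2))
    then have "inverse_map k ?w = ?w" by (simp add: T_def)
    then have "k ?w = ?w" using inverse_map(1)[OF k, of ?w] by simp
    then have "\<phi> v = \<eta> (T v)" using 0[of ?w] dual_diff[OF \<phi>, of v "s (T v)"] by (simp add: \<eta>_def)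
    also have "\<dots> = (\<eta> - dual_act k \<eta>) v" using dual_diff[OF \<eta>] by (simp add: T_def dual_act_def)
    finally show ?thesis .
  qed
  then have "\<phi> = \<eta> - dual_act k \<eta>" by blast
  then show "\<phi> \<in> (\<lambda>\<phi>. \<phi> - dual_act k \<phi>) ` W" using \<eta> by blast
next
  fix \<phi> assume "\<phi> \<in> (\<lambda>\<phi>. \<phi> - dual_act k \<phi>) ` W"
  then obtain \<eta> where \<eta>: "\<eta> \<in> W" "\<phi> = \<eta> - dual_act k \<eta>" by blast
  have "dual_act k \<eta> \<in> W" unfolding dual_act_def by (rule pullback_dual[OF K_inverse[OF k] \<eta>(1)])
  then have "\<phi> \<in> W" using \<eta> fun_space.subspace_diff[OF subspace_dual] by blast
  moreover have "\<phi> v = 0" if "k v = v" for v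
    using inverse_map(2)[OF k, of v] that by (simp add: \<eta>(2) dual_act_def)
  ultimately show "\<phi> \<in> inv_perp scl k" by (simp add: inv_perp_def invariants_def)
qed

lemma dual_act_comp:
  assumes "g \<in> K" "h \<in> K"
  shows "dual_act (g \<circ> h) = (\<lambda>\<phi>. dual_act g (dual_act h \<phi>))"
  by (intro ext) (simp add: dual_act_def o_inv_distrib[OF K_bij[OF assms(1)] K_bij[OF assms(2)]])

theorem mu_comp:
  assumes g: "g \<in> K" and h: "h \<in> K"
    and sum: "{u + v | u v. u \<in> invariants g \<and> v \<in> invariants h} = UNIV"
  shows "inv_perp scl (g \<circ> h) = {\<phi> + \<psi> | \<phi> \<psi>. \<phi> \<in> inv_perp scl g \<and> \<psi> \<in> inv_perp scl h}"
    and "inv_perp scl g \<inter> inv_perp scl h = {0}"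
    and "set xs \<subseteq> inv_perp scl (g \<circ> h) \<Longrightarrow> mu scl \<pi> (g \<circ> h) xs =
      wedge (extend_form \<pi> (inv_perp scl g) (mu scl \<pi> g))
            (extend_form \<pi> (inv_perp scl h) (mu scl \<pi> h)) xs"
proof -
  obtain H where H: "fun_space.hermitian_on W H"
    and H_inv: "\<And>k \<phi> \<psi>. k \<in> K \<Longrightarrow> \<phi> \<in> W \<Longrightarrow> \<psi> \<in> W \<Longrightarrow> H (\<phi> \<circ> k) (\<psi> \<circ> k) = H \<phi> \<psi>"
    using invariant_hermitian_form by blast
  interpret U: unitary_symplectic_space fscale W "coord ` Basis" \<pi> H
    by unfold_locales
      (use subspace_dual V.finite_Basis dual_subset_span symplectic_on_dual H in auto)
  \<comment> \<open>\<open>dual_act k\<close> is the pullback by the inverse of k, which again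
    belongs to K and so preserves both \<pi> and H; its own inverse is the pullback by k.\<close>
  have isometry: "U.isometry (dual_act k) (\<lambda>\<phi>. \<phi> \<circ> k)" if k: "k \<in> K" for k
    unfolding U.isometry_def fun_space.linear_on_def dual_act_def
    using pullback_dual[OF k] pullback_dual[OF K_inverse[OF k]] K_pi[OF K_inverse[OF k]] H_inv[OF K_inverse[OF k]]
    by (auto simp: fun_eq_iff fscale_def inverse_map[OF k])
  have moved: "U.moved (dual_act k) = inv_perp scl k" if "k \<in> K" for k
    unfolding U.moved_def inv_perp_eq[OF that] ..
  have gh: "g \<circ> h \<in> K" by (rule K_comp[OF g h])
  have movedAB: "U.moved (\<lambda>\<phi>. dual_act g (dual_act h \<phi>)) = inv_perp scl (g \<circ> h)"
    using moved[OF gh] unfolding dual_act_comp[OF g h] .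
  \<comment> \<open>The hypothesis V_g + V_h = V in dual form: a functional that kills both
    subspaces is 0.\<close>
  show disj: "inv_perp scl g \<inter> inv_perp scl h = {0}"
  proof (intro equalityI subsetI)
    fix \<phi> assume "\<phi> \<in> inv_perp scl g \<inter> inv_perp scl h"
    then have \<phi>: "\<phi> \<in> W" "\<And>v. v \<in> invariants g \<Longrightarrow> \<phi> v = 0" "\<And>v. v \<in> invariants h \<Longrightarrow> \<phi> v = 0"
      by (auto simp: inv_perp_def)
    have "\<phi> w = 0" for w
    proof -
      have "w \<in> {u + v | u v. u \<in> invariants g \<and> v \<in> invariants h}" using sum by simp
      then obtain u v where "w = u + v" "u \<in> invariants g" "v \<in> invariants h" by blast
      then show ?thesis using \<phi> dual_add[OF \<phi>(1)] by simp
    qed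
    then show "\<phi> \<in> {0}" by (simp add: fun_eq_iff)
  qed (use fun_space.subspace_0[OF subspace_dual] in \<open>simp add: inv_perp_def\<close>)
  interpret T: transversal_isometries
    where scale = fscale and W = W and S = "coord ` Basis" and \<omega> = \<pi> and H = H
      and A = "dual_act g" and A' = "\<lambda>\<phi>. \<phi> \<circ> g" and B = "dual_act h" and B' = "\<lambda>\<phi>. \<phi> \<circ> h"
    by unfold_locales (use isometry[OF g] isometry[OF h] moved[OF g] moved[OF h] disj in auto)
  show "inv_perp scl (g \<circ> h) = {\<phi> + \<psi> | \<phi> \<psi>. \<phi> \<in> inv_perp scl g \<and> \<psi> \<in> inv_perp scl h}"
    using T.U_eq unfolding movedAB moved[OF g] moved[OF h] .
  assume "set xs \<subseteq> inv_perp scl (g \<circ> h)"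
  then have "set xs \<subseteq> T.U" unfolding movedAB .
  then have formula: "csqrt (det_on fscale T.U (\<lambda>\<phi>. \<phi> - dual_act g (dual_act h \<phi>))) * U.volume T.U xs =
    wedge (\<lambda>l. csqrt (det_on fscale T.UA (\<lambda>\<phi>. \<phi> - dual_act g \<phi>)) * U.volume T.UA (map (U.proj (dual_act g)) l))
          (\<lambda>l. csqrt (det_on fscale T.UB (\<lambda>\<phi>. \<phi> - dual_act h \<phi>)) * U.volume T.UB (map (U.proj (dual_act h)) l)) xs"
    by (rule T.product_formula)
  \<comment> \<open>On the annihilator, \<open>volume\<close> is \<open>psi\<close>, because
    \<open>half_dim\<close> is half its dimension; the formula can thus be read in terms of
    \<open>mu\<close>.\<close>
  have mu: "mu scl \<pi> k = (\<lambda>l. csqrt (det_on fscale (inv_perp scl k) (\<lambda>\<phi>. \<phi> - dual_act k \<phi>)) *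
      U.volume (inv_perp scl k) l)" for k
    by (intro ext) (simp add: mu_def psi_def U.volume_def half_dim_def)
  show "mu scl \<pi> (g \<circ> h) xs =
      wedge (extend_form \<pi> (inv_perp scl g) (mu scl \<pi> g))
            (extend_form \<pi> (inv_perp scl h) (mu scl \<pi> h)) xs"
    unfolding mu extend_form_def[abs_def] dual_act_comp[OF g h]
    using formula unfolding movedAB moved[OF g] moved[OF h] .
qed

end

theorem theoremC1:
  fixes scl :: "complex \<Rightarrow> 'v::ab_group_add \<Rightarrow> 'v"
    and Basis :: "'v set"
    and \<pi> :: "('v \<Rightarrow> complex) \<Rightarrow> ('v \<Rightarrow> complex) \<Rightarrow> complex"
    and K :: "('v \<Rightarrow> 'v) set"
    and g h :: "'v \<Rightarrow> 'v"
  assumes "finite_dimensional_vector_space scl Basis"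
    and "symplectic scl \<pi>"
    and "compact_subgroup_Sp scl \<pi> K"
    and "g \<in> K" and "h \<in> K"
    and "{u + v | u v. u \<in> invariants g \<and> v \<in> invariants h} = UNIV"
  shows "inv_perp scl (g \<circ> h) = {\<phi> + \<psi> | \<phi> \<psi>. \<phi> \<in> inv_perp scl g \<and> \<psi> \<in> inv_perp scl h} \<and>
         inv_perp scl g \<inter> inv_perp scl h = {0} \<and>
         (\<forall>xs. set xs \<subseteq> inv_perp scl (g \<circ> h) \<longrightarrow>
            mu scl \<pi> (g \<circ> h) xs =
            wedge (extend_form \<pi> (inv_perp scl g) (mu scl \<pi> g))
                  (extend_form \<pi> (inv_perp scl h) (mu scl \<pi> h)) xs)"
proof -
  interpret compact_symplectic_action scl Basis \<pi> K
    by (rule compact_symplectic_action.intro[OF assms(1-3)])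
  show ?thesis using mu_comp[OF assms(4-6)] by blast
qed

end
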